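(* Let $p>2$, $\lambda>0$, let $\Gamma\in W^{2,p}(\mathbb{R}/L\mathbb{Z},\mathbb{R}^n)$ be parametrised by arc-length, and let $\tilde\gamma\in C^\infty(\mathbb{R}/L\mathbb{Z},\mathbb{R}^n)$ be parametrised by arc-length with unit quasi-tangent $\tau$. Let $0<T<\infty$ and let $$\phi\in L^\infty\big([0,T),W^{2,p}(\mathbb{R}/L\mathbb{Z},\mathbb{R}^n)\big)\cap W^{1,2}\big([0,T),L^2(\mathbb{R}/L\mathbb{Z},\mathbb{R}^n)\big)\cap C^{1/2}\big([0,T),L^2(\mathbb{R}/L\mathbb{Z},\mathbb{R}^n)\big)$$ be orthogonal to $\tau$ (i.e. $\langle\phi(t,x),\tau(x)\rangle=0$), such that the curves $\gamma(t,x)=\tilde\gamma(x)+\phi(t,x)$, $0\le t<T$, satisfy $\langle\partial_x\gamma(t,x),\tau(x)\rangle\ge\frac12$, the initial condition $\gamma(0,\cdot)=\Gamma\circ\sigma$ for some reparametrisation $\sigma$ of $\mathbb{R}/L\mathbb{Z}$, and $$\int_0^T\int_{\mathbb{R}/L\mathbb{Z}}\langle\partial_t^\bot\gamma,\psi\rangle\,ds\,dt=-\int_0^T\delta_{\psi_t}E(\gamma_t)\,dt\qquad( * )$$ for all test functions $\psi\in C_c^\infty((0,T)\times\mathbb{R}/L\mathbb{Z},\mathbb{R}^n)$ that are orthogonal to $\tau$. If $\gamma(t,\cdot)$ belongs to $W^{3,p}(\mathbb{R}/L\mathbb{Z},\mathbb{R}^n)$ for almost all $0\le t<T$, then $( *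 )$ holds for all test functions $\psi\in C_c^\infty((0,T)\times\mathbb{R}/L\mathbb{Z},\mathbb{R}^n)$.
   Context: The dimension $n$ is fixed. For a regular curve $\gamma\in W^{2,p}(\mathbb{R}/L\mathbb{Z},\mathbb{R}^n)$ (regular: $\gamma'=\partial_x\gamma$ never vanishes), $ds=|\partial_x\gamma|\,dx$ is the arc-length element, $\partial_s=|\partial_x\gamma|^{-1}\partial_x$, $\kappa=\partial_s^2\gamma$ is the curvature vector, and $$E(\gamma)=\frac1p\int_{\mathbb{R}/L\mathbb{Z}}|\kappa|^p\,ds+\lambda\int_{\mathbb{R}/L\mathbb{Z}}ds .$$ The first variation is $\delta_\psi E(\gamma)=\frac{d}{d\varepsilon}E(\gamma+\varepsilon\psi)|_{\varepsilon=0}$. We write $\gamma_t=\gamma(t,\cdot)$, $\psi_t=\psi(t,\cdot)$. In $( * )$, $ds$ is the arc-length element of $\gamma_t$ and $\partial_t^\bot\gamma=\partial_t\gamma-\langle\partial_t\gamma,\tfrac{\gamma'}{|\gamma'|}\rangle\tfrac{\gamma'}{|\gamma'|}$ is the normal velocity (the component of $\partial_t\gamma$ orthogonal to $\partial_x\gamma$). A reparametrisation of $\mathbb{R}/L\mathbb{Z}$ is a $C^1$-diffeomorphism of $\mathbb{R}/L\mathbb{Z}$. Unit quasi-tangent. Fix a mollifier $\eta\in C^\infty(\mathbb{R})$, i.e. $\eta\ge0$, $\eta(x)=0$ for $|x|\ge1$, $\int\eta=1$, and let $\eta_\varepsilon(x)=\frac1\varepsilon\eta(\frac x\varepsilon)$.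 For a $W^{2,p}$-curve $\gamma:\mathbb{R}/\mathbb{Z}\to\mathbb{R}^n$ parametrised by arc-length with $\|\gamma'\|_{W^{1,p}}\le M$, let $\gamma_\varepsilon=\gamma*\eta_\varepsilon$. There is $\varepsilon=\varepsilon(p,M)>0$ such that for all such curves $\gamma_\varepsilon'$ never vanishes and the smooth map $\tau=\gamma_\varepsilon'/|\gamma_\varepsilon'|$ satisfies $\|\tau-\gamma'\|_{L^\infty}\le\frac14$; $\tau$ is then called a unit quasi-tangent to $\gamma$. For a curve $\gamma$ of length $L$ parametrised by arc-length on $\mathbb{R}/L\mathbb{Z}$ the notion is obtained by scaling: $\tau$ is a unit quasi-tangent to $\gamma$ if $x\mapsto\tau(Lx)$ is a unit quasi-tangent to the unit-length curve $x\mapsto L^{-1}\gamma(Lx)$. *)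

theory Defs
  imports "HOL-Analysis.Analysis" "HOL-Library.Periodic_Fun"
begin

text \<open>
  Functions on the circle of length \<open>L\<close> are represented by \<open>L\<close>-periodic functions on the
  real line; integrals over the circle are Lebesgue integrals over \<open>{0..L}\<close>.
\<close>

section \<open>Functions of class \<open>C\<^sup>k\<close>\<close>

primrec Ck :: "nat \<Rightarrow> ('a::real_normed_vector \<Rightarrow> 'b::real_normed_vector) \<Rightarrow> bool" where
  "Ck 0 f \<longleftrightarrow> continuous_on UNIV f"
| "Ck (Suc k) f \<longleftrightarrow>
     (\<forall>x. f differentiable (at x)) \<and> (\<forall>v. Ck k (\<lambda>x. frechet_derivative f (at x) v))"

definition smooth :: "('a::real_normed_vector \<Rightarrow> 'b::real_normed_vector) \<Rightarrow> bool" where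
  "smooth f \<longleftrightarrow> (\<forall>k. Ck k f)"

text \<open>
  A \<open>C\<^sup>1\<close>-diffeomorphism of the circle, given by a lift to the real line; the two signs are
  the orientation-preserving and the orientation-reversing case.
\<close>
definition reparametrisation :: "real \<Rightarrow> (real \<Rightarrow> real) \<Rightarrow> bool" where
  "reparametrisation L \<sigma> \<longleftrightarrow>
     bij \<sigma> \<and> Ck 1 \<sigma> \<and> Ck 1 (inv \<sigma>) \<and>
     ((\<forall>x. \<sigma> (x + L) = \<sigma> x + L) \<or> (\<forall>x. \<sigma> (x + L) = \<sigma> x - L))"


section \<open>Lebesgue and Sobolev spaces on the circle\<close>

definition Lp :: "real \<Rightarrow> real \<Rightarrow> (real \<Rightarrow> 'a::euclidean_space) set" where
  "Lp L p = {f. periodic_fun_simple f L \<and> f \<in> borel_measurable (lebesgue_on {0..L}) \<and>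
                integrable (lebesgue_on {0..L}) (\<lambda>x. norm (f x) powr p)}"

definition Lp_norm :: "real \<Rightarrow> real \<Rightarrow> (real \<Rightarrow> 'a::euclidean_space) \<Rightarrow> real" where
  "Lp_norm L p f = (\<integral>x. norm (f x) powr p \<partial>lebesgue_on {0..L}) powr (1 / p)"

definition weak_deriv ::
    "real \<Rightarrow> (real \<Rightarrow> 'a::euclidean_space) \<Rightarrow> (real \<Rightarrow> 'a) \<Rightarrow> bool" where
  "weak_deriv L f g \<longleftrightarrow>
     periodic_fun_simple f L \<and> integrable (lebesgue_on {0..L}) f \<and>
     periodic_fun_simple g L \<and> integrable (lebesgue_on {0..L}) g \<and>
     (\<forall>\<zeta>::real \<Rightarrow> real. smooth \<zeta> \<and> periodic_fun_simple \<zeta> L \<longrightarrow>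
        (\<integral>x. deriv \<zeta> x *\<^sub>R f x \<partial>lebesgue_on {0..L}) =
        - (\<integral>x. \<zeta> x *\<^sub>R g x \<partial>lebesgue_on {0..L}))"

text \<open>The weak derivative is unique only up to null sets; an arbitrary representative is chosen.\<close>
definition wderiv :: "real \<Rightarrow> (real \<Rightarrow> 'a::euclidean_space) \<Rightarrow> real \<Rightarrow> 'a" where
  "wderiv L f = (SOME g. weak_deriv L f g)"

primrec sobolev :: "real \<Rightarrow> nat \<Rightarrow> real \<Rightarrow> (real \<Rightarrow> 'a::euclidean_space) set" where
  "sobolev L 0 p = Lp L p"
| "sobolev L (Suc k) p = {f \<in> Lp L p. \<exists>g \<in> sobolev L k p. weak_deriv L f g}"

definition sobolev_norm :: "real \<Rightarrow> nat \<Rightarrow> real \<Rightarrow> (real \<Rightarrow> 'a::euclidean_space) \<Rightarrow> real" where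
  "sobolev_norm L k p f = (\<Sum>j\<le>k. Lp_norm L p ((wderiv L ^^ j) f))"

text \<open>
  For \<open>k \<ge> 1\<close> every class in \<open>W\<^bsup>k,p\<^esup>\<close> has exactly one continuous representative, which is
  then of class \<open>C\<^bsup>k-1\<^esup>\<close>. Curves are always represented in this way, so that
  the first derivative of a \<open>W\<^bsup>2,p\<^esup>\<close>-curve is a classical one.
\<close>
definition Wc :: "real \<Rightarrow> nat \<Rightarrow> real \<Rightarrow> (real \<Rightarrow> 'a::euclidean_space) set" where
  "Wc L k p = {f \<in> sobolev L k p. continuous_on UNIV f}"


section \<open>Spaces of functions of time with values in a function space\<close>

text \<open>
  Here \<open>X\<close> is the carrier and \<open>N\<close> the (semi)norm of a space of functions, and \<open>I\<close> is a bounded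
  interval of times. Measurability and integrals are in the sense of Bochner; the definition of
  the integral mirrors that of \<^const>\<open>has_bochner_integral\<close>, which is
  available only for values in a normed vector space type.
\<close>

definition simple_into :: "real set \<Rightarrow> ('x \<Rightarrow> 'v) set \<Rightarrow> (real \<Rightarrow> 'x \<Rightarrow> 'v) \<Rightarrow> bool" where
  "simple_into I X s \<longleftrightarrow> simple_function (lebesgue_on I) s \<and> s ` I \<subseteq> X"

definition simple_integral_into ::
    "real set \<Rightarrow> (real \<Rightarrow> 'x \<Rightarrow> 'v::real_normed_vector) \<Rightarrow> 'x \<Rightarrow> 'v" where
  "simple_integral_into I s =
     (\<lambda>x. \<Sum>y \<in> s ` I. measure lebesgue {t \<in> I. s t = y} *\<^sub>R y x)"

definition bochner_measurable ::
    "real set \<Rightarrow> ('x \<Rightarrow> 'v) set \<Rightarrow> (('x \<Rightarrow> 'v) \<Rightarrow> real) \<Rightarrow>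
     (real \<Rightarrow> 'x \<Rightarrow> 'v::real_normed_vector) \<Rightarrow> bool" where
  "bochner_measurable I X N u \<longleftrightarrow>
     (\<forall>t \<in> I. u t \<in> X) \<and>
     (\<exists>s. (\<forall>k::nat. simple_into I X (s k)) \<and>
          (AE t in lebesgue_on I. (\<lambda>k. N (\<lambda>x. u t x - s k t x)) \<longlonglongrightarrow> 0))"

definition has_bochner_integral_into ::
    "real set \<Rightarrow> ('x \<Rightarrow> 'v) set \<Rightarrow> (('x \<Rightarrow> 'v) \<Rightarrow> real) \<Rightarrow>
     (real \<Rightarrow> 'x \<Rightarrow> 'v::real_normed_vector) \<Rightarrow> ('x \<Rightarrow> 'v) \<Rightarrow> bool" where
  "has_bochner_integral_into I X N u w \<longleftrightarrow>
     bochner_measurable I X N u \<and> w \<in> X \<and>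
     (\<exists>s. (\<forall>k::nat. simple_into I X (s k)) \<and>
          (\<lambda>k. \<integral>\<^sup>+ t. ennreal (N (\<lambda>x. u t x - s k t x)) \<partial>lebesgue_on I) \<longlonglongrightarrow> 0 \<and>
          (\<lambda>k. N (\<lambda>x. simple_integral_into I (s k) x - w x)) \<longlonglongrightarrow> 0)"

definition Linfty_into ::
    "real set \<Rightarrow> ('x \<Rightarrow> 'v) set \<Rightarrow> (('x \<Rightarrow> 'v) \<Rightarrow> real) \<Rightarrow>
     (real \<Rightarrow> 'x \<Rightarrow> 'v::real_normed_vector) set" where
  "Linfty_into I X N =
     {u. bochner_measurable I X N u \<and> (\<exists>C. AE t in lebesgue_on I. N (u t) \<le> C)}"

definition L2_into ::
    "real set \<Rightarrow> ('x \<Rightarrow> 'v) set \<Rightarrow> (('x \<Rightarrow> 'v) \<Rightarrow> real) \<Rightarrow>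
     (real \<Rightarrow> 'x \<Rightarrow> 'v::real_normed_vector) set" where
  "L2_into I X N =
     {u. bochner_measurable I X N u \<and> integrable (lebesgue_on I) (\<lambda>t. (N (u t))\<^sup>2)}"

definition weak_time_deriv ::
    "real set \<Rightarrow> ('x \<Rightarrow> 'v) set \<Rightarrow> (('x \<Rightarrow> 'v) \<Rightarrow> real) \<Rightarrow>
     (real \<Rightarrow> 'x \<Rightarrow> 'v::real_normed_vector) \<Rightarrow> (real \<Rightarrow> 'x \<Rightarrow> 'v) \<Rightarrow> bool" where
  "weak_time_deriv I X N u v \<longleftrightarrow>
     (\<forall>\<zeta>::real \<Rightarrow> real.
        smooth \<zeta> \<and> compact (closure {t. \<zeta> t \<noteq> 0}) \<and> closure {t. \<zeta> t \<noteq> 0} \<subseteq> interior I \<longrightarrow>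
        (\<exists>w. has_bochner_integral_into I X N (\<lambda>t x. deriv \<zeta> t *\<^sub>R u t x) w \<and>
             has_bochner_integral_into I X N (\<lambda>t x. \<zeta> t *\<^sub>R v t x) (\<lambda>x. - w x)))"

definition W12_into ::
    "real set \<Rightarrow> ('x \<Rightarrow> 'v) set \<Rightarrow> (('x \<Rightarrow> 'v) \<Rightarrow> real) \<Rightarrow>
     (real \<Rightarrow> 'x \<Rightarrow> 'v::real_normed_vector) set" where
  "W12_into I X N = {u \<in> L2_into I X N. \<exists>v \<in> L2_into I X N. weak_time_deriv I X N u v}"

definition Holder_into ::
    "real \<Rightarrow> real set \<Rightarrow> ('x \<Rightarrow> 'v) set \<Rightarrow> (('x \<Rightarrow> 'v) \<Rightarrow> real) \<Rightarrow>
     (real \<Rightarrow> 'x \<Rightarrow> 'v::real_normed_vector) set" where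
  "Holder_into \<alpha> I X N =
     {u. (\<forall>t \<in> I. u t \<in> X) \<and>
         (\<exists>C. (\<forall>t \<in> I. N (u t) \<le> C) \<and>
              (\<forall>s \<in> I. \<forall>t \<in> I. N (\<lambda>x. u s x - u t x) \<le> C * \<bar>s - t\<bar> powr \<alpha>))}"

text \<open>The derivative \<open>\<partial>\<^sub>t u\<close> of a function in \<open>W\<^bsup>1,2\<^esup>(I, L\<^sup>2)\<close>, again up to null sets.\<close>
definition time_deriv ::
    "real \<Rightarrow> real set \<Rightarrow> (real \<Rightarrow> real \<Rightarrow> 'a::euclidean_space) \<Rightarrow> real \<Rightarrow> real \<Rightarrow> 'a" where
  "time_deriv L I u =
     (SOME v. v \<in> L2_into I (Lp L 2) (Lp_norm L 2) \<and>
              weak_time_deriv I (Lp L 2) (Lp_norm L 2) u v)"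


section \<open>Curves and their energy\<close>

definition dx :: "(real \<Rightarrow> 'a::euclidean_space) \<Rightarrow> real \<Rightarrow> 'a" where
  "dx \<gamma> x = vector_derivative \<gamma> (at x)"

definition arclength_param :: "(real \<Rightarrow> 'a::euclidean_space) \<Rightarrow> bool" where
  "arclength_param \<gamma> \<longleftrightarrow> (\<forall>x. norm (dx \<gamma> x) = 1)"

definition unit_tangent :: "(real \<Rightarrow> 'a::euclidean_space) \<Rightarrow> real \<Rightarrow> 'a" where
  "unit_tangent \<gamma> x = dx \<gamma> x /\<^sub>R norm (dx \<gamma> x)"

text \<open>
  \<open>\<kappa> = \<partial>\<^sub>s (\<partial>\<^sub>s \<gamma>)\<close>: the inner derivative is classical, the outer one is a weak derivative.
\<close>
definition curvature :: "real \<Rightarrow> (real \<Rightarrow> 'a::euclidean_space) \<Rightarrow> real \<Rightarrow> 'a" where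
  "curvature L \<gamma> x = wderiv L (unit_tangent \<gamma>) x /\<^sub>R norm (dx \<gamma> x)"

definition energy :: "real \<Rightarrow> real \<Rightarrow> real \<Rightarrow> (real \<Rightarrow> 'a::euclidean_space) \<Rightarrow> real" where
  "energy L p lam \<gamma> =
     1 / p * (\<integral>x. norm (curvature L \<gamma> x) powr p * norm (dx \<gamma> x) \<partial>lebesgue_on {0..L})
     + lam * (\<integral>x. norm (dx \<gamma> x) \<partial>lebesgue_on {0..L})"

definition first_variation ::
    "real \<Rightarrow> real \<Rightarrow> real \<Rightarrow> (real \<Rightarrow> 'a::euclidean_space) \<Rightarrow> (real \<Rightarrow> 'a) \<Rightarrow> real" where
  "first_variation L p lam \<psi> \<gamma> = deriv (\<lambda>\<epsilon>. energy L p lam (\<lambda>x. \<gamma> x + \<epsilon> *\<^sub>R \<psi> x)) 0"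

definition normal_velocity ::
    "real \<Rightarrow> real set \<Rightarrow> (real \<Rightarrow> real \<Rightarrow> 'a::euclidean_space) \<Rightarrow> real \<Rightarrow> real \<Rightarrow> 'a" where
  "normal_velocity L I \<gamma> t x =
     time_deriv L I \<gamma> t x
     - (time_deriv L I \<gamma> t x \<bullet> unit_tangent (\<gamma> t) x) *\<^sub>R unit_tangent (\<gamma> t) x"

definition weak_flow_eq ::
    "real \<Rightarrow> real \<Rightarrow> real \<Rightarrow> real \<Rightarrow> (real \<Rightarrow> real \<Rightarrow> 'a::euclidean_space) \<Rightarrow>
     (real \<Rightarrow> real \<Rightarrow> 'a) \<Rightarrow> bool" where
  "weak_flow_eq L T p lam \<gamma> \<psi> \<longleftrightarrow>
     (\<integral>t. (\<integral>x. (normal_velocity L {0..<T} \<gamma> t x \<bullet> \<psi> t x) * norm (dx (\<gamma> t) x)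
              \<partial>lebesgue_on {0..L}) \<partial>lebesgue_on {0..<T}) =
     - (\<integral>t. first_variation L p lam (\<psi> t) (\<gamma> t) \<partial>lebesgue_on {0..<T})"

text \<open>
  \<open>C\<^sub>c\<^sup>\<infinity>((0,T) \<times> \<real>/L\<int>)\<close>, with functions extended by zero to all times. As the circle is compact,
  compactness of the support only concerns the time variable.
\<close>
definition space_time_test ::
    "real \<Rightarrow> real \<Rightarrow> (real \<Rightarrow> real \<Rightarrow> 'a::euclidean_space) \<Rightarrow> bool" where
  "space_time_test L T \<psi> \<longleftrightarrow>
     smooth (\<lambda>(t, x). \<psi> t x) \<and> (\<forall>t. periodic_fun_simple (\<psi> t) L) \<and>
     closure {t. \<exists>x. \<psi> t x \<noteq> 0} \<subseteq> {0<..<T}"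


section \<open>Unit quasi-tangents\<close>

definition mollifier :: "(real \<Rightarrow> real) \<Rightarrow> bool" where
  "mollifier \<eta> \<longleftrightarrow>
     smooth \<eta> \<and> (\<forall>x. \<eta> x \<ge> 0) \<and> (\<forall>x. \<bar>x\<bar> \<ge> 1 \<longrightarrow> \<eta> x = 0) \<and> (\<integral>x. \<eta> x \<partial>lebesgue) = 1"

definition mollify ::
    "(real \<Rightarrow> real) \<Rightarrow> real \<Rightarrow> (real \<Rightarrow> 'a::euclidean_space) \<Rightarrow> real \<Rightarrow> 'a" where
  "mollify \<eta> \<epsilon> \<gamma> x = (\<integral>y. (1 / \<epsilon> * \<eta> (y / \<epsilon>)) *\<^sub>R \<gamma> (x - y) \<partial>lebesgue)"

definition unit_length_curves :: "real \<Rightarrow> real \<Rightarrow> (real \<Rightarrow> 'a::euclidean_space) set" where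
  "unit_length_curves p M =
     {\<gamma> \<in> Wc 1 2 p. arclength_param \<gamma> \<and> sobolev_norm 1 1 p (dx \<gamma>) \<le> M}"

text \<open>
  The scale \<open>\<epsilon>\<close> has to work for the whole class of curves with the bound \<open>M\<close>, not just for the
  given curve; any such scale and any bound for the given curve are admitted.
\<close>
definition unit_length_quasi_tangent ::
    "(real \<Rightarrow> real) \<Rightarrow> real \<Rightarrow> (real \<Rightarrow> 'a::euclidean_space) \<Rightarrow> (real \<Rightarrow> 'a) \<Rightarrow> bool" where
  "unit_length_quasi_tangent \<eta> p \<gamma> \<tau> \<longleftrightarrow>
     (\<exists>M. \<exists>\<epsilon>>0. \<gamma> \<in> unit_length_curves p M \<and>
        (\<forall>\<beta> \<in> (unit_length_curves p M :: (real \<Rightarrow> 'a) set). \<forall>x.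
           dx (mollify \<eta> \<epsilon> \<beta>) x \<noteq> 0 \<and>
           norm (unit_tangent (mollify \<eta> \<epsilon> \<beta>) x - dx \<beta> x) \<le> 1 / 4) \<and>
        \<tau> = unit_tangent (mollify \<eta> \<epsilon> \<gamma>))"

definition unit_quasi_tangent ::
    "(real \<Rightarrow> real) \<Rightarrow> real \<Rightarrow> real \<Rightarrow> (real \<Rightarrow> 'a::euclidean_space) \<Rightarrow> (real \<Rightarrow> 'a) \<Rightarrow> bool" where
  "unit_quasi_tangent \<eta> p L \<gamma> \<tau> \<longleftrightarrow>
     unit_length_quasi_tangent \<eta> p (\<lambda>x. \<gamma> (L * x) /\<^sub>R L) (\<lambda>x. \<tau> (L * x))"

end

theory Submission
  imports Defs
begin

text \<open>
  The energy of a regular curve of class \<open>C\<^sup>2\<close> is \<open>\<integral> F(\<gamma>', \<gamma>'') dx\<close> with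
  \<open>F(u, a) = 1/p (|u|\<^sup>2|a|\<^sup>2 - (u \<bullet> a)\<^sup>2)\<^bsup>p/2\<^esup> |u|\<^bsup>1-3p\<^esup> + \<lambda>|u|\<close>, and its first variation in
  direction \<open>X\<close> is \<open>\<integral> DF(\<gamma>', \<gamma>'')[X', X''] dx\<close> (\<open>first_variation_C2\<close>). A change of parameter
  replaces \<open>(u, a)\<close> by \<open>(c u, c\<^sup>2 a + d u)\<close> and multiplies \<open>F\<close> by \<open>c\<close>. Infinitesimally,
  \<open>DF(u, a)[c u, 2 c a + d u] = c F(u, a)\<close>, and therefore
  \<open>DF(\<gamma>', \<gamma>'')[(f \<gamma>')', (f \<gamma>')''] = (f F(\<gamma>', \<gamma>''))'\<close>, so the first variation in every
  tangential direction \<open>f \<gamma>'\<close> vanishes (\<open>tangential_variation_zero\<close>). This is where the third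
  weak derivative of the curve is used.

  Given an arbitrary test function \<open>\<psi>\<close>, the coefficient \<open>f = (\<psi> \<bullet> \<tau>) / (\<gamma>' \<bullet> \<tau>)\<close> is well
  defined because \<open>\<gamma>' \<bullet> \<tau> \<ge> 1/2\<close>, and \<open>Y = \<psi> - f \<gamma>'\<close> is orthogonal to \<open>\<tau>\<close>. Neither side of the
  equation sees \<open>f \<gamma>'\<close>: the normal velocity is orthogonal to it and the first variation
  vanishes. It remains to use the equation for \<open>Y\<close>. But \<open>Y\<close> has only two weak derivatives in
  space, and there is no information about its regularity in time, so it is not an admissible
  test function.

  This is resolved by working at almost every fixed time. Testing with \<open>\<zeta>(t) X(x)\<close> gives, for
  each smooth \<open>X\<close> orthogonal to \<open>\<tau>\<close>, the equation at almost every time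
  (\<open>flow_equation_at_times\<close>); the exceptional set depends on \<open>X\<close>, so only countably many \<open>X\<close>
  may be used. At a fixed time the equation is a linear functional
  \<open>\<integral> c\<^sub>0 \<psi> + c\<^sub>1 \<psi>' + c\<^sub>2 \<psi>''\<close> in each component, and an explicit countable family of smooth
  periodic functions suffices to show that such a functional vanishes on all functions with
  two weak derivatives (\<open>second_order_du_Bois_Reymond\<close>), in particular on the components of
  \<open>Y\<close>. Hence the two integrands in time agree almost everywhere for \<open>\<psi>\<close>, and the equation
  follows by integration (\<open>flow_equation_all_tests\<close>).

  The localisation in time requires that, for fixed \<open>X\<close>, both integrands are integrable in
  time (\<open>elastic_integrable\<close>, \<open>friction_integrable\<close>). Measurability comes from approximation
  of \<open>\<phi>\<close> by simple functions in \<open>W\<^bsup>2,p\<^esup>\<close> and from continuity of the first variation in that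
  norm at curves of class \<open>C\<^sup>2\<close> (\<open>ddensity_integral_tendsto\<close>), bounds from
  \<open>\<phi> \<in> L\<^sup>\<infinity>([0, T), W\<^bsup>2,p\<^esup>)\<close>. The time derivative of the graph is that of \<open>\<phi>\<close>
  (\<open>weak_time_deriv_add_static\<close>).
\<close>

section \<open>Lebesgue integrals over intervals\<close>

lemma measurable_lebesgue_on_cong_AE:
  fixes f g :: "'c::euclidean_space \<Rightarrow> 'b::euclidean_space"
  assumes S: "S \<in> sets lebesgue" and ae: "AE x in lebesgue_on S. f x = g x"
    and f: "f \<in> borel_measurable (lebesgue_on S)"
  shows "g \<in> borel_measurable (lebesgue_on S)"
proof -
  have ae': "AE x in lebesgue. x \<in> S \<longrightarrow> f x = g x"
    using ae S by (simp add: AE_restrict_space_iff)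
  have "(\<lambda>x. if x \<in> S then f x else 0) \<in> borel_measurable lebesgue"
    using f S by (simp add: borel_measurable_if)
  then have "(\<lambda>x. if x \<in> S then g x else 0) \<in> borel_measurable lebesgue"
    by (rule borel_measurable_AE) (use ae' in \<open>auto elim: eventually_mono\<close>)
  then show ?thesis using S by (simp add: borel_measurable_if)
qed

lemma integrable_lebesgue_on_cong_AE:
  fixes f g :: "'c::euclidean_space \<Rightarrow> 'b::euclidean_space"
  assumes S: "S \<in> sets lebesgue" and ae: "AE x in lebesgue_on S. f x = g x"
    and f: "integrable (lebesgue_on S) f"
  shows "integrable (lebesgue_on S) g"
  by (rule integrable_cong_AE_imp[OF f measurable_lebesgue_on_cong_AE[OF S ae] ae]) (use f in auto)

text \<open>
  The measure is complete, so two functions that agree almost everywhere are both measurable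
  or both not measurable; a non-integrable function has integral 0 by convention. This lets
  integrands be compared almost everywhere without knowing that they are measurable.
\<close>
lemma integral_lebesgue_on_cong_AE:
  fixes f g :: "'c::euclidean_space \<Rightarrow> 'b::euclidean_space"
  assumes S: "S \<in> sets lebesgue" and ae: "AE x in lebesgue_on S. f x = g x"
  shows "integral\<^sup>L (lebesgue_on S) f = integral\<^sup>L (lebesgue_on S) g"
proof (cases "f \<in> borel_measurable (lebesgue_on S)")
  case True
  then show ?thesis using measurable_lebesgue_on_cong_AE[OF S ae] ae by (intro integral_cong_AE) auto
next
  case False
  have "AE x in lebesgue_on S. g x = f x" using ae by (auto elim: eventually_mono)
  then have "g \<notin> borel_measurable (lebesgue_on S)"
    using measurable_lebesgue_on_cong_AE[OF S] False by blast
  then show ?thesis using False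
    by (metis borel_measurable_integrable not_integrable_integral_eq)
qed

lemma integrable_lebesgue_on_continuous:
  fixes f :: "real \<Rightarrow> 'b::euclidean_space"
  assumes "continuous_on {a..b} f"
  shows "integrable (lebesgue_on {a..b}) f"
  by (rule absolutely_integrable_imp_integrable[OF absolutely_integrable_continuous_real[OF assms]]) auto

lemma Icc_lebesgue [simp]: "{a..b::real} \<in> sets lebesgue" "{a..<b::real} \<in> sets lebesgue"
  by auto

lemma integral_lebesgue_on_eq_HK:
  fixes f :: "real \<Rightarrow> 'b::euclidean_space"
  assumes "integrable (lebesgue_on {a..b}) f"
  shows "integral\<^sup>L (lebesgue_on {a..b}) f = integral {a..b} f"
  using assms by (rule lebesgue_integral_eq_integral) simp

lemma measurable_continuous_Icc:
  fixes f :: "real \<Rightarrow> 'b::euclidean_space"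
  assumes "continuous_on {a..b} f"
  shows "f \<in> borel_measurable (lebesgue_on {a..b})"
  using integrable_lebesgue_on_continuous[OF assms] by auto

lemma integrable_scaleR_continuous:
  fixes g :: "real \<Rightarrow> 'b::euclidean_space"
  assumes g: "integrable (lebesgue_on {a..b}) g" and c: "continuous_on {a..b} c"
  shows "integrable (lebesgue_on {a..b}) (\<lambda>x. c x *\<^sub>R g x)"
proof -
  obtain B where B: "\<And>x. x \<in> {a..b} \<Longrightarrow> norm (c x) \<le> B"
    using compact_imp_bounded[OF compact_continuous_image[OF c compact_Icc]]
    unfolding bounded_iff by blast
  show ?thesis
  proof (rule Bochner_Integration.integrable_bound)
    show "integrable (lebesgue_on {a..b}) (\<lambda>x. B * norm (g x))"
      using g by auto
    show "(\<lambda>x. c x *\<^sub>R g x) \<in> borel_measurable (lebesgue_on {a..b})"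
      using measurable_continuous_Icc[OF c] g by auto
    show "AE x in lebesgue_on {a..b}. norm (c x *\<^sub>R g x) \<le> norm (B * norm (g x))"
    proof (rule AE_I2)
      fix x assume "x \<in> space (lebesgue_on {a..b})"
      then have "norm (c x) * norm (g x) \<le> B * norm (g x)"
        using B by (intro mult_right_mono) auto
      then show "norm (c x *\<^sub>R g x) \<le> norm (B * norm (g x))" by simp
    qed
  qed
qed

lemma finite_measure_Icc: "finite_measure (lebesgue_on {a..b::real})"
  by (rule finite_measure_lebesgue_on) simp

lemma integral_lebesgue_on_tendsto_bounded:
  fixes s :: "nat \<Rightarrow> real \<Rightarrow> 'b::euclidean_space"
  assumes m: "\<And>n. s n \<in> borel_measurable (lebesgue_on {a..b})"
    and f: "f \<in> borel_measurable (lebesgue_on {a..b})"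
    and lim: "AE x in lebesgue_on {a..b}. (\<lambda>n. s n x) \<longlonglongrightarrow> f x"
    and B: "\<And>n. AE x in lebesgue_on {a..b}. norm (s n x) \<le> B"
  shows "(\<lambda>n. integral\<^sup>L (lebesgue_on {a..b}) (s n)) \<longlonglongrightarrow> integral\<^sup>L (lebesgue_on {a..b}) f"
  by (rule integral_dominated_convergence[where w = "\<lambda>_. B"])
     (use assms finite_measure.integrable_const[OF finite_measure_Icc] in auto)

text \<open>
  A measurable function is an almost everywhere limit of continuous functions. Truncating the
  given function at a large height and the approximating functions at the same height makes
  dominated convergence applicable, at the price of an arbitrarily small error in \<open>L\<^sup>1\<close>.
\<close>
lemma L1_approx_continuous:
  fixes g :: "real \<Rightarrow> 'b::euclidean_space"
  assumes g: "integrable (lebesgue_on {a..b}) g" and e: "e > 0"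
  obtains h where "continuous_on UNIV h" "(\<integral>x. norm (g x - h x) \<partial>lebesgue_on {a..b}) < e"
proof -
  let ?M = "lebesgue_on {a..b}"
  \<comment> \<open>radial truncation at height \<open>N\<close>\<close>
  define c :: "nat \<Rightarrow> 'b \<Rightarrow> 'b" where "c N y = (real N / max (real N) (norm y)) *\<^sub>R y" for N y
  have c_bound: "norm (c N y) \<le> real N" for N y
  proof (cases "N = 0")
    case False
    then have "real N * norm y \<le> real N * max (real N) (norm y)" by (intro mult_left_mono) auto
    then show ?thesis using False by (simp add: c_def divide_simps)
  qed (simp add: c_def)
  have c_le: "norm (c N y) \<le> norm y" for N y
  proof -
    have "real N / max (real N) (norm y) \<le> 1" by (auto simp: divide_simps)
    then have "real N / max (real N) (norm y) * norm y \<le> 1 * norm y" by (intro mult_right_mono) auto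
    then show ?thesis by (simp add: c_def)
  qed
  have c_cont: "continuous_on UNIV (c N)" for N
  proof (cases "N = 0")
    case False
    then have "max (real N) (norm y) \<noteq> 0" for y :: 'b by auto
    then show ?thesis unfolding c_def by (intro continuous_intros) auto
  qed (simp add: c_def)
  have c_meas: "c N \<in> borel_measurable borel" for N
    using c_cont by (rule borel_measurable_continuous_onI)
  have c_lim: "(\<lambda>N. c N y) \<longlonglongrightarrow> y" for y
  proof (rule tendsto_eventually)
    show "\<forall>\<^sub>F N in sequentially. c N y = y"
      using eventually_ge_at_top[of "nat \<lceil>norm y\<rceil> + 1"]
    proof eventually_elim
      case (elim N)
      then have "norm y \<le> real N" "real N > 0" by linarith+
      then show ?case by (simp add: c_def max_def)
    qed
  qed
  have gm: "g \<in> borel_measurable ?M" using g by auto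
  have cgm: "(\<lambda>x. c N (g x)) \<in> borel_measurable ?M" for N
    using measurable_compose[OF gm c_meas] .
  have "(\<lambda>N. \<integral>x. norm (g x - c N (g x)) \<partial>?M) \<longlonglongrightarrow> (\<integral>x. 0 \<partial>?M)"
  proof (rule integral_dominated_convergence[where w = "\<lambda>x. 2 * norm (g x)"])
    have "(\<lambda>N. norm (g x - c N (g x))) \<longlonglongrightarrow> 0" for x
      using tendsto_norm[OF tendsto_diff[OF tendsto_const c_lim], of "g x" "g x"] by simp
    then show "AE x in ?M. (\<lambda>N. norm (g x - c N (g x))) \<longlonglongrightarrow> 0" by simp
    show "AE x in ?M. norm (norm (g x - c N (g x))) \<le> 2 * norm (g x)" for N
    proof (rule AE_I2)
      fix x
      show "norm (norm (g x - c N (g x))) \<le> 2 * norm (g x)"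
        using norm_triangle_ineq4[of "g x" "c N (g x)"] c_le[of N "g x"] by simp
    qed
  qed (use g cgm in auto)
  then have "\<forall>\<^sub>F N in sequentially. (\<integral>x. norm (g x - c N (g x)) \<partial>?M) < e / 2"
    using e by (intro order_tendstoD(2)) auto
  then obtain N where N: "(\<integral>x. norm (g x - c N (g x)) \<partial>?M) < e / 2"
    by (auto simp: eventually_sequentially)
  have "g measurable_on {a..b}" using gm by (simp add: measurable_on_iff_borel_measurable)
  then obtain Z k where Z: "negligible Z" and k: "\<And>n. continuous_on UNIV (k n)"
    and kl: "\<And>x. x \<notin> Z \<Longrightarrow> (\<lambda>n. k n x) \<longlonglongrightarrow> (if x \<in> {a..b} then g x else 0)"
    unfolding measurable_on_def by (auto simp: fun_eq_iff)
  have ckc: "continuous_on UNIV (\<lambda>x. c N (k n x))" for n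
    using continuous_on_compose2[OF c_cont k] by auto
  have ckm: "(\<lambda>x. c N (k n x)) \<in> borel_measurable ?M" for n
    using continuous_on_subset[OF ckc] measurable_continuous_Icc by blast
  have "AE x in lebesgue. x \<notin> Z"
    using Z by (intro AE_not_in) (simp add: negligible_iff_null_sets)
  then have ae: "AE x in ?M. x \<notin> Z"
    by (simp add: AE_restrict_space_iff) (auto elim: eventually_mono)
  have "(\<lambda>n. \<integral>x. norm (c N (g x) - c N (k n x)) \<partial>?M) \<longlonglongrightarrow> (\<integral>x. 0 \<partial>?M)"
  proof (rule integral_lebesgue_on_tendsto_bounded[where B = "2 * real N"])
    have "AE x in ?M. x \<in> {a..b} \<and> x \<notin> Z" using ae by (auto intro: AE_space[THEN AE_mp])
    then show "AE x in ?M. (\<lambda>n. norm (c N (g x) - c N (k n x))) \<longlonglongrightarrow> 0"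
    proof eventually_elim
      case (elim x)
      then have "(\<lambda>n. k n x) \<longlonglongrightarrow> g x" using kl[of x] by simp
      then have "(\<lambda>n. c N (k n x)) \<longlonglongrightarrow> c N (g x)"
        using c_cont by (auto intro!: continuous_on_tendsto_compose[OF c_cont])
      then have "(\<lambda>n. norm (c N (g x) - c N (k n x))) \<longlonglongrightarrow> norm (c N (g x) - c N (g x))"
        by (intro tendsto_intros)
      then show ?case by simp
    qed
    show "AE x in ?M. norm (norm (c N (g x) - c N (k n x))) \<le> 2 * real N" for n
    proof (rule AE_I2)
      fix x
      show "norm (norm (c N (g x) - c N (k n x))) \<le> 2 * real N"
        using norm_triangle_ineq4[of "c N (g x)" "c N (k n x)"] c_bound[of N "g x"] c_bound[of N "k n x"]
        by simp
    qed
  qed (use cgm ckm in auto)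
  then have "\<forall>\<^sub>F n in sequentially. (\<integral>x. norm (c N (g x) - c N (k n x)) \<partial>?M) < e / 2"
    using e by (intro order_tendstoD(2)) auto
  then obtain n where n: "(\<integral>x. norm (c N (g x) - c N (k n x)) \<partial>?M) < e / 2"
    by (auto simp: eventually_sequentially)
  have fin: "integrable ?M (\<lambda>x. c N (g x))"
    by (rule finite_measure.integrable_const_bound[OF finite_measure_Icc, where B="real N"])
       (use cgm c_bound in auto)
  have fin2: "integrable ?M (\<lambda>x. c N (k n x))"
    using ckc by (intro integrable_lebesgue_on_continuous) (auto intro: continuous_on_subset)
  have "(\<integral>x. norm (g x - c N (k n x)) \<partial>?M)
      \<le> (\<integral>x. norm (g x - c N (g x)) + norm (c N (g x) - c N (k n x)) \<partial>?M)"
    using g fin fin2 by (intro integral_mono) (auto intro: norm_diff_triangle_ineq[THEN order_trans] norm_diff_triangle_le)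
  also have "\<dots> = (\<integral>x. norm (g x - c N (g x)) \<partial>?M) + (\<integral>x. norm (c N (g x) - c N (k n x)) \<partial>?M)"
    using g fin fin2 by (intro Bochner_Integration.integral_add) auto
  also have "\<dots> < e" using N n by simp
  finally show ?thesis using that[OF ckc] by blast
qed

section \<open>Absolutely continuous functions\<close>

text \<open>
  The functions \<open>f\<close> with such a \<open>g\<close> are the absolutely continuous ones on \<open>[0, L]\<close>, and \<open>g\<close> is
  the almost everywhere derivative. All integration by parts below happens at this level of
  regularity, since \<open>\<gamma>''\<close> is only absolutely continuous for a \<open>W\<^bsup>3,p\<^esup>\<close>-curve.
\<close>
definition primitive :: "real \<Rightarrow> (real \<Rightarrow> 'a::euclidean_space) \<Rightarrow> (real \<Rightarrow> 'a) \<Rightarrow> bool" where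
  "primitive L f g \<longleftrightarrow>
     integrable (lebesgue_on {0..L}) g \<and> (\<forall>x\<in>{0..L}. f x - f 0 = integral {0..x} g)"

lemma integrable_on_subinterval_0:
  fixes g :: "real \<Rightarrow> 'a::euclidean_space"
  assumes "integrable (lebesgue_on {0..L}) g" "x \<in> {0..L}"
  shows "g integrable_on {0..x}"
proof -
  have "g integrable_on {0..L}" using assms(1) by (rule integrable_on_lebesgue_on) simp
  then show ?thesis using assms(2) by (auto intro: integrable_on_subinterval)
qed

lemma primitive_continuous:
  assumes "primitive L f g"
  shows "continuous_on {0..L} f"
proof -
  have "g integrable_on {0..L}"
    using assms unfolding primitive_def by (auto intro: integrable_on_lebesgue_on)
  then have "continuous_on {0..L} (\<lambda>x. f 0 + integral {0..x} g)"
    by (intro continuous_intros indefinite_integral_continuous_1)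
  moreover have "f x = f 0 + integral {0..x} g" if "x \<in> {0..L}" for x
    using assms that unfolding primitive_def by (metis add.commute diff_add_cancel)
  ultimately show ?thesis by (subst continuous_on_cong[OF refl]) (assumption, simp)
qed

lemma primitive_integrable: "primitive L f g \<Longrightarrow> integrable (lebesgue_on {0..L}) g"
  by (simp add: primitive_def)

lemma primitive_total:
  assumes "primitive L f g" "0 \<le> L"
  shows "(\<integral>x. g x \<partial>lebesgue_on {0..L}) = f L - f 0"
  using assms by (simp add: primitive_def integral_lebesgue_on_eq_HK)

lemma primitive_C1:
  fixes f :: "real \<Rightarrow> 'a::euclidean_space"
  assumes d: "\<And>x. x \<in> {0..L} \<Longrightarrow> (f has_vector_derivative g x) (at x within {0..L})"
    and c: "continuous_on {0..L} g"
  shows "primitive L f g"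
  unfolding primitive_def
proof (intro conjI ballI)
  show "integrable (lebesgue_on {0..L}) g" by (rule integrable_lebesgue_on_continuous[OF c])
  fix x assume x: "x \<in> {0..L}"
  have "(g has_integral f x - f 0) {0..x}"
  proof (rule fundamental_theorem_of_calculus)
    fix y assume "y \<in> {0..x}"
    then show "(f has_vector_derivative g y) (at y within {0..x})"
      using d[of y] x by (auto intro: has_vector_derivative_within_subset)
  qed (use x in auto)
  then show "f x - f 0 = integral {0..x} g" by (simp add: integral_unique)
qed

text \<open>
  Uniform approximations of a curve with compact image in \<open>S\<close> eventually stay in one compact
  subset \<open>K'\<close> of \<open>S\<close>; this is where bounds on derivatives can be taken.
\<close>
lemma compact_thickening:
  fixes K :: "'a::euclidean_space set"
  assumes "compact K" "K \<noteq> {}" "open S" "K \<subseteq> S"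
  obtains e K' where "e > 0" "compact K'" "K' \<subseteq> S" "\<And>x y. x \<in> K \<Longrightarrow> dist x y \<le> e \<Longrightarrow> y \<in> K'"
proof -
  obtain e where e: "e > 0" "{x. infdist x K \<le> e} \<subseteq> S"
    using compact_in_open_separated[OF assms(2,1,3,4)] by auto
  show ?thesis
  proof (rule that[of e "{x. infdist x K \<le> e}"])
    show "compact {x. infdist x K \<le> e}" using compact_infdist_le assms e by blast
    show "y \<in> {x. infdist x K \<le> e}" if "x \<in> K" "dist x y \<le> e" for x y
      using infdist_le[OF that(1), of y] that(2) by (simp add: dist_commute)
  qed (use e in auto)
qed

lemma linear_family_expand:
  assumes "linear A"
  shows "A v = (\<Sum>b\<in>Basis. (v \<bullet> b) *\<^sub>R A b)"
  by (subst euclidean_representation[of v, symmetric])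
     (simp add: linear_sum[OF assms] linear_cmul[OF assms])

text \<open>
  On a compact set, pointwise continuity of a family of linear maps already bounds the
  operator norms, because a basis is finite.
\<close>
lemma linear_family_bound:
  fixes A :: "'c::topological_space \<Rightarrow> 'a::euclidean_space \<Rightarrow> 'b::real_normed_vector"
  assumes K: "compact K" and lin: "\<And>y. y \<in> K \<Longrightarrow> linear (A y)"
    and c: "\<And>v. continuous_on K (\<lambda>y. A y v)"
  obtains C where "C \<ge> 0" "\<And>y v. y \<in> K \<Longrightarrow> norm (A y v) \<le> C * norm v"
proof -
  have "\<exists>B. \<forall>y\<in>K. norm (A y b) \<le> B" for b
    using compact_imp_bounded[OF compact_continuous_image[OF c K], of b]
    unfolding bounded_iff image_iff by blast
  then obtain B where B: "\<And>b y. y \<in> K \<Longrightarrow> norm (A y b) \<le> B b" by metis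
  show ?thesis
  proof (rule that[of "\<Sum>b\<in>Basis. \<bar>B b\<bar>"])
    fix y v assume y: "y \<in> K"
    have "norm (A y v) \<le> (\<Sum>b\<in>Basis. norm ((v \<bullet> b) *\<^sub>R A y b))"
      by (subst linear_family_expand[OF lin[OF y]]) (rule norm_sum)
    also have "\<dots> \<le> (\<Sum>b\<in>Basis. \<bar>B b\<bar> * norm v)"
    proof (rule sum_mono)
      fix b :: 'a assume b: "b \<in> Basis"
      have "\<bar>v \<bullet> b\<bar> * norm (A y b) \<le> norm v * \<bar>B b\<bar>"
        using Basis_le_norm[OF b, of v] B[OF y, of b] by (intro mult_mono) auto
      then show "norm ((v \<bullet> b) *\<^sub>R A y b) \<le> \<bar>B b\<bar> * norm v" by (simp add: mult.commute)
    qed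
    finally show "norm (A y v) \<le> (\<Sum>b\<in>Basis. \<bar>B b\<bar>) * norm v"
      by (simp add: sum_distrib_right)
  qed (simp add: sum_nonneg)
qed

lemma integrable_linear_family:
  fixes A :: "real \<Rightarrow> 'a::euclidean_space \<Rightarrow> 'b::euclidean_space"
  assumes lin: "\<And>x. x \<in> {a..b} \<Longrightarrow> linear (A x)"
    and c: "\<And>v. continuous_on {a..b} (\<lambda>x. A x v)"
    and g: "integrable (lebesgue_on {a..b}) g"
  shows "integrable (lebesgue_on {a..b}) (\<lambda>x. A x (g x))"
proof -
  have "integrable (lebesgue_on {a..b}) (\<lambda>x. \<Sum>i\<in>Basis. (g x \<bullet> i) *\<^sub>R A x i)"
  proof (rule Bochner_Integration.integrable_sum)
    fix i :: 'a
    have gi: "integrable (lebesgue_on {a..b}) (\<lambda>x. g x \<bullet> i)" using g by auto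
    have "integrable (lebesgue_on {a..b}) (\<lambda>x. \<Sum>j\<in>Basis. (A x i \<bullet> j) *\<^sub>R ((g x \<bullet> i) *\<^sub>R j))"
    proof (rule Bochner_Integration.integrable_sum)
      fix j :: 'b
      show "integrable (lebesgue_on {a..b}) (\<lambda>x. (A x i \<bullet> j) *\<^sub>R ((g x \<bullet> i) *\<^sub>R j))"
        by (rule integrable_scaleR_continuous[where c = "\<lambda>x. A x i \<bullet> j"])
           (use gi in \<open>auto intro!: continuous_intros c\<close>)
    qed
    moreover have "(\<Sum>j\<in>Basis. (A x i \<bullet> j) *\<^sub>R ((g x \<bullet> i) *\<^sub>R j)) = (g x \<bullet> i) *\<^sub>R A x i" for x
    proof -
      have "(\<Sum>j\<in>Basis. (A x i \<bullet> j) *\<^sub>R ((g x \<bullet> i) *\<^sub>R j)) = (g x \<bullet> i) *\<^sub>R (\<Sum>j\<in>Basis. (A x i \<bullet> j) *\<^sub>R j)"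
        by (simp add: scaleR_sum_right mult.commute)
      then show ?thesis by (simp add: euclidean_representation)
    qed
    ultimately show "integrable (lebesgue_on {a..b}) (\<lambda>x. (g x \<bullet> i) *\<^sub>R A x i)" by simp
  qed
  then show ?thesis
    by (subst Bochner_Integration.integrable_cong[OF refl, where g = "\<lambda>x. \<Sum>i\<in>Basis. (g x \<bullet> i) *\<^sub>R A x i"])
       (use linear_family_expand[OF lin] in auto)
qed

text \<open>
  For a continuous density this is the classical chain rule and the fundamental theorem of
  calculus. In general \<open>g\<close> is approximated in \<open>L\<^sup>1\<close> by continuous \<open>h\<^sub>n\<close>; the primitives \<open>W\<^sub>n\<close>
  of \<open>h\<^sub>n\<close> converge uniformly to \<open>w\<close>, and both sides of the identity for \<open>W\<^sub>n\<close> converge.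
\<close>
lemma primitive_chain:
  fixes \<Phi> :: "'a::euclidean_space \<Rightarrow> 'b::euclidean_space"
  assumes w: "primitive L w g" and S: "open S" "w ` {0..L} \<subseteq> S"
    and d: "\<And>y. y \<in> S \<Longrightarrow> (\<Phi> has_derivative \<Phi>' y) (at y)"
    and c: "\<And>v. continuous_on S (\<lambda>y. \<Phi>' y v)"
  shows "primitive L (\<lambda>x. \<Phi> (w x)) (\<lambda>x. \<Phi>' (w x) (g x))"
proof (cases "0 \<le> L")
  case False
  then show ?thesis by (simp add: primitive_def)
next
  case L: True
  let ?M = "lebesgue_on {0..L}"
  have g: "integrable ?M g" using w by (rule primitive_integrable)
  have wc: "continuous_on {0..L} w" using w by (rule primitive_continuous)
  have lin: "linear (\<Phi>' y)" if "y \<in> S" for y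
    using d[OF that] has_derivative_bounded_linear bounded_linear.linear by blast
  obtain e K where e: "e > 0" and K: "compact K" "K \<subseteq> S"
    and near: "\<And>x y. x \<in> w ` {0..L} \<Longrightarrow> dist x y \<le> e \<Longrightarrow> y \<in> K"
    using compact_thickening[OF compact_continuous_image[OF wc compact_Icc] _ S] L by auto
  obtain C where C: "C \<ge> 0" "\<And>y v. y \<in> K \<Longrightarrow> norm (\<Phi>' y v) \<le> C * norm v"
    using linear_family_bound[OF K(1), of \<Phi>'] lin K c continuous_on_subset by (metis subsetD)
  define r where "r n = min e (1 / (real n + 1))" for n :: nat
  have r: "r n > 0" "r n \<le> e" for n using e by (auto simp: r_def)
  have r_lim: "r \<longlonglongrightarrow> 0"
  proof (rule tendsto_sandwich[of "\<lambda>_. 0" _ _ "\<lambda>n. 1 / (real n + 1)"])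
    show "(\<lambda>n. 1 / (real n + 1)) \<longlonglongrightarrow> 0"
      using LIMSEQ_inverse_real_of_nat by (simp add: inverse_eq_divide add.commute)
  qed (use r in \<open>auto simp: r_def less_imp_le\<close>)
  have "\<exists>h. continuous_on UNIV h \<and> (\<integral>x. norm (g x - h x) \<partial>?M) < r n" for n
    using L1_approx_continuous[OF g r(1)] by blast
  then obtain h where h: "\<And>n. continuous_on UNIV (h n)"
    and hg: "\<And>n. (\<integral>x. norm (g x - h n x) \<partial>?M) < r n" by metis
  have hc: "continuous_on A (h n)" for n A using h continuous_on_subset by blast
  have hi: "integrable ?M (h n)" for n using hc by (rule integrable_lebesgue_on_continuous)
  define W where "W n x = w 0 + integral {0..x} (h n)" for n x
  have W_near: "norm (w x - W n x) \<le> r n" if x: "x \<in> {0..L}" for n x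
  proof -
    have i1: "(\<lambda>s. norm (g s - h n s)) integrable_on {0..L}"
      using g hi by (intro integrable_on_lebesgue_on[where S="{0..L}"]) auto
    have "w x - w 0 = integral {0..x} g" using w x by (simp add: primitive_def)
    then have "w x - W n x = integral {0..x} (\<lambda>s. g s - h n s)"
      by (simp add: W_def integral_diff integrable_on_subinterval_0[OF _ x] g hi algebra_simps)
    then have "norm (w x - W n x) = norm (integral {0..x} (\<lambda>s. g s - h n s))" by simp
    also have "\<dots> \<le> integral {0..x} (\<lambda>s. norm (g s - h n s))"
      using x g hi i1
      by (intro integral_norm_bound_integral integrable_on_subinterval_0[OF _ x]) auto
    also have "\<dots> \<le> integral {0..L} (\<lambda>s. norm (g s - h n s))"
      using x i1 by (intro integral_subset_le integrable_on_subinterval_0[OF _ x])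
        (use g hi in auto)
    also have "\<dots> = (\<integral>x. norm (g x - h n x) \<partial>?M)"
      using g hi by (subst integral_lebesgue_on_eq_HK) auto
    finally show ?thesis using hg[of n] by linarith
  qed
  have W_K: "W n x \<in> K" if "x \<in> {0..L}" for n x
    using W_near[OF that, of n] r(2)[of n] near[of "w x" "W n x"] that by (auto simp: dist_norm)
  have w_K: "w x \<in> K" if "x \<in> {0..L}" for x
    using near[of "w x" "w x"] that e by auto
  have Wd: "(W n has_vector_derivative h n x) (at x within {0..L})" if "x \<in> {0..L}" for n x
    unfolding W_def using integral_has_vector_derivative[OF hc that]
    by (auto intro!: derivative_eq_intros)
  have Wc: "continuous_on {0..L} (W n)" for n
    unfolding continuous_on_eq_continuous_within using Wd has_vector_derivative_continuous by blast
  have W_lim: "(\<lambda>n. W n x) \<longlonglongrightarrow> w x" if "x \<in> {0..L}" for x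
  proof -
    have "(\<lambda>n. norm (w x - W n x)) \<longlonglongrightarrow> 0"
      by (rule tendsto_sandwich[OF _ _ tendsto_const r_lim]) (use W_near[OF that] in auto)
    then have "(\<lambda>n. norm (W n x - w x)) \<longlonglongrightarrow> 0" by (simp add: norm_minus_commute)
    then show ?thesis using Lim_null tendsto_norm_zero_iff by blast
  qed
  have W_S: "W n x \<in> S" if "x \<in> {0..L}" for n x using W_K[OF that] K by auto
  have w_S: "w x \<in> S" if "x \<in> {0..L}" for x using S(2) that by auto
  let ?G = "\<lambda>x. \<Phi>' (w x) (g x)" and ?H = "\<lambda>n x. \<Phi>' (W n x) (h n x)"
  have int_w: "integrable ?M (\<lambda>x. \<Phi>' (w x) (f x))" if "integrable ?M f" for f
    by (rule integrable_linear_family[where A = "\<lambda>x. \<Phi>' (w x)"])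
       (use lin w_S continuous_on_compose2[OF c wc S(2)] that in auto)
  have int_W: "integrable ?M (\<lambda>x. \<Phi>' (W n x) (f x))" if "integrable ?M f" for f n
  proof (rule integrable_linear_family[where A = "\<lambda>x. \<Phi>' (W n x)"])
    show "continuous_on {0..L} (\<lambda>x. \<Phi>' (W n x) v)" for v
      by (rule continuous_on_compose2[OF c Wc]) (use W_K K in auto)
  qed (use lin W_K K that in auto)
  have cH: "continuous_on {0..L} (?H n)" for n
  proof -
    have "continuous_on {0..L} (\<lambda>x. \<Sum>b\<in>Basis. (h n x \<bullet> b) *\<^sub>R \<Phi>' (W n x) b)"
      by (intro continuous_intros hc continuous_on_compose2[OF c Wc]) (use W_K K in auto)
    moreover have "?H n x = (\<Sum>b\<in>Basis. (h n x \<bullet> b) *\<^sub>R \<Phi>' (W n x) b)" if "x \<in> {0..L}" for x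
      by (rule linear_family_expand[OF lin]) (use W_K[OF that] K in auto)
    ultimately show ?thesis by (subst continuous_on_cong[OF refl]) (assumption, simp)
  qed
  have FTC: "\<Phi> (W n x) - \<Phi> (W n 0) = integral {0..x} (?H n)" if "x \<in> {0..L}" for n x
  proof -
    have "primitive L (\<lambda>x. \<Phi> (W n x)) (?H n)"
    proof (rule primitive_C1[OF _ cH])
      fix y assume y: "y \<in> {0..L}"
      have "(\<Phi> has_derivative \<Phi>' (W n y)) (at (W n y) within W n ` {0..L})"
        using d W_K[OF y] K by (auto intro: has_derivative_at_withinI)
      then have "(\<Phi> \<circ> W n has_derivative \<Phi>' (W n y) \<circ> (\<lambda>t. t *\<^sub>R h n y)) (at y within {0..L})"
        using Wd[OF y, of n] unfolding has_vector_derivative_def by (intro diff_chain_within)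
      moreover have "W n y \<in> S" using W_K[OF y] K by auto
      ultimately show "((\<lambda>x. \<Phi> (W n x)) has_vector_derivative ?H n y) (at y within {0..L})"
        using linear_cmul[OF lin, of "W n y"] by (simp add: has_vector_derivative_def o_def)
    qed
    then show ?thesis using that by (auto simp: primitive_def)
  qed
  have lim0: "(\<lambda>n. \<integral>x. norm (\<Phi>' (W n x) (g x) - ?G x) \<partial>?M) \<longlonglongrightarrow> (\<integral>x. 0 \<partial>?M)"
  proof (rule integral_dominated_convergence[where w = "\<lambda>x. 2 * C * norm (g x)"])
    show "AE x in ?M. (\<lambda>n. norm (\<Phi>' (W n x) (g x) - ?G x)) \<longlonglongrightarrow> 0"
    proof (rule AE_I2)
      fix x assume "x \<in> space ?M"
      then have x: "x \<in> {0..L}" by simp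
      have "(\<lambda>n. \<Phi>' (W n x) (g x)) \<longlonglongrightarrow> ?G x"
        by (rule continuous_on_tendsto_compose[OF c W_lim[OF x]]) (use w_S[OF x] W_S[OF x] in auto)
      then show "(\<lambda>n. norm (\<Phi>' (W n x) (g x) - ?G x)) \<longlonglongrightarrow> 0"
        using LIM_zero tendsto_norm_zero by blast
    qed
    show "AE x in ?M. norm (norm (\<Phi>' (W n x) (g x) - ?G x)) \<le> 2 * C * norm (g x)" for n
    proof (rule AE_I2)
      fix x assume "x \<in> space ?M"
      then have x: "x \<in> {0..L}" by simp
      show "norm (norm (\<Phi>' (W n x) (g x) - ?G x)) \<le> 2 * C * norm (g x)"
        using C(2)[OF W_K[OF x], of n "g x"] C(2)[OF w_K[OF x], of "g x"]
          norm_triangle_ineq4[of "\<Phi>' (W n x) (g x)" "?G x"] by simp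
    qed
  qed (use int_w[OF g] int_W[OF g] g in auto)
  have bound: "norm (integral {0..x} (?H n) - integral {0..x} ?G)
      \<le> C * r n + (\<integral>x. norm (\<Phi>' (W n x) (g x) - ?G x) \<partial>?M)" if x: "x \<in> {0..L}" for n x
  proof -
    have HM: "integrable ?M (?H n)" using cH by (rule integrable_lebesgue_on_continuous)
    have GM: "integrable ?M ?G" using int_w[OF g] .
    have i1: "(\<lambda>s. norm (?H n s - ?G s)) integrable_on {0..L}"
      using HM GM by (intro integrable_on_lebesgue_on[where S="{0..L}"]) auto
    have "norm (integral {0..x} (?H n) - integral {0..x} ?G) = norm (integral {0..x} (\<lambda>s. ?H n s - ?G s))"
      using HM GM by (simp add: integral_diff integrable_on_subinterval_0[OF _ x])
    also have "\<dots> \<le> integral {0..x} (\<lambda>s. norm (?H n s - ?G s))"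
      using x HM GM by (intro integral_norm_bound_integral integrable_on_subinterval_0[OF _ x]) auto
    also have "\<dots> \<le> integral {0..L} (\<lambda>s. norm (?H n s - ?G s))"
      using x i1 by (intro integral_subset_le integrable_on_subinterval_0[OF _ x])
        (use HM GM in auto)
    also have "\<dots> = (\<integral>s. norm (?H n s - ?G s) \<partial>?M)"
      using HM GM by (subst integral_lebesgue_on_eq_HK) auto
    also have "\<dots> \<le> (\<integral>s. C * norm (g s - h n s) + norm (\<Phi>' (W n s) (g s) - ?G s) \<partial>?M)"
    proof (rule integral_mono)
      fix s assume "s \<in> space ?M"
      then have s: "s \<in> {0..L}" by simp
      have "norm (?H n s - \<Phi>' (W n s) (g s)) \<le> C * norm (h n s - g s)"
        using C(2)[OF W_K[OF s], of n "h n s - g s"] linear_diff[OF lin, of "W n s" "h n s" "g s"]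
          W_K[OF s, of n] K by auto
      then show "norm (?H n s - ?G s) \<le> C * norm (g s - h n s) + norm (\<Phi>' (W n s) (g s) - ?G s)"
        using norm_triangle_ineq[of "?H n s - \<Phi>' (W n s) (g s)" "\<Phi>' (W n s) (g s) - ?G s"]
        by (simp add: norm_minus_commute)
    qed (use HM GM g hi int_W[OF g] in auto)
    also have "\<dots> = C * (\<integral>s. norm (g s - h n s) \<partial>?M) + (\<integral>s. norm (\<Phi>' (W n s) (g s) - ?G s) \<partial>?M)"
      using g hi int_W[OF g] GM by (subst Bochner_Integration.integral_add) auto
    also have "\<dots> \<le> C * r n + (\<integral>s. norm (\<Phi>' (W n s) (g s) - ?G s) \<partial>?M)"
      using hg[of n] C(1) by (intro add_right_mono mult_left_mono) auto
    finally show ?thesis .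
  qed
  have "\<Phi> (w x) - \<Phi> (w 0) = integral {0..x} ?G" if x: "x \<in> {0..L}" for x
  proof -
    have \<Phi>c: "continuous_on S \<Phi>"
    proof (rule continuous_at_imp_continuous_on, rule ballI)
      show "isCont \<Phi> y" if "y \<in> S" for y using has_derivative_continuous[OF d[OF that]] .
    qed
    have 1: "(\<lambda>n. \<Phi> (W n y)) \<longlonglongrightarrow> \<Phi> (w y)" if "y \<in> {0..L}" for y
      by (rule continuous_on_tendsto_compose[OF \<Phi>c W_lim[OF that]]) (use w_S[OF that] W_S[OF that] in auto)
    have "(\<lambda>n. C * r n + (\<integral>x. norm (\<Phi>' (W n x) (g x) - ?G x) \<partial>?M)) \<longlonglongrightarrow> C * 0 + (\<integral>x. 0 \<partial>?M)"
      by (intro tendsto_intros r_lim lim0)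
    then have "(\<lambda>n. C * r n + (\<integral>x. norm (\<Phi>' (W n x) (g x) - ?G x) \<partial>?M)) \<longlonglongrightarrow> 0" by simp
    then have "(\<lambda>n. integral {0..x} (?H n) - integral {0..x} ?G) \<longlonglongrightarrow> 0"
      using Lim_null_comparison[OF eventuallyI] bound[OF x] by fast
    then have 2: "(\<lambda>n. integral {0..x} (?H n)) \<longlonglongrightarrow> integral {0..x} ?G"
      by (rule LIM_zero_cancel)
    have "(\<lambda>n. \<Phi> (W n x) - \<Phi> (W n 0)) \<longlonglongrightarrow> integral {0..x} ?G"
      using 2 FTC[OF x] by simp
    moreover have "(\<lambda>n. \<Phi> (W n x) - \<Phi> (W n 0)) \<longlonglongrightarrow> \<Phi> (w x) - \<Phi> (w 0)"
      using L by (intro tendsto_diff 1 x) simp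
    ultimately show ?thesis using LIMSEQ_unique by blast
  qed
  then show ?thesis using int_w[OF g] by (simp add: primitive_def)
qed

lemma primitive_bounded_linear:
  fixes T :: "'a::euclidean_space \<Rightarrow> 'b::euclidean_space"
  assumes T: "bounded_linear T" and f: "primitive L f g"
  shows "primitive L (\<lambda>x. T (f x)) (\<lambda>x. T (g x))"
  unfolding primitive_def
proof (intro conjI ballI)
  show "integrable (lebesgue_on {0..L}) (\<lambda>x. T (g x))"
    by (rule integrable_bounded_linear[OF T primitive_integrable[OF f]])
  fix x assume x: "x \<in> {0..L}"
  have "integral {0..x} (\<lambda>x. T (g x)) = T (integral {0..x} g)"
    using integral_linear[OF integrable_on_subinterval_0[OF primitive_integrable[OF f] x] T]
    by (simp add: o_def)
  moreover have "T (f x) - T (f 0) = T (f x - f 0)"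
    by (simp add: linear_diff[OF bounded_linear.linear[OF T]])
  ultimately show "T (f x) - T (f 0) = integral {0..x} (\<lambda>x. T (g x))"
    using f x by (simp add: primitive_def)
qed

lemma primitive_add:
  assumes "primitive L f f'" "primitive L g g'"
  shows "primitive L (\<lambda>x. f x + g x) (\<lambda>x. f' x + g' x)"
  unfolding primitive_def
proof (intro conjI ballI)
  show "integrable (lebesgue_on {0..L}) (\<lambda>x. f' x + g' x)"
    using assms by (auto simp: primitive_def)
  fix x assume x: "x \<in> {0..L}"
  have "integral {0..x} (\<lambda>x. f' x + g' x) = integral {0..x} f' + integral {0..x} g'"
    by (intro integral_add integrable_on_subinterval_0[OF _ x] primitive_integrable[OF assms(1)]
        primitive_integrable[OF assms(2)])
  moreover have "f x + g x - (f 0 + g 0) = (f x - f 0) + (g x - g 0)" by simp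
  ultimately show "f x + g x - (f 0 + g 0) = integral {0..x} (\<lambda>x. f' x + g' x)"
    using assms x by (simp only: primitive_def)
qed

lemma primitive_diff:
  assumes "primitive L f f'" "primitive L g g'"
  shows "primitive L (\<lambda>x. f x - g x) (\<lambda>x. f' x - g' x)"
  using primitive_add[OF assms(1)
      primitive_bounded_linear[OF bounded_linear_minus[OF bounded_linear_ident] assms(2)]]
  by simp

lemma primitive_Pair:
  fixes f :: "real \<Rightarrow> 'a::euclidean_space" and g :: "real \<Rightarrow> 'b::euclidean_space"
  assumes "primitive L f f'" "primitive L g g'"
  shows "primitive L (\<lambda>x. (f x, g x)) (\<lambda>x. (f' x, g' x))"
proof -
  have "bounded_linear (\<lambda>a::'a. (a, 0::'b))" "bounded_linear (\<lambda>b::'b. (0::'a, b))"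
    by (intro bounded_linear_Pair bounded_linear_ident bounded_linear_zero)+
  note l = this
  show ?thesis
    using primitive_add[OF primitive_bounded_linear[OF l(1) assms(1)]
        primitive_bounded_linear[OF l(2) assms(2)]] by simp
qed

text \<open>
  The product rule is the chain rule for the bilinear map on pairs.
\<close>
lemma primitive_bilinear:
  fixes B :: "'a::euclidean_space \<Rightarrow> 'b::euclidean_space \<Rightarrow> 'c::euclidean_space"
  assumes B: "bounded_bilinear B" and f: "primitive L f f'" and g: "primitive L g g'"
  shows "primitive L (\<lambda>x. B (f x) (g x)) (\<lambda>x. B (f x) (g' x) + B (f' x) (g x))"
proof -
  have "primitive L (\<lambda>x. (\<lambda>y. B (fst y) (snd y)) (f x, g x))
      (\<lambda>x. (\<lambda>y h. B (fst y) (snd h) + B (fst h) (snd y)) (f x, g x) (f' x, g' x))"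
  proof (rule primitive_chain[OF primitive_Pair[OF f g], where S = UNIV])
    fix y :: "'a \<times> 'b"
    show "((\<lambda>y. B (fst y) (snd y)) has_derivative (\<lambda>h. B (fst y) (snd h) + B (fst h) (snd y))) (at y)"
      by (rule bounded_bilinear.FDERIV[OF B]) (auto intro!: derivative_eq_intros)
    show "continuous_on UNIV (\<lambda>y. B (fst y) (snd v) + B (fst v) (snd y))" for v
      by (intro continuous_intros bounded_bilinear.continuous_on[OF B])
  qed auto
  then show ?thesis by simp
qed

lemma primitive_parts:
  fixes B :: "'a::euclidean_space \<Rightarrow> 'b::euclidean_space \<Rightarrow> 'c::euclidean_space"
  assumes B: "bounded_bilinear B" and f: "primitive L f f'" and g: "primitive L g g'"
    and L: "0 \<le> L" and per: "f L = f 0" "g L = g 0"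
  shows "(\<integral>x. B (f x) (g' x) \<partial>lebesgue_on {0..L}) = - (\<integral>x. B (f' x) (g x) \<partial>lebesgue_on {0..L})"
    and "integrable (lebesgue_on {0..L}) (\<lambda>x. B (f x) (g' x))"
    and "integrable (lebesgue_on {0..L}) (\<lambda>x. B (f' x) (g x))"
proof -
  show 1: "integrable (lebesgue_on {0..L}) (\<lambda>x. B (f x) (g' x))"
    by (rule integrable_linear_family[where A = "\<lambda>x. B (f x)"])
       (auto intro: bounded_linear.linear bounded_bilinear.bounded_linear_right[OF B]
          bounded_bilinear.continuous_on[OF B] primitive_continuous[OF f]
          primitive_integrable[OF g])
  show 2: "integrable (lebesgue_on {0..L}) (\<lambda>x. B (f' x) (g x))"
    by (rule integrable_linear_family[where A = "\<lambda>x a. B a (g x)"])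
       (auto intro: bounded_linear.linear bounded_bilinear.bounded_linear_left[OF B]
          bounded_bilinear.continuous_on[OF B] primitive_continuous[OF g]
          primitive_integrable[OF f])
  have "(\<integral>x. B (f x) (g' x) + B (f' x) (g x) \<partial>lebesgue_on {0..L}) = 0"
    using primitive_total[OF primitive_bilinear[OF B f g] L] per by simp
  then show "(\<integral>x. B (f x) (g' x) \<partial>lebesgue_on {0..L}) = - (\<integral>x. B (f' x) (g x) \<partial>lebesgue_on {0..L})"
    using 1 2 by (simp add: eq_neg_iff_add_eq_0)
qed

section \<open>Calculus of smooth functions\<close>

text \<open>
  In \<^const>\<open>Ck\<close> the derivative is tested in every fixed direction, so each closure property follows
  by induction on \<open>k\<close> once the derivative is expressed through functions of the same kind.
\<close>
lemma Ck_SucI: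
  assumes d: "\<And>x. (f has_derivative f' x) (at x)" and c: "\<And>v. Ck k (\<lambda>x. f' x v)"
  shows "Ck (Suc k) f"
proof -
  have "frechet_derivative f (at x) = f' x" for x
    using frechet_derivative_at[OF d] by simp
  moreover have "f differentiable (at x)" for x
    using d by (rule differentiableI)
  ultimately show ?thesis using c by simp
qed

lemma Ck_SucD:
  assumes "Ck (Suc k) f"
  shows "(f has_derivative frechet_derivative f (at x)) (at x)"
    and "Ck k (\<lambda>x. frechet_derivative f (at x) v)"
  using assms by (auto simp: frechet_derivative_works)

lemma Ck_lower: "Ck (Suc k) f \<Longrightarrow> Ck k f"
proof (induction k arbitrary: f)
  case 0
  then show ?case
    by (auto intro!: continuous_at_imp_continuous_on differentiable_imp_continuous_within)
next
  case (Suc k)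
  then show ?case by (metis Ck.simps(2))
qed

lemma Ck_continuous: "Ck k f \<Longrightarrow> continuous_on UNIV f"
  by (induction k) (use Ck_lower in auto)

lemma Ck_const: "Ck k (\<lambda>x. c)"
proof (induction k arbitrary: c)
  case (Suc k)
  show ?case by (rule Ck_SucI[OF has_derivative_const]) (rule Suc)
qed simp

lemma Ck_ident: "Ck k (\<lambda>x. x)"
proof (cases k)
  case (Suc m)
  then show ?thesis using Ck_SucI[OF has_derivative_ident Ck_const] by simp
qed simp

lemma Ck_add: "Ck k f \<Longrightarrow> Ck k g \<Longrightarrow> Ck k (\<lambda>x. f x + g x)"
proof (induction k arbitrary: f g)
  case (Suc k)
  show ?case
    by (rule Ck_SucI[OF has_derivative_add[OF Ck_SucD(1)[OF Suc.prems(1)] Ck_SucD(1)[OF Suc.prems(2)]]])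
       (intro Suc.IH Ck_SucD(2)[OF Suc.prems(1)] Ck_SucD(2)[OF Suc.prems(2)])
qed (auto intro: continuous_intros)

lemma Ck_bounded_linear: "bounded_linear T \<Longrightarrow> Ck k f \<Longrightarrow> Ck k (\<lambda>x. T (f x))"
proof (induction k arbitrary: f)
  case 0
  then show ?case by (auto intro: bounded_linear.continuous_on)
next
  case (Suc k)
  show ?case
    by (rule Ck_SucI[OF bounded_linear.has_derivative[OF Suc.prems(1) Ck_SucD(1)[OF Suc.prems(2)]]])
       (intro Suc.IH Ck_SucD(2)[OF Suc.prems(2)] Suc.prems(1))
qed

lemma Ck_minus: "Ck k f \<Longrightarrow> Ck k (\<lambda>x. - f x)"
  by (rule Ck_bounded_linear[OF bounded_linear_minus[OF bounded_linear_ident]])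

lemma Ck_diff: "Ck k f \<Longrightarrow> Ck k g \<Longrightarrow> Ck k (\<lambda>x. f x - g x)"
  using Ck_add[OF _ Ck_minus, of k f g] by simp

lemma Ck_bilinear:
  "bounded_bilinear B \<Longrightarrow> Ck k f \<Longrightarrow> Ck k g \<Longrightarrow> Ck k (\<lambda>x. B (f x) (g x))"
proof (induction k arbitrary: f g)
  case 0
  then show ?case by (auto intro: bounded_bilinear.continuous_on)
next
  case (Suc k)
  show ?case
    by (rule Ck_SucI[OF bounded_bilinear.FDERIV[OF Suc.prems(1) Ck_SucD(1)[OF Suc.prems(2)]
            Ck_SucD(1)[OF Suc.prems(3)]]])
       (intro Ck_add Suc.IH Suc.prems(1) Ck_lower[OF Suc.prems(2)] Ck_lower[OF Suc.prems(3)]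
          Ck_SucD(2)[OF Suc.prems(2)] Ck_SucD(2)[OF Suc.prems(3)])
qed

lemmas Ck_mult = Ck_bilinear[OF bounded_bilinear_mult]
lemmas Ck_scaleR = Ck_bilinear[OF bounded_bilinear_scaleR]
lemmas Ck_inner = Ck_bilinear[OF bounded_bilinear_inner]

lemma Ck_affine:
  assumes "bounded_linear T"
  shows "Ck k f \<Longrightarrow> Ck k (\<lambda>x. f (c + T x))"
proof (induction k arbitrary: f)
  case 0
  then have "continuous_on UNIV f" by simp
  moreover have "continuous_on UNIV (\<lambda>x. c + T x)"
    by (intro continuous_intros bounded_linear.continuous_on[OF assms])
  ultimately show ?case by (auto intro: continuous_on_compose2)
next
  case (Suc k)
  show ?case
  proof (rule Ck_SucI)
    show "((\<lambda>x. f (c + T x)) has_derivative (\<lambda>v. frechet_derivative f (at (c + T x)) (T v))) (at x)" for x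
    proof -
      have "((\<lambda>x. c + T x) has_derivative T) (at x)"
        using bounded_linear_imp_has_derivative[OF assms] by (auto intro!: derivative_eq_intros)
      from diff_chain_at[OF this Ck_SucD(1)[OF Suc.prems]] show ?thesis by (simp add: o_def)
    qed
    show "Ck k (\<lambda>x. frechet_derivative f (at (c + T x)) (T v))" for v
      by (rule Suc.IH[OF Ck_SucD(2)[OF Suc.prems]])
  qed
qed

lemma Ck_compose_real:
  fixes h :: "real \<Rightarrow> 'b::real_normed_vector" and f :: "'a::real_normed_vector \<Rightarrow> real"
  shows "Ck k h \<Longrightarrow> Ck k f \<Longrightarrow> Ck k (\<lambda>x. h (f x))"
proof (induction k arbitrary: h)
  case 0
  then show ?case using continuous_on_compose2[of UNIV h UNIV f] by simp
next
  case (Suc k)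
  show ?case
  proof (rule Ck_SucI)
    let ?h' = "\<lambda>y. frechet_derivative h (at y) 1"
    show "((\<lambda>x. h (f x)) has_derivative
        (\<lambda>v. frechet_derivative f (at x) v *\<^sub>R ?h' (f x))) (at x)" for x
    proof -
      have lin: "linear (frechet_derivative h (at y))" for y
        using Suc.prems(1) by (auto intro: linear_frechet_derivative)
      have "frechet_derivative h (at y) v = v *\<^sub>R ?h' y" for y v
        using linear_cmul[OF lin, of y v 1] by simp
      then have "frechet_derivative h (at (f x)) \<circ> frechet_derivative f (at x)
          = (\<lambda>v. frechet_derivative f (at x) v *\<^sub>R ?h' (f x))"
        unfolding o_def by blast
      with diff_chain_at[OF Ck_SucD(1)[OF Suc.prems(2), of x] Ck_SucD(1)[OF Suc.prems(1), of "f x"]]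
      show ?thesis unfolding o_def by metis
    qed
    show "Ck k (\<lambda>x. frechet_derivative f (at x) v *\<^sub>R ?h' (f x))" for v
      by (intro Ck_scaleR Ck_SucD(2)[OF Suc.prems(2)] Suc.IH Ck_SucD(2)[OF Suc.prems(1)]
          Ck_lower[OF Suc.prems(2)])
  qed
qed

text \<open>
  The exponent has to vary in the induction, because differentiation lowers it by one.
\<close>
lemma Ck_powr:
  fixes f :: "'a::real_normed_vector \<Rightarrow> real"
  assumes pos: "\<And>x. f x > 0"
  shows "Ck k f \<Longrightarrow> Ck k (\<lambda>x. f x powr q)"
proof (induction k arbitrary: q)
  case 0
  then have "continuous_on UNIV f" by simp
  moreover have "\<forall>x\<in>UNIV. f x \<noteq> 0" using pos by (metis less_irrefl)
  ultimately have "continuous_on UNIV (\<lambda>x. f x powr q)"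
    by (intro continuous_on_powr continuous_on_const)
  then show ?case by simp
next
  case (Suc k)
  show ?case
  proof (rule Ck_SucI)
    show "((\<lambda>x. f x powr q) has_derivative
        (\<lambda>v. (q * f x powr (q - 1)) * frechet_derivative f (at x) v)) (at x)" for x
    proof -
      have "((\<lambda>z. z powr q) has_derivative (\<lambda>v. (q * f x powr (q - 1)) * v)) (at (f x))"
        using has_real_derivative_powr[OF pos[of x], of q] by (simp add: has_field_derivative_def)
      from diff_chain_at[OF Ck_SucD(1)[OF Suc.prems] this] show ?thesis by (simp add: o_def)
    qed
    show "Ck k (\<lambda>x. q * f x powr (q - 1) * frechet_derivative f (at x) v)" for v
      by (intro Ck_mult Ck_const Suc.IH Ck_lower[OF Suc.prems] Ck_SucD(2)[OF Suc.prems])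
  qed
qed

lemma Ck_Suc_vector_derivative:
  fixes f :: "real \<Rightarrow> 'b::real_normed_vector"
  assumes d: "\<And>x. (f has_vector_derivative f' x) (at x)" and c: "Ck k f'"
  shows "Ck (Suc k) f"
  by (rule Ck_SucI[OF d[unfolded has_vector_derivative_def]])
     (intro Ck_scaleR Ck_const c)

lemma smooth_has_vector_derivative:
  fixes f :: "real \<Rightarrow> 'b::euclidean_space"
  assumes "smooth f"
  shows "(f has_vector_derivative dx f x) (at x)" and "smooth (dx f)"
proof -
  have Suc: "Ck (Suc k) f" for k using assms by (auto simp: smooth_def)
  show d: "(f has_vector_derivative dx f x) (at x)" for x
    using Suc[of 0] unfolding dx_def by (auto simp: vector_derivative_works[symmetric])
  have "frechet_derivative f (at x) 1 = dx f x" for x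
    using frechet_derivative_at[OF d[unfolded has_vector_derivative_def]] by (metis scaleR_one)
  then have "Ck k (dx f)" for k using Ck_SucD(2)[OF Suc[of k], of 1] by simp
  then show "smooth (dx f)" by (simp add: smooth_def)
qed

lemma smooth_antiderivative:
  fixes f :: "real \<Rightarrow> 'b::euclidean_space"
  assumes "\<And>x. (F has_vector_derivative f x) (at x)" "smooth f"
  shows "smooth F"
  unfolding smooth_def
proof
  fix k
  show "Ck k F"
    using Ck_Suc_vector_derivative[OF assms(1), of k] assms(2) Ck_lower by (auto simp: smooth_def)
qed

lemma smooth_continuous: "smooth f \<Longrightarrow> continuous_on S f"
  using Ck_continuous continuous_on_subset by (fastforce simp: smooth_def)

lemma smooth_const: "smooth (\<lambda>x. c)"
  and smooth_ident: "smooth (\<lambda>x. x)"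
  and smooth_add: "smooth f \<Longrightarrow> smooth g \<Longrightarrow> smooth (\<lambda>x. f x + g x)"
  and smooth_diff: "smooth f \<Longrightarrow> smooth g \<Longrightarrow> smooth (\<lambda>x. f x - g x)"
  by (simp_all add: smooth_def Ck_const Ck_ident Ck_add Ck_diff)

lemma smooth_mult:
  fixes f g :: "'a::real_normed_vector \<Rightarrow> real"
  shows "smooth f \<Longrightarrow> smooth g \<Longrightarrow> smooth (\<lambda>x. f x * g x)"
  by (simp add: smooth_def Ck_mult)

lemma smooth_scaleR: "smooth f \<Longrightarrow> smooth g \<Longrightarrow> smooth (\<lambda>x. f x *\<^sub>R g x)"
  by (simp add: smooth_def Ck_scaleR)

lemma smooth_inner: "smooth f \<Longrightarrow> smooth g \<Longrightarrow> smooth (\<lambda>x. f x \<bullet> g x)"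
  by (simp add: smooth_def Ck_inner)

lemma smooth_compose_real:
  fixes h :: "real \<Rightarrow> 'b::real_normed_vector"
  shows "smooth h \<Longrightarrow> smooth f \<Longrightarrow> smooth (\<lambda>x. h (f x))"
  by (simp add: smooth_def Ck_compose_real)

lemma smooth_powr:
  fixes f :: "'a::real_normed_vector \<Rightarrow> real"
  shows
  "(\<And>x. f x > 0) \<Longrightarrow> smooth f \<Longrightarrow> smooth (\<lambda>x. f x powr q)"
  unfolding smooth_def by (rule allI, rule Ck_powr) auto

lemma smooth_bounded_linear: "bounded_linear T \<Longrightarrow> smooth f \<Longrightarrow> smooth (\<lambda>x. T (f x))"
  by (simp add: smooth_def Ck_bounded_linear)

lemma smooth_slice:
  assumes "smooth (\<lambda>(t::real, x::real). \<psi> t x)"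
  shows "smooth (\<psi> t)"
  unfolding smooth_def
proof
  fix k
  have "bounded_linear (\<lambda>x::real. (0::real, x))"
    by (intro bounded_linear_Pair bounded_linear_zero bounded_linear_ident)
  from Ck_affine[OF this, of k "\<lambda>(t, x). \<psi> t x" "(t, 0)"] assms
  show "Ck k (\<psi> t)" by (simp add: smooth_def)
qed

lemma Ck_sin_cos: "Ck k (sin :: real \<Rightarrow> real) \<and> Ck k (cos :: real \<Rightarrow> real)"
proof (induction k)
  case 0
  show ?case by (simp add: continuous_on_sin continuous_on_cos continuous_on_id)
next
  case (Suc k)
  have s: "(sin has_vector_derivative cos x) (at x)" for x :: real
    using DERIV_sin[of x] by (simp only: has_real_derivative_iff_has_vector_derivative)
  have c: "(cos has_vector_derivative - sin x) (at x)" for x :: real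
    using DERIV_cos[of x] by (simp only: has_real_derivative_iff_has_vector_derivative)
  show ?case
    using Ck_Suc_vector_derivative[OF s, of k] Ck_Suc_vector_derivative[OF c, of k]
      Suc Ck_minus by blast
qed

lemma smooth_sin: "smooth (sin :: real \<Rightarrow> real)"
  using Ck_sin_cos by (simp add: smooth_def)

lemma smooth_arctan: "smooth (arctan :: real \<Rightarrow> real)"
proof (rule smooth_antiderivative)
  show "(arctan has_vector_derivative (1 + x * x) powr (- 1)) (at x)" for x
  proof -
    have "1 + x * x > 0" by (simp add: add_pos_nonneg)
    then have "(1 + x * x) powr (- 1) = inverse (1 + x\<^sup>2)"
      by (simp add: powr_minus power2_eq_square)
    then show ?thesis
      using DERIV_arctan[of x] by (simp add: has_real_derivative_iff_has_vector_derivative)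
  qed
  show "smooth (\<lambda>x::real. (1 + x * x) powr (- 1))"
    by (intro smooth_powr smooth_add smooth_const smooth_mult smooth_ident)
       (simp add: add_pos_nonneg)
qed

lemma antiderivative_UNIV:
  fixes f :: "real \<Rightarrow> 'b::euclidean_space"
  assumes "continuous_on UNIV f"
  obtains F where "\<And>x. (F has_vector_derivative f x) (at x)"
proof -
  have "\<exists>F. \<forall>x::real. -\<infinity> < ereal x \<longrightarrow> ereal x < \<infinity> \<longrightarrow> (F has_vector_derivative f x) (at x)"
    using assms by (intro einterval_antiderivative)
      (auto simp: continuous_on_eq_continuous_at)
  then show ?thesis using that by auto
qed

text \<open>
  The step is the antiderivative of the mollifier. Products of two rescaled steps give the
  compactly supported functions of time that are needed to localise in time.
\<close>
lemma smooth_step_exists: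
  assumes "mollifier \<eta>"
  obtains S :: "real \<Rightarrow> real" where "smooth S" "\<And>x. x \<le> -1 \<Longrightarrow> S x = 0" "\<And>x. x \<ge> 1 \<Longrightarrow> S x = 1"
    "\<And>x. \<bar>S x\<bar> \<le> 1"
proof -
  have sm: "smooth \<eta>" and pos: "\<And>x. \<eta> x \<ge> 0" and z: "\<And>x. \<bar>x\<bar> \<ge> 1 \<Longrightarrow> \<eta> x = 0"
    and int: "(\<integral>x. \<eta> x \<partial>lebesgue) = 1"
    using assms by (auto simp: mollifier_def)
  obtain F where F: "\<And>x. (F has_vector_derivative \<eta> x) (at x)"
    using antiderivative_UNIV[OF smooth_continuous[OF sm]] by blast
  have FTC: "(\<eta> has_integral F y - F x) {x..y}" if "x \<le> y" for x y
    using that F by (intro fundamental_theorem_of_calculus) (auto intro: has_vector_derivative_at_within)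
  have mono: "F x \<le> F y" if "x \<le> y" for x y
    using has_integral_nonneg[OF FTC[OF that]] pos by simp
  have int\<eta>: "integrable lebesgue \<eta>"
    using int not_integrable_integral_eq by fastforce
  have "(\<eta> has_integral 1) UNIV"
    using has_integral_integral_lebesgue[OF int\<eta>] int by simp
  moreover have "(\<lambda>x. if x \<in> {-1..1} then \<eta> x else 0) = \<eta>"
    using z by (auto simp: fun_eq_iff abs_if)
  ultimately have "(\<eta> has_integral 1) {-1..1}"
    using has_integral_restrict_UNIV[of "{-1..1}" \<eta> 1] by simp
  from has_integral_unique[OF FTC this] have F1: "F 1 - F (-1) = 1" by simp
  have low: "F x = F (-1)" if "x \<le> -1" for x
  proof -
    have "(\<eta> has_integral 0) {x..-1}"
      by (rule has_integral_is_0) (use z in auto)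
    from has_integral_unique[OF FTC[OF that] this] show ?thesis by simp
  qed
  have high: "F x = F 1" if "x \<ge> 1" for x
  proof -
    have "(\<eta> has_integral 0) {1..x}"
      by (rule has_integral_is_0) (use z in auto)
    from has_integral_unique[OF FTC[OF that] this] show ?thesis by simp
  qed
  show ?thesis
  proof (rule that[of "\<lambda>x. F x - F (-1)"])
    show "smooth (\<lambda>x. F x - F (-1))"
      by (intro smooth_diff smooth_const smooth_antiderivative[OF F sm])
    show "\<bar>F x - F (- 1)\<bar> \<le> 1" for x
    proof -
      have 1: "F (-1) \<le> F x"
      proof (cases "x \<le> -1")
        case True
        show ?thesis by (simp only: low[OF True] order_refl)
      next
        case False
        show ?thesis by (rule mono) (use False in simp)
      qed
      have 2: "F x \<le> F 1"
      proof (cases "x \<ge> 1")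
        case True
        show ?thesis by (simp only: high[OF True] order_refl)
      next
        case False
        show ?thesis by (rule mono) (use False in simp)
      qed
      show ?thesis using 1 2 F1 by linarith
    qed
    show "F x - F (- 1) = 1" if "x \<ge> 1" for x by (simp only: high[OF that] F1)
    show "F x - F (- 1) = 0" if "x \<le> -1" for x by (simp only: low[OF that] diff_self)
  qed
qed

section \<open>Periodic test functions\<close>

text \<open>
  On \<open>(0, L)\<close> the product of the two sines has the sign of \<open>y - x\<close>, so these functions tend to
  the indicator of \<open>(0, y)\<close>. Each sine changes sign under \<open>x \<mapsto> x + L\<close>, so the product is
  \<open>L\<close>-periodic and the functions are smooth on the circle without any gluing.
\<close>
definition arc_test :: "real \<Rightarrow> real \<Rightarrow> nat \<Rightarrow> real \<Rightarrow> real" where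
  "arc_test L y n x = 1 / 2 + arctan (real n * (sin (pi * x / L) * sin (pi * (y - x) / L))) / pi"

lemma arc_test_smooth: "smooth (arc_test L y n)"
proof -
  have "smooth (\<lambda>x::real. 1 / 2 + arctan (real n * (sin ((pi / L) * x) * sin ((pi / L) * (y - x)))) * (1 / pi))"
    by (intro smooth_add smooth_mult smooth_const smooth_diff smooth_ident
        smooth_compose_real[OF smooth_arctan] smooth_compose_real[OF smooth_sin])
  then show ?thesis by (simp add: arc_test_def[abs_def])
qed

lemma arc_test_periodic:
  assumes "L > 0"
  shows "periodic_fun_simple (arc_test L y n) L"
proof
  fix x
  have 1: "sin (pi * (x + L) / L) = - sin (pi * x / L)"
    using assms sin_periodic_pi[of "pi * x / L"] by (simp add: field_simps)
  have 2: "sin (pi * (y - (x + L)) / L) = - sin (pi * (y - x) / L)"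
  proof -
    have "pi * (y - (x + L)) / L = pi * (y - x) / L - pi" using assms by (simp add: field_simps)
    then show ?thesis by (simp add: sin_diff)
  qed
  show "arc_test L y n (x + L) = arc_test L y n x"
    unfolding arc_test_def 1 2 by simp
qed

lemma arc_test_bound: "\<bar>arc_test L y n x\<bar> \<le> 1"
proof -
  let ?a = "arctan (real n * (sin (pi * x / L) * sin (pi * (y - x) / L)))"
  have "\<bar>?a\<bar> \<le> pi / 2" using arctan_bounded[of "real n * (sin (pi * x / L) * sin (pi * (y - x) / L))"] by (simp add: abs_if)
  then have "\<bar>?a / pi\<bar> \<le> 1 / 2" by (simp add: field_simps)
  then show ?thesis unfolding arc_test_def by linarith
qed

lemma arctan_scaled_tendsto:
  "c > 0 \<Longrightarrow> (\<lambda>n. arctan (real n * c)) \<longlonglongrightarrow> pi / 2"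
  "c < 0 \<Longrightarrow> (\<lambda>n. arctan (real n * c)) \<longlonglongrightarrow> - (pi / 2)"
proof -
  have *: "(\<lambda>n. arctan (real n * c)) \<longlonglongrightarrow> pi / 2" if "c > 0" for c
  proof -
    have "LIM n sequentially. real n * c :> at_top"
      using filterlim_tendsto_pos_mult_at_top[OF tendsto_const that filterlim_real_sequentially]
      by (simp add: mult.commute)
    from filterlim_compose[OF tendsto_arctan_at_top this] show ?thesis .
  qed
  show "c > 0 \<Longrightarrow> (\<lambda>n. arctan (real n * c)) \<longlonglongrightarrow> pi / 2" by (rule *)
  show "c < 0 \<Longrightarrow> (\<lambda>n. arctan (real n * c)) \<longlonglongrightarrow> - (pi / 2)"
    using tendsto_minus[OF *[of "- c"]] by (simp add: arctan_minus)
qed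

lemma arc_test_tendsto:
  assumes y: "0 < y" "y < L" and x: "0 < x" "x < L" "x \<noteq> y"
  shows "(\<lambda>n. arc_test L y n x) \<longlonglongrightarrow> (if x < y then 1 else 0)"
proof -
  let ?c = "sin (pi * x / L) * sin (pi * (y - x) / L)"
  have s1: "sin (pi * x / L) > 0" using x y by (intro sin_gt_zero) (auto simp: field_simps)
  show ?thesis
  proof (cases "x < y")
    case True
    have "(y - x) / L < 1" using x y by (simp add: field_simps)
    then have "pi * ((y - x) / L) < pi * 1" by (intro mult_strict_left_mono) auto
    then have "sin (pi * (y - x) / L) > 0" using x y True by (intro sin_gt_zero) auto
    then have "?c > 0" using s1 by simp
    from tendsto_add[OF tendsto_const tendsto_divide[OF arctan_scaled_tendsto(1)[OF this] tendsto_const], of pi "1/2"]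
    show ?thesis using True by (simp add: arc_test_def)
  next
    case False
    have "(x - y) / L < 1" using x y by (simp add: field_simps)
    then have "pi * ((x - y) / L) < pi * 1" by (intro mult_strict_left_mono) auto
    then have "sin (pi * (x - y) / L) > 0" using x y False by (intro sin_gt_zero) auto
    moreover have "sin (pi * (y - x) / L) = - sin (pi * (x - y) / L)"
      by (metis minus_diff_eq minus_divide_left mult_minus_right sin_minus)
    ultimately have "?c < 0" using s1 by (simp add: mult_pos_neg)
    from tendsto_add[OF tendsto_const tendsto_divide[OF arctan_scaled_tendsto(2)[OF this] tendsto_const], of pi "1/2"]
    show ?thesis using False by (simp add: arc_test_def)
  qed
qed

text \<open>
  At almost every point the averages of an integrable function over shrinking intervals
  converge to its value, and here all these averages vanish.
\<close>
lemma AE_zero_of_indefinite_integral_zero: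
  fixes h :: "real \<Rightarrow> real"
  assumes h: "integrable (lebesgue_on {0..L}) h"
    and z: "\<And>y. y \<in> {0..L} \<Longrightarrow> integral {0..y} h = 0"
  shows "AE x in lebesgue_on {0..L}. h x = 0"
proof -
  define f where "f x = (if x \<in> {0..L} then h x else 0)" for x
  have "integrable lebesgue f"
    using h unfolding f_def by (subst Lebesgue_Measure.integrable_restrict_UNIV) auto
  then have fU: "f integrable_on UNIV" by (rule integrable_on_lebesgue)
  have "f integrable_on cbox a b" for a b
    using fU integrable_on_subcbox by blast
  then obtain N where N: "negligible N"
    and lim: "\<And>x e. x \<notin> N \<Longrightarrow> 0 < e \<Longrightarrow> \<exists>d>0. \<forall>h. 0 < h \<and> h < d \<longrightarrow>
        norm (integral (cbox x (x + h *\<^sub>R One)) f /\<^sub>R h ^ DIM(real) - f x) < e"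
    using integrable_ccontinuous_explicit by metis
  have zero: "h x = 0" if x: "x \<notin> N" "0 < x" "x < L" for x
  proof (rule ccontr)
    assume "h x \<noteq> 0"
    then obtain d where d: "d > 0" and dd: "\<And>k. 0 < k \<Longrightarrow> k < d \<Longrightarrow>
        norm (integral (cbox x (x + k *\<^sub>R One)) f /\<^sub>R k ^ DIM(real) - f x) < \<bar>h x\<bar>"
      using lim[OF x(1), of "\<bar>h x\<bar>"] by auto
    define k where "k = min (d / 2) (L - x)"
    have k: "0 < k" "k < d" "x + k \<le> L" using d x by (auto simp: k_def)
    have "integral {0..x} h + integral {x..x+k} h = integral {0..x+k} h"
      using x k by (intro Henstock_Kurzweil_Integration.integral_combine integrable_on_subinterval_0[OF h]) auto
    then have "integral {x..x+k} h = 0" using z[of x] z[of "x+k"] x k by simp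
    moreover have "integral {x..x+k} f = integral {x..x+k} h"
      using x k by (intro integral_cong) (auto simp: f_def)
    ultimately have "norm (f x) < \<bar>h x\<bar>" using dd[OF k(1,2)] by simp
    then show False using x by (simp add: f_def)
  qed
  have "AE x in lebesgue. x \<notin> N \<union> {0, L}"
    using N by (intro AE_not_in) (simp add: negligible_iff_null_sets)
  then have "AE x in lebesgue. x \<in> {0..L} \<longrightarrow> h x = 0"
    by eventually_elim (use zero in force)
  then show ?thesis by (simp add: AE_restrict_space_iff)
qed

text \<open>
  In the limit \<open>n \<rightarrow> \<infinity>\<close> the tests give \<open>\<integral>\<^sub>0\<^sup>y h = 0\<close>, first for rational \<open>y\<close> and then by
  continuity for all. Restricting to rational \<open>y\<close> keeps the family of tests countable, which
  is what allows the exceptional null sets of times to be united later.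
\<close>
lemma AE_zero_by_arc_tests:
  fixes h :: "real \<Rightarrow> real"
  assumes L: "L > 0" and h: "integrable (lebesgue_on {0..L}) h"
    and t: "\<And>y n. y \<in> \<rat> \<Longrightarrow> 0 < y \<Longrightarrow> y < L \<Longrightarrow> (\<integral>x. arc_test L y n x * h x \<partial>lebesgue_on {0..L}) = 0"
  shows "AE x in lebesgue_on {0..L}. h x = 0"
proof (rule AE_zero_of_indefinite_integral_zero[OF h])
  let ?M = "lebesgue_on {0..L}"
  have rat: "integral {0..y} h = 0" if y: "y \<in> \<rat>" "0 < y" "y < L" for y
  proof -
    have m: "(\<lambda>x. if x \<in> {0..y} then h x else 0) \<in> borel_measurable ?M"
    proof (rule measurable_If_set)
      have "{0..y} \<inter> space ?M = {0..y}" using y by auto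
      moreover have "{0..y} \<in> sets ?M" using y by (simp add: sets_restrict_space_iff)
      ultimately show "{0..y} \<inter> space ?M \<in> sets ?M" by (simp only:)
    qed (use h in auto)
    have "(\<lambda>n. \<integral>x. arc_test L y n x * h x \<partial>?M) \<longlonglongrightarrow> (\<integral>x. (if x \<in> {0..y} then h x else 0) \<partial>?M)"
    proof (rule integral_dominated_convergence[where w = "\<lambda>x. norm (h x)"])
      show "(\<lambda>x. arc_test L y n x * h x) \<in> borel_measurable ?M" for n
        using measurable_continuous_Icc[OF smooth_continuous[OF arc_test_smooth]] h by auto
      have "AE x in lebesgue. x \<notin> {0, y, L}" by (intro AE_not_in) simp
      then have "AE x in lebesgue. x \<in> {0..L} \<longrightarrow> (\<lambda>n. arc_test L y n x * h x) \<longlonglongrightarrow> (if x \<in> {0..y} then h x else 0)"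
      proof eventually_elim
        case (elim x)
        show ?case
        proof
          assume "x \<in> {0..L}"
          with elim have x: "0 < x" "x < L" "x \<noteq> y" by auto
          from tendsto_mult[OF arc_test_tendsto[OF y(2,3) x] tendsto_const[of "h x"]]
          show "(\<lambda>n. arc_test L y n x * h x) \<longlonglongrightarrow> (if x \<in> {0..y} then h x else 0)"
            using x by (auto split: if_splits)
        qed
      qed
      then show "AE x in ?M. (\<lambda>n. arc_test L y n x * h x) \<longlonglongrightarrow> (if x \<in> {0..y} then h x else 0)"
        by (simp add: AE_restrict_space_iff)
      show "AE x in ?M. norm (arc_test L y n x * h x) \<le> norm (h x)" for n
        using arc_test_bound by (auto simp: abs_mult intro!: AE_I2 mult_left_le_one_le)
    qed (use h m in auto)
    then have "(\<integral>x. (if x \<in> {0..y} then h x else 0) \<partial>?M) = 0"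
      unfolding t[OF y] by (rule LIMSEQ_unique[OF _ tendsto_const])
    moreover have "(\<integral>x. (if x \<in> {0..y} then h x else 0) \<partial>?M) = integral\<^sup>L (lebesgue_on {0..y}) h"
      using y by (intro integral_restrict) auto
    moreover have "integrable (lebesgue_on {0..y}) h"
      by (rule Equivalence_Lebesgue_Henstock_Integration.integrable_subinterval[OF h]) (use y in auto)
    ultimately show ?thesis by (simp add: integral_lebesgue_on_eq_HK)
  qed
  fix y assume y: "y \<in> {0..L}"
  have c: "continuous_on {0..L} (\<lambda>y. integral {0..y} h)"
    using h by (intro indefinite_integral_continuous_1 integrable_on_lebesgue_on) auto
  show "integral {0..y} h = 0"
  proof (rule ccontr)
    assume "integral {0..y} h \<noteq> 0"
    then obtain d where d: "d > 0" and dd: "\<And>q. q \<in> {0..L} \<Longrightarrow> dist q y < d \<Longrightarrow>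
        dist (integral {0..q} h) (integral {0..y} h) < \<bar>integral {0..y} h\<bar>"
      using c y unfolding continuous_on_iff by (metis zero_less_abs_iff)
    have "max 0 (y - d) < min L (y + d)" using L d y by auto
    then obtain q where q: "q \<in> \<rat>" "max 0 (y - d) < q" "q < min L (y + d)"
      using Rats_dense_in_real by blast
    then have "integral {0..q} h = 0" "q \<in> {0..L}" "dist q y < d"
      using rat[of q] by (auto simp: dist_real_def)
    then show False using dd[of q] by (simp add: dist_real_def)
  qed
qed

lemma periodic_antiderivative:
  fixes \<xi> :: "real \<Rightarrow> 'b::euclidean_space"
  assumes \<xi>: "smooth \<xi>" "periodic_fun_simple \<xi> L" and L: "L > 0"
    and z: "(\<integral>x. \<xi> x \<partial>lebesgue_on {0..L}) = 0"
  obtains F where "smooth F" "periodic_fun_simple F L" "\<And>x. (F has_vector_derivative \<xi> x) (at x)"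
proof -
  obtain F where F: "\<And>x. (F has_vector_derivative \<xi> x) (at x)"
    using antiderivative_UNIV[OF smooth_continuous[OF \<xi>(1)]] by blast
  have sh: "((\<lambda>x. F (x + L)) has_vector_derivative \<xi> (x + L)) (at x)" for x
  proof -
    have "((\<lambda>x. x + L) has_real_derivative 1) (at x)" by (auto intro!: derivative_eq_intros)
    from vector_diff_chain_at[OF this[unfolded has_real_derivative_iff_has_vector_derivative] F]
    show ?thesis by (simp add: o_def)
  qed
  have "((\<lambda>x. F (x + L) - F x) has_vector_derivative 0) (at x within UNIV)" for x
    using has_vector_derivative_diff[OF sh F] periodic_fun_simple.plus_period[OF \<xi>(2)] by simp
  then obtain c where c: "\<And>x. F (x + L) - F x = c"
    using has_vector_derivative_zero_constant[of UNIV "\<lambda>x. F (x + L) - F x"] by auto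
  have "primitive L F \<xi>"
    by (rule primitive_C1) (use F smooth_continuous[OF \<xi>(1)] in \<open>auto intro: has_vector_derivative_at_within\<close>)
  from primitive_total[OF this] L z have "F L = F 0" by simp
  then have "c = 0" using c[of 0] by simp
  then have "periodic_fun_simple F L" using c by (simp add: periodic_fun_simple_def)
  then show ?thesis using that smooth_antiderivative[OF F \<xi>(1)] F by blast
qed

definition mean :: "real \<Rightarrow> (real \<Rightarrow> 'b::euclidean_space) \<Rightarrow> 'b" where
  "mean L f = (\<integral>x. f x \<partial>lebesgue_on {0..L}) /\<^sub>R L"

lemma integrable_const_Icc: "integrable (lebesgue_on {a..b::real}) (\<lambda>x. c::'b::euclidean_space)"
  by (rule integrable_lebesgue_on_continuous) simp

lemma integral_const_Icc: "0 \<le> L \<Longrightarrow> (\<integral>x. c \<partial>lebesgue_on {0..L::real}) = L *\<^sub>R (c::'b::euclidean_space)"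
  unfolding integral_lebesgue_on_eq_HK[OF integrable_const_Icc] by simp

lemma arc_test_integrable: "integrable (lebesgue_on {0..L}) (arc_test L y n)"
  by (rule integrable_lebesgue_on_continuous[OF smooth_continuous[OF arc_test_smooth]])

lemma integrable_mult_continuous:
  fixes g c :: "real \<Rightarrow> real"
  assumes "integrable (lebesgue_on {a..b}) g" "continuous_on {a..b} c"
  shows "integrable (lebesgue_on {a..b}) (\<lambda>x. c x * g x)"
  using integrable_scaleR_continuous[OF assms] by simp

text \<open>
  Subtracting the mean from the test function or from \<open>h\<close> has the same effect on the integral.
\<close>
lemma AE_const_by_arc_tests:
  fixes h :: "real \<Rightarrow> real"
  assumes L: "L > 0" and h: "integrable (lebesgue_on {0..L}) h"
    and t: "\<And>y n. y \<in> \<rat> \<Longrightarrow> 0 < y \<Longrightarrow> y < L \<Longrightarrow>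
      (\<integral>x. (arc_test L y n x - mean L (arc_test L y n)) * h x \<partial>lebesgue_on {0..L}) = 0"
  shows "AE x in lebesgue_on {0..L}. h x = mean L h"
proof -
  let ?M = "lebesgue_on {0..L}"
  have "AE x in ?M. h x - mean L h = 0"
  proof (rule AE_zero_by_arc_tests[OF L])
    show "integrable ?M (\<lambda>x. h x - mean L h)" using h integrable_const_Icc by auto
    fix y n assume y: "y \<in> \<rat>" "0 < y" "y < L"
    let ?a = "arc_test L y n"
    have i: "integrable ?M (\<lambda>x. ?a x * h x)"
      by (rule integrable_mult_continuous[OF h smooth_continuous[OF arc_test_smooth]])
    have "(\<integral>x. ?a x * (h x - mean L h) \<partial>?M) = (\<integral>x. ?a x * h x \<partial>?M) - (\<integral>x. ?a x \<partial>?M) * mean L h"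
      using i arc_test_integrable[of L y n] by (simp add: right_diff_distrib)
    also have "(\<integral>x. ?a x \<partial>?M) * mean L h = mean L ?a * (\<integral>x. h x \<partial>?M)"
      by (simp add: mean_def)
    also have "(\<integral>x. ?a x * h x \<partial>?M) - mean L ?a * (\<integral>x. h x \<partial>?M) = (\<integral>x. (?a x - mean L ?a) * h x \<partial>?M)"
      using i h by (simp add: left_diff_distrib)
    also have "\<dots> = 0" by (rule t[OF y])
    finally show "(\<integral>x. ?a x * (h x - mean L h) \<partial>?M) = 0" .
  qed
  then show ?thesis by simp
qed

lemma smooth_real_deriv:
  fixes \<zeta> :: "real \<Rightarrow> real"
  assumes "smooth \<zeta>"
  shows "(\<zeta> has_vector_derivative deriv \<zeta> x) (at x)" "smooth (deriv \<zeta>)"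
proof -
  have "(\<zeta> has_real_derivative dx \<zeta> x) (at x)" for x
    using smooth_has_vector_derivative(1)[OF assms]
    by (simp add: has_real_derivative_iff_has_vector_derivative)
  then have "deriv \<zeta> = dx \<zeta>" by (auto simp: DERIV_imp_deriv fun_eq_iff)
  then show "(\<zeta> has_vector_derivative deriv \<zeta> x) (at x)" "smooth (deriv \<zeta>)"
    using smooth_has_vector_derivative[OF assms] by auto
qed

lemma periodic_antiderivative_arc_test:
  assumes L: "L > 0"
  obtains F where "smooth F" "periodic_fun_simple F L" "\<And>x. deriv F x = arc_test L y n x - mean L (arc_test L y n)"
proof -
  let ?m = "mean L (arc_test L y n)"
  obtain F where F: "smooth F" "periodic_fun_simple F L"
    "\<And>x. (F has_vector_derivative arc_test L y n x - ?m) (at x)"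
  proof (rule periodic_antiderivative[OF _ _ L, of "\<lambda>x. arc_test L y n x - ?m"])
    show "smooth (\<lambda>x. arc_test L y n x - ?m)" by (intro smooth_diff arc_test_smooth smooth_const)
    show "periodic_fun_simple (\<lambda>x. arc_test L y n x - ?m) L"
      using arc_test_periodic[OF L] by (simp add: periodic_fun_simple_def)
    show "(\<integral>x. arc_test L y n x - ?m \<partial>lebesgue_on {0..L}) = 0"
    proof -
      have "(\<integral>x. arc_test L y n x - ?m \<partial>lebesgue_on {0..L})
          = (\<integral>x. arc_test L y n x \<partial>lebesgue_on {0..L}) - L *\<^sub>R ?m"
        unfolding Bochner_Integration.integral_diff[OF arc_test_integrable integrable_const_Icc]
          integral_const_Icc[OF less_imp_le[OF L]] ..
      also have "\<dots> = 0" using L by (simp add: mean_def)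
      finally show ?thesis .
    qed
  qed blast
  moreover have "deriv F x = arc_test L y n x - ?m" for x
    using F(3)[of x] by (intro DERIV_imp_deriv) (simp add: has_real_derivative_iff_has_vector_derivative)
  ultimately show ?thesis using that by blast
qed

lemma AE_const_by_derivative_tests:
  fixes h :: "real \<Rightarrow> 'b::euclidean_space"
  assumes L: "L > 0" and h: "integrable (lebesgue_on {0..L}) h"
    and t: "\<And>\<zeta>::real \<Rightarrow> real. smooth \<zeta> \<Longrightarrow> periodic_fun_simple \<zeta> L \<Longrightarrow>
      (\<integral>x. deriv \<zeta> x *\<^sub>R h x \<partial>lebesgue_on {0..L}) = 0"
  shows "\<exists>k. AE x in lebesgue_on {0..L}. h x = k"
proof -
  let ?M = "lebesgue_on {0..L}"
  have comp: "AE x in ?M. h x \<bullet> i = mean L (\<lambda>x. h x \<bullet> i)" for i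
  proof (rule AE_const_by_arc_tests[OF L])
    fix y n
    obtain F where F: "smooth F" "periodic_fun_simple F L"
      "\<And>x. deriv F x = arc_test L y n x - mean L (arc_test L y n)"
      using periodic_antiderivative_arc_test[OF L] by blast
    have "integrable ?M (\<lambda>x. deriv F x *\<^sub>R h x)"
      by (rule integrable_scaleR_continuous[OF h smooth_continuous[OF smooth_real_deriv(2)[OF F(1)]]])
    then have "(\<integral>x. (deriv F x *\<^sub>R h x) \<bullet> i \<partial>?M) = (\<integral>x. deriv F x *\<^sub>R h x \<partial>?M) \<bullet> i"
      by (intro integral_inner_left)
    also have "\<dots> = 0" using t[OF F(1,2)] by simp
    finally have "(\<integral>x. deriv F x * (h x \<bullet> i) \<partial>?M) = 0" by (simp only: inner_scaleR_left)
    then show "(\<integral>x. (arc_test L y n x - mean L (arc_test L y n)) * (h x \<bullet> i) \<partial>?M) = 0"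
      by (simp add: F(3))
  qed (use h in auto)
  have "AE x in ?M. \<forall>i\<in>Basis. h x \<bullet> i = mean L (\<lambda>x. h x \<bullet> i)"
    using comp by (intro AE_finite_allI) auto
  then have "AE x in ?M. h x = (\<Sum>i\<in>Basis. mean L (\<lambda>x. h x \<bullet> i) *\<^sub>R i)"
  proof eventually_elim
    case (elim x)
    have "h x = (\<Sum>i\<in>Basis. (h x \<bullet> i) *\<^sub>R i)" by (simp add: euclidean_representation)
    also have "\<dots> = (\<Sum>i\<in>Basis. mean L (\<lambda>x. h x \<bullet> i) *\<^sub>R i)"
      using elim by (intro sum.cong) auto
    finally show ?case .
  qed
  then show ?thesis by blast
qed

section \<open>Weak derivatives on the circle\<close>

text \<open>
  With \<open>G\<close> the indefinite integral of \<open>g\<close>, integration by parts shows that \<open>f - G\<close> is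
  orthogonal to all derivatives of smooth periodic functions, hence constant.
\<close>
lemma weak_deriv_primitive:
  fixes f g :: "real \<Rightarrow> 'b::euclidean_space"
  assumes L: "L > 0" and w: "weak_deriv L f g"
  obtains F where "primitive L F g" "F L = F 0" "AE x in lebesgue_on {0..L}. f x = F x"
proof -
  let ?M = "lebesgue_on {0..L}"
  have f: "integrable ?M f" and g: "integrable ?M g"
    and t: "\<And>\<zeta>::real \<Rightarrow> real. smooth \<zeta> \<Longrightarrow> periodic_fun_simple \<zeta> L \<Longrightarrow>
       (\<integral>x. deriv \<zeta> x *\<^sub>R f x \<partial>?M) = - (\<integral>x. \<zeta> x *\<^sub>R g x \<partial>?M)"
    using w by (auto simp: weak_deriv_def)
  define G where "G x = integral {0..x} g" for x
  have G: "primitive L G g" using g by (simp add: primitive_def G_def)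
  have "(\<integral>x. g x \<partial>?M) = 0"
    using t[of "\<lambda>_. 1"] smooth_const by (auto simp: periodic_fun_simple_def)
  then have GL: "G L = G 0" using primitive_total[OF G] L by simp
  obtain k where k: "AE x in ?M. f x - G x = k"
  proof (rule exE[OF AE_const_by_derivative_tests[OF L, of "\<lambda>x. f x - G x"]])
    have Gi: "integrable ?M G"
      by (rule integrable_lebesgue_on_continuous[OF primitive_continuous[OF G]])
    then show "integrable ?M (\<lambda>x. f x - G x)" using f by auto
    fix \<zeta> :: "real \<Rightarrow> real" assume \<zeta>: "smooth \<zeta>" "periodic_fun_simple \<zeta> L"
    have d: "primitive L \<zeta> (deriv \<zeta>)"
      by (rule primitive_C1)
        (use smooth_real_deriv[OF \<zeta>(1)] smooth_continuous in \<open>auto intro: has_vector_derivative_at_within\<close>)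
    have "\<zeta> L = \<zeta> 0" using periodic_fun_simple.plus_period[OF \<zeta>(2), of 0] by simp
    note p = primitive_parts[OF bounded_bilinear_scaleR d G _ this GL]
    have c: "continuous_on {0..L} (deriv \<zeta>)"
      by (rule smooth_continuous[OF smooth_real_deriv(2)[OF \<zeta>(1)]])
    have "(\<integral>x. deriv \<zeta> x *\<^sub>R (f x - G x) \<partial>?M)
        = (\<integral>x. deriv \<zeta> x *\<^sub>R f x \<partial>?M) - (\<integral>x. deriv \<zeta> x *\<^sub>R G x \<partial>?M)"
      using integrable_scaleR_continuous[OF f c] integrable_scaleR_continuous[OF Gi c]
      by (simp add: scaleR_diff_right)
    then show "(\<integral>x. deriv \<zeta> x *\<^sub>R (f x - G x) \<partial>?M) = 0"
      using t[OF \<zeta>] p(1) L by simp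
  qed blast
  show ?thesis
  proof (rule that[of "\<lambda>x. G x + k"])
    show "primitive L (\<lambda>x. G x + k) g" using G by (simp add: primitive_def)
    show "AE x in ?M. f x = G x + k" using k by eventually_elim (simp add: algebra_simps)
  qed (use GL in simp)
qed

lemma AE_eq_continuous_Icc:
  fixes f g :: "real \<Rightarrow> 'b::euclidean_space"
  assumes "a < b" "continuous_on {a..b} f" "continuous_on {a..b} g"
    and ae: "AE x in lebesgue_on {a..b}. f x = g x" and x: "x \<in> {a..b}"
  shows "f x = g x"
proof -
  have c: "continuous_on {a..b} (\<lambda>x. norm (f x - g x))" by (intro continuous_intros assms)
  have "(\<integral>x. norm (f x - g x) \<partial>lebesgue_on {a..b}) = (\<integral>x. 0 \<partial>lebesgue_on {a..b})"
    by (rule integral_lebesgue_on_cong_AE) (use ae in \<open>auto elim: eventually_mono\<close>)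
  then have "integral {a..b} (\<lambda>x. norm (f x - g x)) = 0"
    by (simp add: integral_lebesgue_on_eq_HK[OF integrable_lebesgue_on_continuous[OF c]])
  then have "\<forall>x\<in>{a..b}. norm (f x - g x) = 0"
    using integral_eq_0_iff[OF c \<open>a < b\<close>] by auto
  then show ?thesis using x by simp
qed

lemma weak_deriv_continuous_primitive:
  fixes f g :: "real \<Rightarrow> 'b::euclidean_space"
  assumes L: "L > 0" and w: "weak_deriv L f g" and c: "continuous_on {0..L} f"
  shows "primitive L f g"
proof -
  obtain F where F: "primitive L F g" "AE x in lebesgue_on {0..L}. f x = F x"
    using weak_deriv_primitive[OF L w] by blast
  have "f x = F x" if "x \<in> {0..L}" for x
    by (rule AE_eq_continuous_Icc[OF L c primitive_continuous[OF F(1)] F(2) that])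
  then show ?thesis using F(1) L by (auto simp: primitive_def)
qed

lemma primitive_cong_AE:
  assumes "primitive L f g" "AE x in lebesgue_on {0..L}. g x = g' x"
  shows "primitive L f g'"
proof -
  have g: "integrable (lebesgue_on {0..L}) g" using assms by (simp add: primitive_def)
  have g': "integrable (lebesgue_on {0..L}) g'"
    by (rule integrable_lebesgue_on_cong_AE[OF _ assms(2) g]) simp
  have "integral {0..x} g = integral {0..x} g'" if x: "x \<in> {0..L}" for x
  proof -
    have i: "integrable (lebesgue_on {0..x}) g" "integrable (lebesgue_on {0..x}) g'"
      by (rule Equivalence_Lebesgue_Henstock_Integration.integrable_subinterval[OF g]
          Equivalence_Lebesgue_Henstock_Integration.integrable_subinterval[OF g'], use x in auto)+
    have "AE y in lebesgue_on {0..x}. g y = g' y"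
      using assms(2) x by (auto simp: AE_restrict_space_iff elim: eventually_mono)
    then have "integral\<^sup>L (lebesgue_on {0..x}) g = integral\<^sup>L (lebesgue_on {0..x}) g'"
      by (intro integral_lebesgue_on_cong_AE) auto
    then show ?thesis using i by (simp add: integral_lebesgue_on_eq_HK)
  qed
  then show ?thesis using assms(1) g' by (simp add: primitive_def)
qed

lemma primitive_unique_AE:
  fixes f g g' :: "real \<Rightarrow> 'b::euclidean_space"
  assumes "primitive L f g" "primitive L f g'"
  shows "AE x in lebesgue_on {0..L}. g x = g' x"
proof -
  have p: "primitive L (\<lambda>x. 0) (\<lambda>x. g x - g' x)"
    using primitive_diff[OF assms] by simp
  have "AE x in lebesgue_on {0..L}. (g x - g' x) \<bullet> i = 0" for i
    by (rule AE_zero_of_indefinite_integral_zero)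
       (use primitive_bounded_linear[OF bounded_linear_inner_left p, of i] in \<open>auto simp: primitive_def\<close>)
  then have "AE x in lebesgue_on {0..L}. \<forall>i\<in>Basis. (g x - g' x) \<bullet> i = 0"
    by (intro AE_finite_allI) auto
  then show ?thesis
    by eventually_elim (auto simp: euclidean_eq_iff[of "g _"] inner_diff_left)
qed

lemma weak_deriv_unique:
  fixes f g g' :: "real \<Rightarrow> 'b::euclidean_space"
  assumes L: "L > 0" and w: "weak_deriv L f g" "weak_deriv L f g'"
  shows "AE x in lebesgue_on {0..L}. g x = g' x"
proof -
  obtain F where F: "primitive L F g" "AE x in lebesgue_on {0..L}. f x = F x"
    using weak_deriv_primitive[OF L w(1)] by blast
  obtain F' where F': "primitive L F' g'" "AE x in lebesgue_on {0..L}. f x = F' x"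
    using weak_deriv_primitive[OF L w(2)] by blast
  have ae: "AE x in lebesgue_on {0..L}. F x = F' x" using F(2) F'(2) by eventually_elim simp
  have "F x = F' x" if "x \<in> {0..L}" for x
    by (rule AE_eq_continuous_Icc[OF L primitive_continuous[OF F(1)] primitive_continuous[OF F'(1)] ae that])
  then have "primitive L F g'" using F'(1) L by (auto simp: primitive_def)
  then show ?thesis by (rule primitive_unique_AE[OF F(1)])
qed

lemma wderiv_weak_deriv:
  fixes f g :: "real \<Rightarrow> 'b::euclidean_space"
  assumes L: "L > 0" and w: "weak_deriv L f g"
  shows "weak_deriv L f (wderiv L f)" and "AE x in lebesgue_on {0..L}. wderiv L f x = g x"
proof -
  show 1: "weak_deriv L f (wderiv L f)" unfolding wderiv_def by (rule someI[of "weak_deriv L f", OF w])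
  show "AE x in lebesgue_on {0..L}. wderiv L f x = g x" by (rule weak_deriv_unique[OF L 1 w])
qed

lemma weak_deriv_cong_AE:
  assumes w: "weak_deriv L f g" and p: "periodic_fun_simple f' L"
    and ae: "AE x in lebesgue_on {0..L}. f x = f' x"
  shows "weak_deriv L f' g"
proof -
  have "integrable (lebesgue_on {0..L}) f'"
    by (rule integrable_lebesgue_on_cong_AE[OF _ ae]) (use w in \<open>auto simp: weak_deriv_def\<close>)
  moreover have "(\<integral>x. deriv \<zeta> x *\<^sub>R f' x \<partial>lebesgue_on {0..L}) = (\<integral>x. deriv \<zeta> x *\<^sub>R f x \<partial>lebesgue_on {0..L})"
    for \<zeta> :: "real \<Rightarrow> real"
    by (rule integral_lebesgue_on_cong_AE) (use ae in \<open>auto elim: eventually_mono\<close>)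
  ultimately show ?thesis using w p by (simp add: weak_deriv_def)
qed

text \<open>
  The values on \<open>[0, L)\<close> are continued periodically; the value of \<open>g\<close> at \<open>L\<close> is lost, which
  does not matter up to null sets.
\<close>
definition periodic_extension :: "real \<Rightarrow> (real \<Rightarrow> 'b) \<Rightarrow> real \<Rightarrow> 'b" where
  "periodic_extension L g x = g (x - L * of_int \<lfloor>x / L\<rfloor>)"

lemma periodic_extension_periodic:
  assumes "L > 0"
  shows "periodic_fun_simple (periodic_extension L g) L"
proof
  fix x
  have "(x + L) / L = x / L + 1" using assms by (simp add: field_simps)
  then have "\<lfloor>(x + L) / L\<rfloor> = \<lfloor>x / L\<rfloor> + 1" by (metis floor_add_int of_int_1)
  then show "periodic_extension L g (x + L) = periodic_extension L g x"
    by (simp add: periodic_extension_def algebra_simps)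
qed

lemma periodic_extension_eq:
  assumes "0 \<le> x" "x < L"
  shows "periodic_extension L g x = g x"
proof -
  have "\<lfloor>x / L\<rfloor> = 0" using assms by (intro floor_unique) (auto simp: divide_simps)
  then show ?thesis by (simp add: periodic_extension_def)
qed

lemma AE_interior:
  assumes "\<And>x. a < x \<Longrightarrow> x < b \<Longrightarrow> P x"
  shows "AE x in lebesgue_on {a..b::real}. P x"
proof -
  have "AE x in lebesgue. x \<notin> {a, b}" by (intro AE_not_in) simp
  then have "AE x in lebesgue. x \<in> {a..b} \<longrightarrow> P x"
    by eventually_elim (use assms in force)
  then show ?thesis by (simp add: AE_restrict_space_iff)
qed

text \<open>
  The converse direction. A density on \<open>[0, L]\<close> has to be continued periodically, since weak
  derivatives are functions on the whole line.
\<close>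
lemma weak_deriv_of_primitive:
  fixes f F g :: "real \<Rightarrow> 'b::euclidean_space"
  assumes L: "L > 0" and p: "periodic_fun_simple f L"
    and ae: "AE x in lebesgue_on {0..L}. f x = F x"
    and F: "primitive L F g" "F L = F 0"
  obtains g' where "weak_deriv L f g'" "AE x in lebesgue_on {0..L}. g' x = g x"
proof -
  let ?M = "lebesgue_on {0..L}"
  define g' where "g' = periodic_extension L g"
  have aeg: "AE x in ?M. g x = g' x"
    by (rule AE_interior) (simp add: g'_def periodic_extension_eq)
  have g: "integrable ?M g'"
    by (rule integrable_lebesgue_on_cong_AE[OF _ aeg]) (use F(1) in \<open>auto simp: primitive_def\<close>)
  have aef: "AE x in ?M. F x = f x" using ae by eventually_elim simp
  have f: "integrable ?M f"
    by (rule integrable_lebesgue_on_cong_AE[OF _ aef])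
       (use integrable_lebesgue_on_continuous[OF primitive_continuous[OF F(1)]] in auto)
  have "(\<integral>x. deriv \<zeta> x *\<^sub>R f x \<partial>?M) = - (\<integral>x. \<zeta> x *\<^sub>R g' x \<partial>?M)"
    if \<zeta>: "smooth \<zeta>" "periodic_fun_simple \<zeta> L" for \<zeta> :: "real \<Rightarrow> real"
  proof -
    have d: "primitive L \<zeta> (deriv \<zeta>)"
      by (rule primitive_C1)
        (use smooth_real_deriv[OF \<zeta>(1)] smooth_continuous in \<open>auto intro: has_vector_derivative_at_within\<close>)
    have "\<zeta> L = \<zeta> 0" using periodic_fun_simple.plus_period[OF \<zeta>(2), of 0] by simp
    note parts = primitive_parts(1)[OF bounded_bilinear_scaleR d F(1) _ this F(2)]
    have "(\<integral>x. deriv \<zeta> x *\<^sub>R f x \<partial>?M) = (\<integral>x. deriv \<zeta> x *\<^sub>R F x \<partial>?M)"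
      by (rule integral_lebesgue_on_cong_AE) (use ae in \<open>auto elim: eventually_mono\<close>)
    moreover have "(\<integral>x. \<zeta> x *\<^sub>R g' x \<partial>?M) = (\<integral>x. \<zeta> x *\<^sub>R g x \<partial>?M)"
      by (rule integral_lebesgue_on_cong_AE) (use aeg in \<open>auto elim: eventually_mono\<close>)
    ultimately show ?thesis using parts L by simp
  qed
  then have "weak_deriv L f g'"
    using f g p periodic_extension_periodic[OF L, of g] by (simp add: weak_deriv_def g'_def)
  moreover have "AE x in ?M. g' x = g x" using aeg by eventually_elim simp
  ultimately show ?thesis by (rule that)
qed

section \<open>The second-order lemma of du Bois-Reymond\<close>

lemma arc_potential_exists:
  assumes L: "L > 0"
  shows "\<exists>\<psi>::real \<Rightarrow> real. smooth \<psi> \<and> periodic_fun_simple \<psi> L \<and>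
    (\<forall>x. dx (dx \<psi>) x = arc_test L y n x - mean L (arc_test L y n))"
proof -
  obtain F where F: "smooth F" "periodic_fun_simple F L"
    "\<And>x. deriv F x = arc_test L y n x - mean L (arc_test L y n)"
    using periodic_antiderivative_arc_test[OF L] by blast
  obtain \<psi> where \<psi>: "smooth \<psi>" "periodic_fun_simple \<psi> L"
    "\<And>x. (\<psi> has_vector_derivative F x - mean L F) (at x)"
  proof (rule periodic_antiderivative[OF _ _ L, of "\<lambda>x. F x - mean L F"])
    have Fi: "integrable (lebesgue_on {0..L}) F"
      by (rule integrable_lebesgue_on_continuous[OF smooth_continuous[OF F(1)]])
    have "(\<integral>x. F x - mean L F \<partial>lebesgue_on {0..L}) = (\<integral>x. F x \<partial>lebesgue_on {0..L}) - L *\<^sub>R mean L F"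
      unfolding Bochner_Integration.integral_diff[OF Fi integrable_const_Icc]
        integral_const_Icc[OF less_imp_le[OF L]] ..
    also have "\<dots> = 0" using L by (simp add: mean_def)
    finally show "(\<integral>x. F x - mean L F \<partial>lebesgue_on {0..L}) = 0" .
  qed (use F in \<open>auto intro: smooth_diff smooth_const simp: periodic_fun_simple_def\<close>)
  have "dx \<psi> = (\<lambda>x. F x - mean L F)"
    using \<psi>(3) by (auto simp: dx_def vector_derivative_at)
  moreover have "((\<lambda>x. F x - mean L F) has_vector_derivative deriv F x) (at x)" for x
    using smooth_real_deriv(1)[OF F(1)] by (auto intro!: derivative_eq_intros)
  ultimately have "dx (dx \<psi>) x = arc_test L y n x - mean L (arc_test L y n)" for x
    using F(3) by (simp add: dx_def vector_derivative_at)
  then show ?thesis using \<psi> by blast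
qed

text \<open>
  A fixed choice of a periodic solution of \<open>\<psi>'' = \<zeta> - \<integral>\<zeta>/L\<close> for each arc test \<open>\<zeta>\<close>. These
  countably many functions, for rational \<open>y\<close>, together with the constant 1 determine every
  linear functional of the form \<open>\<psi> \<mapsto> \<integral> c\<^sub>0 \<psi> + c\<^sub>1 \<psi>' + c\<^sub>2 \<psi>''\<close> with integrable coefficients.
\<close>
definition arc_potential :: "real \<Rightarrow> real \<Rightarrow> nat \<Rightarrow> real \<Rightarrow> real" where
  "arc_potential L y n = (SOME \<psi>. smooth \<psi> \<and> periodic_fun_simple \<psi> L \<and>
    (\<forall>x. dx (dx \<psi>) x = arc_test L y n x - mean L (arc_test L y n)))"

lemma arc_potential:
  assumes L: "L > 0"
  shows "smooth (arc_potential L y n)" "periodic_fun_simple (arc_potential L y n) L"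
    "dx (dx (arc_potential L y n)) x = arc_test L y n x - mean L (arc_test L y n)"
  using someI_ex[OF arc_potential_exists[OF L, of y n]] unfolding arc_potential_def by blast+

lemma smooth_primitive:
  fixes f :: "real \<Rightarrow> 'b::euclidean_space"
  assumes "smooth f"
  shows "primitive L f (dx f)"
  by (rule primitive_C1)
    (use smooth_has_vector_derivative[OF assms] smooth_continuous in \<open>auto intro: has_vector_derivative_at_within\<close>)

lemma dx_periodic:
  fixes \<gamma> :: "real \<Rightarrow> 'b::euclidean_space"
  assumes "periodic_fun_simple \<gamma> L"
  shows "periodic_fun_simple (dx \<gamma>) L"
proof
  fix x
  have sh: "((\<lambda>x. f (x + c)) has_vector_derivative d) (at x)"
    if "(f has_vector_derivative d) (at (x + c))" for f :: "real \<Rightarrow> 'b" and c d x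
  proof -
    have "((\<lambda>x. x + c) has_real_derivative 1) (at x)" by (auto intro!: derivative_eq_intros)
    from vector_diff_chain_at[OF this[unfolded has_real_derivative_iff_has_vector_derivative] that]
    show ?thesis by (simp add: o_def)
  qed
  have p: "\<gamma> (x + L) = \<gamma> x" for x by (rule periodic_fun_simple.plus_period[OF assms])
  have "(\<gamma> has_vector_derivative d) (at (x + L)) \<longleftrightarrow> (\<gamma> has_vector_derivative d) (at x)" for d
  proof
    assume "(\<gamma> has_vector_derivative d) (at (x + L))"
    from sh[OF this] show "(\<gamma> has_vector_derivative d) (at x)" by (simp add: p)
  next
    assume "(\<gamma> has_vector_derivative d) (at x)"
    then have "(\<gamma> has_vector_derivative d) (at (x + L + - L))" by simp
    from sh[OF this] have "((\<lambda>x. \<gamma> (x + - L)) has_vector_derivative d) (at (x + L))" .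
    moreover have "\<gamma> (x + - L) = \<gamma> x" for x using p[of "x - L"] by simp
    ultimately show "(\<gamma> has_vector_derivative d) (at (x + L))" by simp
  qed
  then show "dx \<gamma> (x + L) = dx \<gamma> x" by (simp add: dx_def vector_derivative_def)
qed

lemma periodic_ends: "periodic_fun_simple f L \<Longrightarrow> f L = f 0"
  using periodic_fun_simple.plus_period[of f L 0] by simp

text \<open>
  The point is that vanishing on countably many smooth functions implies vanishing on all
  periodic functions with two integrable weak derivatives, although \<open>c\<^sub>2\<close> is only integrable.
  Integrating by parts twice moves all derivatives onto \<open>\<psi>\<close>: the functional becomes
  \<open>\<integral> (c\<^sub>2 - C\<^sub>1) \<psi>''\<close> with an absolutely continuous \<open>C\<^sub>1\<close> built from \<open>c\<^sub>0\<close> and \<open>c\<^sub>1\<close>. The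
  tests force \<open>c\<^sub>2 - C\<^sub>1\<close> to be constant, and then the integration by parts can be undone with
  \<open>w\<close> in place of \<open>\<psi>\<close>.
\<close>
lemma second_order_du_Bois_Reymond:
  fixes c0 c1 c2 :: "real \<Rightarrow> real"
  assumes L: "L > 0"
    and c: "integrable (lebesgue_on {0..L}) c0" "integrable (lebesgue_on {0..L}) c1"
      "integrable (lebesgue_on {0..L}) c2"
    and t1: "(\<integral>x. c0 x \<partial>lebesgue_on {0..L}) = 0"
    and t2: "\<And>(y::real) n. y \<in> \<rat> \<Longrightarrow>
      (\<integral>x. c0 x * arc_potential L y n x + c1 x * dx (arc_potential L y n) x
           + c2 x * dx (dx (arc_potential L y n)) x \<partial>lebesgue_on {0..L}) = 0"
    and w: "primitive L w w1" "primitive L w1 w2" "w L = w 0" "w1 L = w1 0"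
  shows "integrable (lebesgue_on {0..L}) (\<lambda>x. c2 x * w2 x)"
    and "(\<integral>x. c0 x * w x + c1 x * w1 x + c2 x * w2 x \<partial>lebesgue_on {0..L}) = 0"
proof -
  let ?M = "lebesgue_on {0..L}"
  have L0: "0 \<le> L" using L by simp
  define C0 where "C0 x = integral {0..x} c0" for x
  have C0: "primitive L C0 c0" using c by (simp add: primitive_def C0_def)
  have C0L: "C0 L = C0 0" using primitive_total[OF C0 L0] t1 by simp
  have C0i: "integrable ?M C0" by (rule integrable_lebesgue_on_continuous[OF primitive_continuous[OF C0]])
  \<comment> \<open>The mean is removed so that the indefinite integral \<open>C1\<close> of \<open>d1\<close> is periodic; it does not
      change the functional, because derivatives of periodic functions have mean zero.\<close>
  define m where "m = mean L (\<lambda>x. c1 x - C0 x)"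
  define d1 where "d1 x = c1 x - C0 x - m" for x
  have d1i: "integrable ?M d1" unfolding d1_def using c C0i integrable_const_Icc by auto
  have d10: "(\<integral>x. d1 x \<partial>?M) = 0"
  proof -
    have "(\<integral>x. d1 x \<partial>?M) = (\<integral>x. c1 x - C0 x \<partial>?M) - L *\<^sub>R m"
      unfolding d1_def
      by (subst Bochner_Integration.integral_diff)
         (use c C0i integrable_const_Icc integral_const_Icc[OF L0, of m] in \<open>simp_all only: Bochner_Integration.integrable_diff\<close>)
    also have "\<dots> = 0" using L by (simp add: mean_def m_def)
    finally show ?thesis .
  qed
  define C1 where "C1 x = integral {0..x} d1" for x
  have C1: "primitive L C1 d1" using d1i by (simp add: primitive_def C1_def)
  have C1L: "C1 L = C1 0" using primitive_total[OF C1 L0] d10 by simp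
  have C1i: "integrable ?M C1" by (rule integrable_lebesgue_on_continuous[OF primitive_continuous[OF C1]])
  have lower: "integrable ?M (\<lambda>x. c0 x * w x + c1 x * w1 x)"
      "(\<integral>x. c0 x * w x + c1 x * w1 x \<partial>?M) = - (\<integral>x. C1 x * w2 x \<partial>?M)"
      "integrable ?M (\<lambda>x. C1 x * w2 x)"
    if w: "primitive L w w1" "primitive L w1 w2" "w L = w 0" "w1 L = w1 0" for w w1 w2
  proof -
    note p1 = primitive_parts[OF bounded_bilinear_mult w(1) C0 L0 w(3) C0L]
    note p2 = primitive_parts[OF bounded_bilinear_mult w(2) C1 L0 w(4) C1L]
    have w1i: "integrable ?M w1" by (rule primitive_integrable[OF w(1)])
    have w1c: "continuous_on {0..L} w1" by (rule primitive_continuous[OF w(2)])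
    have i1: "integrable ?M (\<lambda>x. c1 x * w1 x)"
      using integrable_mult_continuous[OF c(2) w1c] by (simp add: mult.commute)
    have i0: "integrable ?M (\<lambda>x. c0 x * w x)" using p1(2) by (simp add: mult.commute)
    have iC: "integrable ?M (\<lambda>x. w1 x * C0 x)" using p1(3) .
    have im: "integrable ?M (\<lambda>x. m * w1 x)" using w1i by simp
    show "integrable ?M (\<lambda>x. c0 x * w x + c1 x * w1 x)" using i0 i1 by auto
    show i2: "integrable ?M (\<lambda>x. C1 x * w2 x)" using p2(3) by (simp add: mult.commute)
    have w10: "(\<integral>x. w1 x \<partial>?M) = 0" using primitive_total[OF w(1) L0] w(3) by simp
    have "(\<integral>x. c0 x * w x + c1 x * w1 x \<partial>?M) = (\<integral>x. w x * c0 x \<partial>?M) + (\<integral>x. c1 x * w1 x \<partial>?M)"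
      using i0 i1 by (simp add: mult.commute)
    also have "\<dots> = (\<integral>x. c1 x * w1 x \<partial>?M) - (\<integral>x. w1 x * C0 x \<partial>?M) - (\<integral>x. m * w1 x \<partial>?M)"
      using p1(1) w10 by simp
    also have "\<dots> = (\<integral>x. c1 x * w1 x - w1 x * C0 x - m * w1 x \<partial>?M)"
      using i1 iC im by simp
    also have "\<dots> = (\<integral>x. w1 x * d1 x \<partial>?M)"
      by (rule Bochner_Integration.integral_cong) (auto simp: d1_def algebra_simps)
    also have "\<dots> = - (\<integral>x. C1 x * w2 x \<partial>?M)" using p2(1) by (simp add: mult.commute)
    finally show "(\<integral>x. c0 x * w x + c1 x * w1 x \<partial>?M) = - (\<integral>x. C1 x * w2 x \<partial>?M)" .
  qed
  have ae: "AE x in ?M. c2 x - C1 x = mean L (\<lambda>x. c2 x - C1 x)"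
  proof (rule AE_const_by_arc_tests[OF L])
    show "integrable ?M (\<lambda>x. c2 x - C1 x)" using c C1i by auto
    fix y :: real and n assume y: "y \<in> \<rat>"
    let ?p = "arc_potential L y n" and ?a = "\<lambda>x. arc_test L y n x - mean L (arc_test L y n)"
    have s: "smooth ?p" "smooth (dx ?p)" "smooth (dx (dx ?p))"
      using arc_potential(1)[OF L] smooth_has_vector_derivative(2) by blast+
    note l = lower[OF smooth_primitive[OF s(1)] smooth_primitive[OF s(2)]
        periodic_ends[OF arc_potential(2)[OF L]] periodic_ends[OF dx_periodic[OF arc_potential(2)[OF L]]]]
    have i2: "integrable ?M (\<lambda>x. c2 x * dx (dx ?p) x)"
      using integrable_mult_continuous[OF c(3) smooth_continuous[OF s(3)]] by (simp add: mult.commute)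
    have "0 = (\<integral>x. (c0 x * ?p x + c1 x * dx ?p x) + c2 x * dx (dx ?p) x \<partial>?M)"
      using t2[OF y] by simp
    also have "\<dots> = (\<integral>x. c0 x * ?p x + c1 x * dx ?p x \<partial>?M) + (\<integral>x. c2 x * dx (dx ?p) x \<partial>?M)"
      by (rule Bochner_Integration.integral_add[OF l(1) i2])
    also have "\<dots> = (\<integral>x. c2 x * dx (dx ?p) x - C1 x * dx (dx ?p) x \<partial>?M)"
      using l i2 by simp
    also have "\<dots> = (\<integral>x. ?a x * (c2 x - C1 x) \<partial>?M)"
      by (rule Bochner_Integration.integral_cong) (auto simp: arc_potential(3)[OF L] algebra_simps)
    finally show "(\<integral>x. ?a x * (c2 x - C1 x) \<partial>?M) = 0" by simp
  qed
  define k where "k = mean L (\<lambda>x. c2 x - C1 x)"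
  have ae2: "AE x in ?M. C1 x * w2 x + k * w2 x = c2 x * w2 x"
    using ae unfolding k_def[symmetric] by eventually_elim (simp add: algebra_simps)
  have w2i: "integrable ?M w2" by (rule primitive_integrable[OF w(2)])
  have i: "integrable ?M (\<lambda>x. C1 x * w2 x + k * w2 x)" using lower(3)[OF w] w2i by auto
  show i2: "integrable ?M (\<lambda>x. c2 x * w2 x)"
    by (rule integrable_lebesgue_on_cong_AE[OF _ ae2 i]) simp
  have "(\<integral>x. c2 x * w2 x \<partial>?M) = (\<integral>x. C1 x * w2 x + k * w2 x \<partial>?M)"
    using integral_lebesgue_on_cong_AE[OF _ ae2] by simp
  also have "\<dots> = (\<integral>x. C1 x * w2 x \<partial>?M)"
    using lower(3)[OF w] w2i primitive_total[OF w(2) L0] w(4) by simp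
  finally show "(\<integral>x. c0 x * w x + c1 x * w1 x + c2 x * w2 x \<partial>?M) = 0"
    using lower[OF w] i2 by simp
qed

section \<open>Energy density\<close>

text \<open>
  The squared area of the parallelogram spanned by \<open>u\<close> and \<open>a\<close>. With \<open>u = \<gamma>'\<close> and \<open>a = \<gamma>''\<close>
  one has \<open>|\<kappa>|\<^sup>2 |u|\<^sup>6 = gram u a\<close>. Writing the energy with a power of this polynomial,
  instead of a power of the norm of the curvature, makes the density continuously
  differentiable also where the curvature vanishes, because \<open>p / 2 > 1\<close>.
\<close>
definition gram :: "'a::real_inner \<Rightarrow> 'a \<Rightarrow> real" where
  "gram u a = (a \<bullet> a) * (u \<bullet> u) - (a \<bullet> u)\<^sup>2"

definition dgram :: "'a::real_inner \<Rightarrow> 'a \<Rightarrow> 'a \<Rightarrow> 'a \<Rightarrow> real" where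
  "dgram u a v b = 2 * (a \<bullet> b) * (u \<bullet> u) + 2 * (a \<bullet> a) * (u \<bullet> v) - 2 * (a \<bullet> u) * (b \<bullet> u + a \<bullet> v)"

text \<open>
  The integrand of the energy as a function of \<open>u = \<gamma>'\<close> and \<open>a = \<gamma>''\<close>. Powers of the speed are
  written as powers of \<open>u \<bullet> u\<close>, which is smooth.
\<close>
definition density :: "real \<Rightarrow> real \<Rightarrow> 'a::real_inner \<Rightarrow> 'a \<Rightarrow> real" where
  "density p lam u a = 1 / p * gram u a powr (p / 2) * (u \<bullet> u) powr ((1 - 3 * p) / 2)
     + lam * (u \<bullet> u) powr (1 / 2)"

text \<open>
  The derivative of \<^const>\<open>density\<close> at \<open>(u, a)\<close> in direction \<open>(v, b)\<close>.
\<close>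
definition ddensity :: "real \<Rightarrow> real \<Rightarrow> 'a::real_inner \<Rightarrow> 'a \<Rightarrow> 'a \<Rightarrow> 'a \<Rightarrow> real" where
  "ddensity p lam u a v b =
     1 / 2 * gram u a powr (p / 2 - 1) * dgram u a v b * (u \<bullet> u) powr ((1 - 3 * p) / 2)
     + 1 / p * gram u a powr (p / 2) * ((1 - 3 * p) * (u \<bullet> u) powr ((1 - 3 * p) / 2 - 1) * (u \<bullet> v))
     + lam * ((u \<bullet> u) powr (1 / 2 - 1) * (u \<bullet> v))"

lemma gram_nonneg: "gram u a \<ge> 0"
  using Cauchy_Schwarz_ineq[of a u] by (simp add: gram_def)

text \<open>
  The absolute value only serves to have a function on the whole line whose derivative at 0
  exists as a two-sided one.
\<close>
lemma abs_powr_has_derivative: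
  fixes z q :: real
  assumes "z \<ge> 0" "q > 1"
  shows "((\<lambda>z. \<bar>z\<bar> powr q) has_real_derivative q * z powr (q - 1)) (at z)"
proof (cases "z = 0")
  case True
  have "((\<lambda>y::real. \<bar>y\<bar> powr (q - 1)) \<longlongrightarrow> 0) (at 0)"
    using assms by (intro tendsto_zero_powrI[where b = "q - 1"] tendsto_eq_intros) auto
  then have "((\<lambda>y::real. (\<bar>y\<bar> powr q - \<bar>0\<bar> powr q) / (y - 0)) \<longlongrightarrow> 0) (at 0)"
  proof (rule Lim_null_comparison[rotated])
    show "\<forall>\<^sub>F y in at 0. norm ((\<bar>y\<bar> powr q - \<bar>0\<bar> powr q) / (y - 0)) \<le> \<bar>y::real\<bar> powr (q - 1)"
    proof (rule always_eventually, rule allI)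
      fix y :: real
      show "norm ((\<bar>y\<bar> powr q - \<bar>0\<bar> powr q) / (y - 0)) \<le> \<bar>y\<bar> powr (q - 1)"
        by (cases "y = 0") (auto simp: powr_diff)
    qed
  qed
  then show ?thesis using True by (simp add: has_field_derivative_iff)
next
  case False
  then have z: "z > 0" using assms by simp
  have "((\<lambda>z. z powr q) has_real_derivative q * z powr (q - 1)) (at z)"
    by (rule has_real_derivative_powr[OF z])
  then show ?thesis
    by (rule has_field_derivative_transform_within_open[where S = "{0<..}"]) (use z in auto)
qed

lemma has_derivative_powr_nonneg:
  fixes f :: "'a::real_normed_vector \<Rightarrow> real"
  assumes f: "(f has_derivative f') (at x)" and nn: "\<And>y. f y \<ge> 0" and q: "q > 1"
  shows "((\<lambda>y. f y powr q) has_derivative (\<lambda>v. q * f x powr (q - 1) * f' v)) (at x)"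
proof -
  have "((\<lambda>z. \<bar>z\<bar> powr q) has_derivative (\<lambda>v. q * f x powr (q - 1) * v)) (at (f x))"
    using abs_powr_has_derivative[OF nn q, of x] by (simp add: has_field_derivative_def)
  from diff_chain_at[OF f this] show ?thesis using nn by (simp add: o_def)
qed

lemma has_derivative_powr_pos:
  fixes f :: "'a::real_normed_vector \<Rightarrow> real"
  assumes f: "(f has_derivative f') (at x)" and pos: "f x > 0"
  shows "((\<lambda>y. f y powr q) has_derivative (\<lambda>v. q * f x powr (q - 1) * f' v)) (at x)"
proof -
  have "((\<lambda>z. z powr q) has_derivative (\<lambda>v. q * f x powr (q - 1) * v)) (at (f x))"
    using has_real_derivative_powr[OF pos, of q] by (simp add: has_field_derivative_def)
  from diff_chain_at[OF f this] show ?thesis by (simp add: o_def)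
qed

text \<open>
  The assumption \<open>p > 2\<close> enters here: it makes the power \<open>p / 2\<close> of the Gram determinant
  differentiable at its zeros.
\<close>
lemma density_has_derivative:
  fixes z :: "'a::euclidean_space \<times> 'a"
  assumes p: "p > 2" and u: "fst z \<noteq> 0"
  shows "((\<lambda>z. density p lam (fst z) (snd z)) has_derivative
     (\<lambda>h. ddensity p lam (fst z) (snd z) (fst h) (snd h))) (at z)"
proof -
  have g: "((\<lambda>z. gram (fst z) (snd z)) has_derivative
      (\<lambda>h. dgram (fst z) (snd z) (fst h) (snd h))) (at z)"
    unfolding gram_def dgram_def power2_eq_square
    by (auto intro!: derivative_eq_intros simp: inner_commute algebra_simps)
  have n: "((\<lambda>z. fst z \<bullet> fst z) has_derivative (\<lambda>h. 2 * (fst z \<bullet> fst h))) (at z)"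
    by (auto intro!: derivative_eq_intros simp: inner_commute)
  have pos: "fst z \<bullet> fst z > 0" using u by simp
  have q: "p / 2 > 1" using p by simp
  note d1 = has_derivative_powr_nonneg[OF g gram_nonneg q]
  note d2 = has_derivative_powr_pos[OF n pos]
  show ?thesis
    unfolding density_def ddensity_def
    by (rule has_derivative_eq_rhs)
      (rule has_derivative_add has_derivative_mult has_derivative_const d1 d2
        | use p in \<open>auto simp: fun_eq_iff field_simps\<close>)+
qed

lemma continuous_gram [continuous_intros]:
  fixes f g :: "'c::topological_space \<Rightarrow> 'a::euclidean_space"
  assumes "continuous_on S f" "continuous_on S g"
  shows "continuous_on S (\<lambda>x. gram (f x) (g x))"
  unfolding gram_def by (intro continuous_intros assms)

lemma continuous_gram_powr:
  fixes u a :: "'c::topological_space \<Rightarrow> 'a::euclidean_space"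
  assumes "continuous_on S u" "continuous_on S a" "q > 0"
  shows "continuous_on S (\<lambda>x. gram (u x) (a x) powr q)"
  by (rule continuous_on_powr'[OF continuous_gram[OF assms(1,2)] continuous_on_const])
     (use assms(3) gram_nonneg in auto)

lemma continuous_speed_powr:
  fixes u :: "'c::topological_space \<Rightarrow> 'a::euclidean_space"
  assumes "continuous_on S u" "\<And>x. x \<in> S \<Longrightarrow> u x \<noteq> 0"
  shows "continuous_on S (\<lambda>x. (u x \<bullet> u x) powr q)"
  by (rule continuous_on_powr[OF continuous_on_inner[OF assms(1,1)] continuous_on_const])
     (use assms(2) in auto)

lemma continuous_ddensity:
  fixes u a v b :: "'c::topological_space \<Rightarrow> 'a::euclidean_space"
  assumes p: "p > 2"
    and c: "continuous_on S u" "continuous_on S a" "continuous_on S v" "continuous_on S b"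
    and nz: "\<And>x. x \<in> S \<Longrightarrow> u x \<noteq> 0"
  shows "continuous_on S (\<lambda>x. ddensity p lam (u x) (a x) (v x) (b x))"
proof -
  have g: "continuous_on S (\<lambda>x. gram (u x) (a x) powr q)" if "q > 0" for q
    by (rule continuous_gram_powr[OF c(1,2) that])
  have n: "continuous_on S (\<lambda>x. (u x \<bullet> u x) powr q)" for q
    by (rule continuous_speed_powr[OF c(1) nz])
  have q: "p / 2 - 1 > 0" "p / 2 > 0" using p by auto
  have d: "continuous_on S (\<lambda>x. dgram (u x) (a x) (v x) (b x))"
    unfolding dgram_def by (intro continuous_intros c)
  show ?thesis
    unfolding ddensity_def
    by (rule continuous_on_add continuous_on_mult continuous_on_const continuous_on_inner c d n
        g[OF q(1)] g[OF q(2)])+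
qed

lemma continuous_density:
  fixes u a :: "'c::topological_space \<Rightarrow> 'a::euclidean_space"
  assumes p: "p > 2"
    and c: "continuous_on S u" "continuous_on S a" and nz: "\<And>x. x \<in> S \<Longrightarrow> u x \<noteq> 0"
  shows "continuous_on S (\<lambda>x. density p lam (u x) (a x))"
proof -
  have n: "continuous_on S (\<lambda>x. (u x \<bullet> u x) powr q)" for q
    by (rule continuous_speed_powr[OF c(1) nz])
  have q: "p / 2 > 0" using p by auto
  show ?thesis
    unfolding density_def
    by (rule continuous_on_add continuous_on_mult continuous_on_const n continuous_gram_powr[OF c q])+
qed

lemma ddensity_linear: "linear (\<lambda>h. ddensity p lam u a (fst h) (snd h))"
  by (rule linearI) (simp_all add: ddensity_def dgram_def inner_add_right inner_add_left algebra_simps)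

lemma ddensity_add:
  "ddensity p lam u a (v + v') (b + b') = ddensity p lam u a v b + ddensity p lam u a v' b'"
  using linear_add[OF ddensity_linear, of p lam u a "(v, b)" "(v', b')"] by simp

lemma ddensity_scale: "ddensity p lam u a (c *\<^sub>R v) (c *\<^sub>R b) = c * ddensity p lam u a v b"
  using linear_cmul[OF ddensity_linear, of p lam u a c "(v, b)"] by simp

text \<open>
  Infinitesimal reparametrisation invariance. A change of parameter with derivatives \<open>c, d\<close>
  turns \<open>(u, a)\<close> into \<open>(c u, c\<^sup>2 a + d u)\<close> and multiplies the density by \<open>c\<close>; differentiating
  at \<open>c = 1, d = 0\<close> gives this identity. Here it follows from
  \<open>dgram u a (c u) (2 c a + d u) = 6 c gram u a\<close>.
\<close>
lemma ddensity_reparametrisation: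
  fixes u a :: "'a::euclidean_space"
  assumes p: "p > 2" and u: "u \<noteq> 0"
  shows "ddensity p lam u a (c *\<^sub>R u) ((2 * c) *\<^sub>R a + d *\<^sub>R u) = c * density p lam u a"
proof -
  have pos: "u \<bullet> u > 0" using u by simp
  have dg: "dgram u a (c *\<^sub>R u) ((2 * c) *\<^sub>R a + d *\<^sub>R u) = 6 * c * gram u a"
    by (simp add: dgram_def gram_def inner_add_left inner_add_right inner_commute power2_eq_square algebra_simps)
  have g: "gram u a powr (p / 2 - 1) * gram u a = gram u a powr (p / 2)"
  proof (cases "gram u a = 0")
    case False
    then show ?thesis using gram_nonneg[of u a] by (simp add: powr_diff)
  qed (use p in simp)
  have n: "(u \<bullet> u) powr (q - 1) * (u \<bullet> u) = (u \<bullet> u) powr q" for q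
    using pos by (simp add: powr_diff)
  let ?G = "gram u a powr (p / 2)" and ?N = "(u \<bullet> u) powr ((1 - 3 * p) / 2)"
  have "ddensity p lam u a (c *\<^sub>R u) ((2 * c) *\<^sub>R a + d *\<^sub>R u)
    = 3 * c * (gram u a powr (p / 2 - 1) * gram u a) * ?N
      + 1 / p * ?G * (1 - 3 * p) * c * ((u \<bullet> u) powr ((1 - 3 * p) / 2 - 1) * (u \<bullet> u))
      + lam * c * ((u \<bullet> u) powr (1 / 2 - 1) * (u \<bullet> u))"
  proof -
    have "1 / 2 * A * (6 * c * B) * N + 1 / p * G * ((1 - 3 * p) * N' * (c * S)) + lam * (M * (c * S))
      = 3 * c * (A * B) * N + 1 / p * G * (1 - 3 * p) * c * (N' * S) + lam * c * (M * S)"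
      for A B G N N' S M :: real
      by simp
    then show ?thesis unfolding ddensity_def dg inner_scaleR_right .
  qed
  also have "\<dots> = 3 * c * ?G * ?N + 1 / p * ?G * (1 - 3 * p) * c * ?N + lam * c * (u \<bullet> u) powr (1 / 2)"
    unfolding g n ..
  also have "\<dots> = c * density p lam u a"
  proof -
    have "3 * c * G * N + 1 / p * G * (1 - 3 * p) * c * N + lam * c * M = c * (1 / p * G * N + lam * M)"
      for G N M :: real
      using p by (simp add: field_simps)
    then show ?thesis unfolding density_def .
  qed
  finally show ?thesis .
qed

text \<open>
  The heart of the argument. The first variation in a tangential direction \<open>f u\<close> is the
  integral of \<open>f DF(u, a)[a, c] + f' F(u, a)\<close> by the previous identity, where \<open>F\<close> is the
  density and \<open>c = a'\<close>. This is the derivative of the periodic function \<open>f F(u, a)\<close>. It is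
  needed that \<open>a\<close> itself is absolutely continuous, which is the additional regularity of
  \<open>W\<^bsup>3,p\<^esup>\<close>-curves.
\<close>
lemma tangential_variation_zero:
  fixes u a c :: "real \<Rightarrow> 'a::euclidean_space" and f f1 f2 :: "real \<Rightarrow> real"
  assumes p: "p > 2" and L: "0 \<le> L"
    and u: "primitive L u a" "primitive L a c" "u L = u 0" "a L = a 0" "\<And>x. x \<in> {0..L} \<Longrightarrow> u x \<noteq> 0"
    and f: "primitive L f f1" "primitive L f1 f2" "f L = f 0"
  shows "(\<integral>x. ddensity p lam (u x) (a x) (f1 x *\<^sub>R u x + f x *\<^sub>R a x)
            (f2 x *\<^sub>R u x + (2 * f1 x) *\<^sub>R a x + f x *\<^sub>R c x) \<partial>lebesgue_on {0..L}) = 0"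
proof -
  have H: "primitive L (\<lambda>x. (\<lambda>z. density p lam (fst z) (snd z)) (u x, a x))
      (\<lambda>x. (\<lambda>z h. ddensity p lam (fst z) (snd z) (fst h) (snd h)) (u x, a x) (a x, c x))"
  proof (rule primitive_chain[OF primitive_Pair[OF u(1,2)], where S = "{z. fst z \<noteq> 0}"])
    show "open {z::'a \<times> 'a. fst z \<noteq> 0}"
      by (intro open_Collect_neq continuous_intros)
    show "((\<lambda>z. density p lam (fst z) (snd z)) has_derivative
         (\<lambda>h. ddensity p lam (fst y) (snd y) (fst h) (snd h))) (at y)"
      if "y \<in> {z. fst z \<noteq> 0}" for y :: "'a \<times> 'a"
      using density_has_derivative[OF p, of y] that by simp
    show "continuous_on {z::'a \<times> 'a. fst z \<noteq> 0} (\<lambda>y. ddensity p lam (fst y) (snd y) (fst v) (snd v))" for v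
      by (rule continuous_ddensity[OF p]) (auto intro!: continuous_intros)
  qed (use u(5) in auto)
  have fH: "primitive L (\<lambda>x. f x * density p lam (u x) (a x))
      (\<lambda>x. f x * ddensity p lam (u x) (a x) (a x) (c x) + f1 x * density p lam (u x) (a x))"
    using primitive_bilinear[OF bounded_bilinear_mult f(1) H] by simp
  have "ddensity p lam (u x) (a x) (f1 x *\<^sub>R u x + f x *\<^sub>R a x)
            (f2 x *\<^sub>R u x + (2 * f1 x) *\<^sub>R a x + f x *\<^sub>R c x)
       = f x * ddensity p lam (u x) (a x) (a x) (c x) + f1 x * density p lam (u x) (a x)"
    if "x \<in> {0..L}" for x
    using ddensity_add[of p lam "u x" "a x" "f1 x *\<^sub>R u x" "f x *\<^sub>R a x"
        "(2 * f1 x) *\<^sub>R a x + f2 x *\<^sub>R u x" "f x *\<^sub>R c x"]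
      ddensity_reparametrisation[OF p u(5)[OF that], of lam "a x" "f1 x" "f2 x"]
      ddensity_scale[of p lam "u x" "a x" "f x" "a x" "c x"]
    by (simp add: add.commute add.left_commute)
  then have "(\<integral>x. ddensity p lam (u x) (a x) (f1 x *\<^sub>R u x + f x *\<^sub>R a x)
            (f2 x *\<^sub>R u x + (2 * f1 x) *\<^sub>R a x + f x *\<^sub>R c x) \<partial>lebesgue_on {0..L})
     = (\<integral>x. f x * ddensity p lam (u x) (a x) (a x) (c x) + f1 x * density p lam (u x) (a x) \<partial>lebesgue_on {0..L})"
    by (intro Bochner_Integration.integral_cong) auto
  also have "\<dots> = 0" using primitive_total[OF fH L] u(3,4) f(3) by simp
  finally show ?thesis .
qed

section \<open>First variation of the energy\<close>

text \<open>
  Only values on \<open>[0, L]\<close> matter for integrals, so the derivatives \<open>u\<close> and \<open>a\<close> are given on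
  that interval, with matching end values of \<open>u\<close>.
\<close>
definition C2_on :: "real \<Rightarrow> (real \<Rightarrow> 'a::euclidean_space) \<Rightarrow> (real \<Rightarrow> 'a) \<Rightarrow> (real \<Rightarrow> 'a) \<Rightarrow> bool" where
  "C2_on L \<gamma> u a \<longleftrightarrow> periodic_fun_simple \<gamma> L \<and>
     (\<forall>x. 0 < x \<longrightarrow> x < L \<longrightarrow> (\<gamma> has_vector_derivative u x) (at x)) \<and>
     (\<forall>x\<in>{0..L}. (u has_vector_derivative a x) (at x within {0..L})) \<and>
     continuous_on {0..L} a \<and> u L = u 0"

lemma C2_on_continuous:
  assumes "C2_on L \<gamma> u a"
  shows "continuous_on {0..L} u" "continuous_on {0..L} a" "primitive L u a"
proof -
  have u: "\<And>x. x \<in> {0..L} \<Longrightarrow> (u has_vector_derivative a x) (at x within {0..L})"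
    and a: "continuous_on {0..L} a" using assms by (auto simp: C2_on_def)
  show "primitive L u a" by (rule primitive_C1[OF u a])
  then show "continuous_on {0..L} u" by (rule primitive_continuous)
  show "continuous_on {0..L} a" by (rule a)
qed

lemma C2_on_dx:
  assumes "C2_on L \<gamma> u a" "0 < x" "x < L"
  shows "dx \<gamma> x = u x"
  using assms by (simp add: C2_on_def dx_def vector_derivative_at)

lemma C2_on_perturb:
  assumes "C2_on L \<gamma> u a" "C2_on L X v b"
  shows "C2_on L (\<lambda>x. \<gamma> x + e *\<^sub>R X x) (\<lambda>x. u x + e *\<^sub>R v x) (\<lambda>x. a x + e *\<^sub>R b x)"
  using assms unfolding C2_on_def periodic_fun_simple_def
  by (auto intro!: derivative_eq_intros continuous_intros)

lemma C2_on_smooth: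
  fixes X :: "real \<Rightarrow> 'a::euclidean_space"
  assumes "smooth X" "periodic_fun_simple X L"
  shows "C2_on L X (dx X) (dx (dx X))"
  unfolding C2_on_def
  using assms smooth_has_vector_derivative[OF assms(1)]
    smooth_has_vector_derivative[OF smooth_has_vector_derivative(2)[OF assms(1)]]
    periodic_ends[OF dx_periodic[OF assms(2)]] smooth_continuous
  by (auto intro: has_vector_derivative_at_within)

lemma normalise_primitive:
  fixes u a :: "real \<Rightarrow> 'a::euclidean_space"
  assumes u: "primitive L u a" and nz: "\<And>x. x \<in> {0..L} \<Longrightarrow> u x \<noteq> 0"
  shows "primitive L (\<lambda>x. (u x \<bullet> u x) powr (- 1 / 2) *\<^sub>R u x)
     (\<lambda>x. (u x \<bullet> u x) powr (- 1 / 2) *\<^sub>R a x - ((u x \<bullet> u x) powr (- 1 / 2 - 1) * (u x \<bullet> a x)) *\<^sub>R u x)"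
proof (rule primitive_chain[OF u, where S = "{y. y \<noteq> 0}" and \<Phi> = "\<lambda>y. (y \<bullet> y) powr (- 1 / 2) *\<^sub>R y"
      and \<Phi>' = "\<lambda>y v. (y \<bullet> y) powr (- 1 / 2) *\<^sub>R v - ((y \<bullet> y) powr (- 1 / 2 - 1) * (y \<bullet> v)) *\<^sub>R y"])
  show "open {y::'a. y \<noteq> 0}" by (intro open_Collect_neq continuous_intros)
  fix y :: 'a assume "y \<in> {y. y \<noteq> 0}"
  then have pos: "y \<bullet> y > 0" by simp
  have n: "((\<lambda>y. y \<bullet> y) has_derivative (\<lambda>h. 2 * (y \<bullet> h))) (at y)"
    by (auto intro!: derivative_eq_intros simp: inner_commute)
  note d = has_derivative_powr_pos[OF n pos, of "- 1 / 2"]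
  show "((\<lambda>y. (y \<bullet> y) powr (- 1 / 2) *\<^sub>R y) has_derivative
      (\<lambda>v. (y \<bullet> y) powr (- 1 / 2) *\<^sub>R v - ((y \<bullet> y) powr (- 1 / 2 - 1) * (y \<bullet> v)) *\<^sub>R y)) (at y)"
    by (rule has_derivative_eq_rhs[OF has_derivative_scaleR[OF d has_derivative_ident]])
       (simp add: fun_eq_iff)
next
  fix v :: 'a
  have n: "continuous_on {y. y \<noteq> 0} (\<lambda>y::'a. (y \<bullet> y) powr q)" for q
    by (rule continuous_speed_powr) (auto intro: continuous_intros)
  show "continuous_on {y. y \<noteq> 0}
      (\<lambda>y. (y \<bullet> y) powr (- 1 / 2) *\<^sub>R v - ((y \<bullet> y) powr (- 1 / 2 - 1) * (y \<bullet> v)) *\<^sub>R y)"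
    by (rule continuous_on_diff continuous_on_scaleR continuous_on_mult n continuous_on_inner
        continuous_on_const continuous_on_id)+
qed (use nz in auto)

text \<open>
  The vector inside the norm is \<open>(\<gamma>' / |\<gamma>'|)' / |\<gamma>'|\<close>, the curvature, in terms of \<open>u = \<gamma>'\<close> and
  \<open>a = \<gamma>''\<close>.
\<close>
lemma curvature_density:
  fixes u a :: "'a::euclidean_space"
  assumes u: "u \<noteq> 0"
  shows "norm (((u \<bullet> u) powr (- 1 / 2) *\<^sub>R a - ((u \<bullet> u) powr (- 1 / 2 - 1) * (u \<bullet> a)) *\<^sub>R u) /\<^sub>R norm u) powr p * norm u
     = gram u a powr (p / 2) * (u \<bullet> u) powr ((1 - 3 * p) / 2)"
proof -
  define N where "N = u \<bullet> u"
  have N: "N > 0" using u by (simp add: N_def)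
  define k where "k = N powr (- 1 / 2) *\<^sub>R a - (N powr (- 1 / 2 - 1) * (u \<bullet> a)) *\<^sub>R u"
  have nu: "norm u = N powr (1 / 2)" using N by (simp add: N_def norm_eq_sqrt_inner powr_half_sqrt)
  have m: "N powr (- 1 / 2) * N powr (- 1 / 2) = N powr (-1)"
    "N powr (- 1 / 2) * N powr (- 1 / 2 - 1) = N powr (-2)"
    "N powr (- 1 / 2 - 1) * N powr (- 1 / 2 - 1) * N = N powr (-2)"
    "N powr (-1) = N powr (-2) * N"
    using N by (simp_all add: powr_add[symmetric] powr_mult_base mult.commute)
  have "(s *\<^sub>R a - (t * (u \<bullet> a)) *\<^sub>R u) \<bullet> (s *\<^sub>R a - (t * (u \<bullet> a)) *\<^sub>R u)
      = (s * s) * (a \<bullet> a) - 2 * (s * t) * (u \<bullet> a)\<^sup>2 + (t * t * N) * (u \<bullet> a)\<^sup>2" for s t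
    by (simp add: N_def inner_diff_left inner_diff_right inner_commute[of a u] power2_eq_square algebra_simps)
  then have "k \<bullet> k = (N powr (- 1 / 2) * N powr (- 1 / 2)) * (a \<bullet> a)
      - 2 * (N powr (- 1 / 2) * N powr (- 1 / 2 - 1)) * (u \<bullet> a)\<^sup>2
      + (N powr (- 1 / 2 - 1) * N powr (- 1 / 2 - 1) * N) * (u \<bullet> a)\<^sup>2"
    unfolding k_def .
  also have "\<dots> = (N powr (-2) * N) * (a \<bullet> a) - 2 * N powr (-2) * (u \<bullet> a)\<^sup>2 + N powr (-2) * (u \<bullet> a)\<^sup>2"
    by (simp only: m)
  also have "\<dots> = gram u a * N powr (-2)"
    unfolding gram_def N_def[symmetric] inner_commute[of a u] by (simp add: algebra_simps)
  finally have kk: "k \<bullet> k = gram u a * N powr (-2)" .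
  have "norm k = (k \<bullet> k) powr (1 / 2)" by (simp add: norm_eq_sqrt_inner powr_half_sqrt)
  then have nk: "norm k = gram u a powr (1 / 2) * N powr (-1)"
    using gram_nonneg[of u a] by (simp add: kk powr_mult powr_powr)
  have "norm (k /\<^sub>R norm u) = norm k / norm u" by (simp add: divide_inverse_commute)
  also have "\<dots> = gram u a powr (1 / 2) * (N powr (-1) / N powr (1 / 2))"
    unfolding nk nu by (simp only: times_divide_eq_right)
  also have "N powr (-1) / N powr (1 / 2) = N powr (- 3 / 2)"
    unfolding powr_diff[symmetric] by simp
  finally have nkn: "norm (k /\<^sub>R norm u) = gram u a powr (1 / 2) * N powr (- 3 / 2)" .
  have "norm (k /\<^sub>R norm u) powr p = gram u a powr (1 / 2 * p) * N powr (- 3 / 2 * p)"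
    unfolding nkn using gram_nonneg[of u a] by (simp only: powr_mult powr_ge_zero powr_powr)
  then have "norm (k /\<^sub>R norm u) powr p * norm u = gram u a powr (1 / 2 * p) * N powr (- 3 / 2 * p) * norm u"
    by (simp only:)
  also have "\<dots> = gram u a powr (1 / 2 * p) * N powr (- 3 / 2 * p) * N powr (1 / 2)" by (simp only: nu)
  also have "\<dots> = gram u a powr (p / 2) * (N powr (- 3 / 2 * p) * N powr (1 / 2))" by simp
  also have "N powr (- 3 / 2 * p) * N powr (1 / 2) = N powr ((1 - 3 * p) / 2)"
    unfolding powr_add[symmetric] by (rule arg_cong[where f = "\<lambda>q. N powr q"]) (simp add: field_simps)
  finally show ?thesis unfolding k_def N_def .
qed

lemma energy_C2:
  fixes \<gamma> u a :: "real \<Rightarrow> 'a::euclidean_space"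
  assumes p: "p > 2" and L: "L > 0" and c: "C2_on L \<gamma> u a" and nz: "\<And>x. x \<in> {0..L} \<Longrightarrow> u x \<noteq> 0"
  shows "energy L p lam \<gamma> = integral {0..L} (\<lambda>x. density p lam (u x) (a x))"
proof -
  let ?M = "lebesgue_on {0..L}"
  define k where "k x = (u x \<bullet> u x) powr (- 1 / 2) *\<^sub>R a x - ((u x \<bullet> u x) powr (- 1 / 2 - 1) * (u x \<bullet> a x)) *\<^sub>R u x" for x
  have k: "primitive L (\<lambda>x. (u x \<bullet> u x) powr (- 1 / 2) *\<^sub>R u x) k"
    unfolding k_def by (rule normalise_primitive[OF C2_on_continuous(3)[OF c] nz])
  have ut: "unit_tangent \<gamma> x = (u x \<bullet> u x) powr (- 1 / 2) *\<^sub>R u x" if "0 < x" "x < L" for x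
  proof -
    have "inverse (norm (u x)) = (u x \<bullet> u x) powr (- 1 / 2)"
      using nz[of x] that by (simp add: norm_eq_sqrt_inner powr_minus powr_half_sqrt)
    then show ?thesis using C2_on_dx[OF c that] by (simp add: unit_tangent_def)
  qed
  have p1: "periodic_fun_simple (dx \<gamma>) L" using c by (auto simp: C2_on_def intro: dx_periodic)
  then have per: "periodic_fun_simple (unit_tangent \<gamma>) L"
    by (simp add: periodic_fun_simple_def unit_tangent_def)
  have ae: "AE x in ?M. unit_tangent \<gamma> x = (u x \<bullet> u x) powr (- 1 / 2) *\<^sub>R u x"
    by (rule AE_interior[OF ut])
  have ends: "(u L \<bullet> u L) powr (- 1 / 2) *\<^sub>R u L = (u 0 \<bullet> u 0) powr (- 1 / 2) *\<^sub>R u 0"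
    using c by (simp add: C2_on_def)
  obtain g' where g': "weak_deriv L (unit_tangent \<gamma>) g'" "AE x in ?M. g' x = k x"
    using weak_deriv_of_primitive[OF L per ae k ends] by blast
  have w: "AE x in ?M. wderiv L (unit_tangent \<gamma>) x = k x"
    using wderiv_weak_deriv(2)[OF L g'(1)] g'(2) by eventually_elim simp
  have dxu: "AE x in ?M. x \<in> {0..L} \<and> dx \<gamma> x = u x"
    by (rule AE_interior) (use C2_on_dx[OF c] in auto)
  let ?K = "\<lambda>x. gram (u x) (a x) powr (p / 2) * (u x \<bullet> u x) powr ((1 - 3 * p) / 2)"
  let ?S = "\<lambda>x. (u x \<bullet> u x) powr (1 / 2)"
  have q: "p / 2 > 0" using p by simp
  have cK: "continuous_on {0..L} ?K"
    by (rule continuous_on_mult continuous_gram_powr continuous_speed_powr C2_on_continuous[OF c] q nz | assumption)+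
  have cS: "continuous_on {0..L} ?S"
    by (rule continuous_speed_powr[OF C2_on_continuous(1)[OF c] nz])
  have e1: "(\<integral>x. norm (curvature L \<gamma> x) powr p * norm (dx \<gamma> x) \<partial>?M) = (\<integral>x. ?K x \<partial>?M)"
  proof (rule integral_lebesgue_on_cong_AE)
    show "AE x in ?M. norm (curvature L \<gamma> x) powr p * norm (dx \<gamma> x) = ?K x"
      using w dxu
    proof eventually_elim
      case (elim x)
      then show ?case using curvature_density[OF nz, of x "a x" p] by (simp add: curvature_def k_def)
    qed
  qed simp
  have e2: "(\<integral>x. norm (dx \<gamma> x) \<partial>?M) = (\<integral>x. ?S x \<partial>?M)"
  proof (rule integral_lebesgue_on_cong_AE)
    show "AE x in ?M. norm (dx \<gamma> x) = ?S x"
      using dxu by eventually_elim (simp add: norm_eq_sqrt_inner powr_half_sqrt)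
  qed simp
  have "energy L p lam \<gamma> = 1 / p * integral {0..L} ?K + lam * integral {0..L} ?S"
    unfolding energy_def e1 e2
    by (simp add: integral_lebesgue_on_eq_HK[OF integrable_lebesgue_on_continuous[OF cK]]
        integral_lebesgue_on_eq_HK[OF integrable_lebesgue_on_continuous[OF cS]])
  also have "\<dots> = integral {0..L} (\<lambda>x. 1 / p * ?K x) + integral {0..L} (\<lambda>x. lam * ?S x)"
    by (simp only: integral_mult_right)
  also have "\<dots> = integral {0..L} (\<lambda>x. 1 / p * ?K x + lam * ?S x)"
    by (intro Henstock_Kurzweil_Integration.integral_add[symmetric] integrable_continuous_real
        continuous_on_mult continuous_on_const cK cS)
  finally show ?thesis by (simp add: density_def mult.assoc)
qed

text \<open>
  Since \<open>u, a, v, b\<close> are continuous on a compact interval and \<open>u\<close> does not vanish, the curves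
  \<open>\<gamma> + e X\<close> are regular for small \<open>e\<close>, and differentiation under the integral sign is
  classical.
\<close>
lemma first_variation_C2:
  fixes \<gamma> u a X v b :: "real \<Rightarrow> 'a::euclidean_space"
  assumes p: "p > 2" and L: "L > 0" and c: "C2_on L \<gamma> u a" and nz: "\<And>x. x \<in> {0..L} \<Longrightarrow> u x \<noteq> 0"
    and X: "C2_on L X v b"
  shows "first_variation L p lam X \<gamma> = (\<integral>x. ddensity p lam (u x) (a x) (v x) (b x) \<partial>lebesgue_on {0..L})"
proof -
  note cc = C2_on_continuous(1,2)[OF c] C2_on_continuous(1,2)[OF X]
  obtain r where r: "r > 0" "\<And>x. x \<in> {0..L} \<Longrightarrow> r \<le> norm (u x)"
  proof -
    have "{0..L} \<noteq> {}" using L by simp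
    then obtain x0 where x0: "x0 \<in> {0..L}" "\<And>x. x \<in> {0..L} \<Longrightarrow> norm (u x0) \<le> norm (u x)"
      using continuous_attains_inf[OF compact_Icc _ continuous_on_norm[OF cc(1)]] by blast
    show ?thesis by (rule that[of "norm (u x0)"]) (use nz x0 in auto)
  qed
  obtain B where B: "\<And>x. x \<in> {0..L} \<Longrightarrow> norm (v x) \<le> B"
    using compact_imp_bounded[OF compact_continuous_image[OF cc(3) compact_Icc]]
    unfolding bounded_iff by blast
  have B0: "B \<ge> 0" using B[of 0] L by (meson atLeastAtMost_iff less_imp_le norm_ge_zero order_refl order_trans)
  \<comment> \<open>For \<open>|e| < d\<close> the perturbation \<open>e v\<close> is shorter than \<open>|u|\<close>.\<close>
  define d where "d = r / (B + 1)"
  have d: "d > 0" using r B0 by (simp add: d_def)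
  have nz': "u x + e *\<^sub>R v x \<noteq> 0" if "x \<in> {0..L}" "\<bar>e\<bar> < d" for x e
  proof
    assume "u x + e *\<^sub>R v x = 0"
    then have "norm (u x) = norm (e *\<^sub>R v x)" by (simp add: eq_neg_iff_add_eq_0[symmetric])
    also have "\<dots> \<le> \<bar>e\<bar> * (B + 1)" using B[OF that(1)] by (simp add: mult_left_mono)
    also have "\<dots> < d * (B + 1)" using that(2) B0 by (intro mult_strict_right_mono) auto
    also have "\<dots> = r" using B0 by (simp add: d_def)
    finally show False using r(2)[OF that(1)] by simp
  qed
  define E where "E e = integral (cbox 0 L) (\<lambda>x. density p lam (u x + e *\<^sub>R v x) (a x + e *\<^sub>R b x))" for e
  let ?D = "\<lambda>e x. ddensity p lam (u x + e *\<^sub>R v x) (a x + e *\<^sub>R b x) (v x) (b x)"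
  have "(E has_field_derivative integral (cbox 0 L) (?D 0)) (at 0 within {-d<..<d})"
    unfolding E_def
  proof (rule leibniz_rule_field_derivative)
    fix e x assume e: "e \<in> {-d<..<d}" and x: "x \<in> cbox 0 L"
    let ?z = "(u x + e *\<^sub>R v x, a x + e *\<^sub>R b x)"
    have e': "\<bar>e\<bar> < d" using e by auto
    have "((\<lambda>e. (u x + e *\<^sub>R v x, a x + e *\<^sub>R b x)) has_derivative (\<lambda>h. (h *\<^sub>R v x, h *\<^sub>R b x))) (at e)"
      by (auto intro!: derivative_eq_intros)
    moreover have "((\<lambda>z. density p lam (fst z) (snd z)) has_derivative
       (\<lambda>h. ddensity p lam (fst ?z) (snd ?z) (fst h) (snd h))) (at ?z)"
      by (rule density_has_derivative[OF p]) (use nz'[of x e] e' x in auto)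
    ultimately have "((\<lambda>z. density p lam (fst z) (snd z)) \<circ> (\<lambda>e. (u x + e *\<^sub>R v x, a x + e *\<^sub>R b x))
        has_derivative (\<lambda>h. ddensity p lam (fst ?z) (snd ?z) (fst h) (snd h)) \<circ> (\<lambda>h. (h *\<^sub>R v x, h *\<^sub>R b x))) (at e)"
      by (rule diff_chain_at)
    then have "((\<lambda>e. density p lam (u x + e *\<^sub>R v x) (a x + e *\<^sub>R b x)) has_derivative (\<lambda>h. h * ?D e x)) (at e)"
      by (simp add: o_def ddensity_scale)
    then have "((\<lambda>e. density p lam (u x + e *\<^sub>R v x) (a x + e *\<^sub>R b x)) has_field_derivative ?D e x) (at e)"
      by (simp add: has_field_derivative_def mult.commute[of _ "?D e x"])
    then show "((\<lambda>e. density p lam (u x + e *\<^sub>R v x) (a x + e *\<^sub>R b x)) has_field_derivative ?D e x) (at e within {-d<..<d})"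
      by (rule has_field_derivative_at_within)
  next
    fix e assume e: "e \<in> {-d<..<d}"
    have "continuous_on (cbox 0 L) (\<lambda>x. density p lam (u x + e *\<^sub>R v x) (a x + e *\<^sub>R b x))"
      by (rule continuous_density[OF p]) (use nz' e cc in \<open>auto intro!: continuous_intros\<close>)
    then show "(\<lambda>x. density p lam (u x + e *\<^sub>R v x) (a x + e *\<^sub>R b x)) integrable_on cbox 0 L"
      by (rule integrable_continuous)
  next
    have s: "continuous_on ({-d<..<d} \<times> {0..L}) (\<lambda>y. f (snd y))" if "continuous_on {0..L} f" for f :: "real \<Rightarrow> 'a"
      by (rule continuous_on_compose2[OF that continuous_on_snd[OF continuous_on_id]]) auto
    have "continuous_on ({-d<..<d} \<times> {0..L}) (\<lambda>y. ?D (fst y) (snd y))"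
      by (rule continuous_ddensity[OF p])
         (use nz' in \<open>auto intro!: continuous_intros s cc\<close>)
    then show "continuous_on ({-d<..<d} \<times> cbox 0 L) (\<lambda>(e, x). ?D e x)"
      by (simp add: case_prod_beta')
  qed (use d in auto)
  then have dE: "(E has_field_derivative integral {0..L} (?D 0)) (at 0)"
    using d by (simp add: at_within_open[of 0 "{-d<..<d}"])
  have "((\<lambda>e. energy L p lam (\<lambda>x. \<gamma> x + e *\<^sub>R X x)) has_field_derivative integral {0..L} (?D 0)) (at 0)"
  proof (rule has_field_derivative_transform_within_open[OF dE, of "{-d<..<d}"])
    fix e assume "e \<in> {-d<..<d}"
    then have "\<bar>e\<bar> < d" by auto
    then show "E e = energy L p lam (\<lambda>x. \<gamma> x + e *\<^sub>R X x)"
      using energy_C2[OF p L C2_on_perturb[OF c X] nz'] by (simp add: E_def)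
  qed (use d in auto)
  then have "first_variation L p lam X \<gamma> = integral {0..L} (?D 0)"
    unfolding first_variation_def by (rule DERIV_imp_deriv)
  also have "\<dots> = (\<integral>x. ddensity p lam (u x) (a x) (v x) (b x) \<partial>lebesgue_on {0..L})"
    by (subst integral_lebesgue_on_eq_HK[OF integrable_lebesgue_on_continuous])
       (auto intro!: continuous_ddensity[OF p] cc nz)
  finally show ?thesis .
qed

section \<open>Curves of class \<open>W\<^bsup>2,p\<^esup>\<close> and \<open>W\<^bsup>3,p\<^esup>\<close>\<close>

lemma primitive_has_vector_derivative:
  fixes f g :: "real \<Rightarrow> 'a::euclidean_space"
  assumes f: "primitive L f g" and c: "continuous_on {0..L} g" and x: "x \<in> {0..L}"
  shows "(f has_vector_derivative g x) (at x within {0..L})"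
proof -
  have "((\<lambda>x. f 0 + integral {0..x} g) has_vector_derivative g x) (at x within {0..L})"
    using integral_has_vector_derivative[OF c x] by (auto intro!: derivative_eq_intros)
  moreover have "f y = f 0 + integral {0..y} g" if "y \<in> {0..L}" for y
  proof -
    have "f y - f 0 = integral {0..y} g" using f that unfolding primitive_def by blast
    then show ?thesis by (metis add.commute diff_add_cancel)
  qed
  ultimately show ?thesis by (intro has_vector_derivative_transform[OF x, of f "\<lambda>x. f 0 + integral {0..x} g"])
qed

lemma primitive_has_vector_derivative_interior:
  fixes f g :: "real \<Rightarrow> 'a::euclidean_space"
  assumes f: "primitive L f g" and c: "continuous_on {0..L} g" and x: "0 < x" "x < L"
  shows "(f has_vector_derivative g x) (at x)"
proof -
  have "x \<in> {0..L}" using x by simp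
  from primitive_has_vector_derivative[OF f c this] show ?thesis
    by (simp only: at_within_Icc_at[OF x])
qed

text \<open>
  The first weak derivative has an absolutely continuous representative \<open>u\<close>, and the iterated
  \<^const>\<open>wderiv\<close>, which is an arbitrary representative, agrees with \<open>u\<close> and \<open>a\<close> almost everywhere.
\<close>
lemma W2_structure:
  fixes w :: "real \<Rightarrow> 'a::euclidean_space"
  assumes L: "L > 0" and w: "w \<in> Wc L 2 p"
  obtains u a where "primitive L w u" "primitive L u a" "u L = u 0" "a \<in> Lp L p"
    "AE x in lebesgue_on {0..L}. wderiv L w x = u x"
    "AE x in lebesgue_on {0..L}. wderiv L (wderiv L w) x = a x"
    "weak_deriv L w (wderiv L w)" "weak_deriv L (wderiv L w) (wderiv L (wderiv L w))"
proof -
  let ?M = "lebesgue_on {0..L}"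
  obtain g1 g2 where wc: "continuous_on UNIV w" and g1: "weak_deriv L w g1" and g2: "weak_deriv L g1 g2" "g2 \<in> Lp L p"
    using w by (auto simp: Wc_def numeral_2_eq_2)
  obtain u where u: "primitive L u g2" "u L = u 0" "AE x in ?M. g1 x = u x"
    using weak_deriv_primitive[OF L g2(1)] by blast
  have "primitive L w g1"
    by (rule weak_deriv_continuous_primitive[OF L g1]) (use wc continuous_on_subset in blast)
  then have wu: "primitive L w u" by (rule primitive_cong_AE[OF _ u(3)])
  note d1 = wderiv_weak_deriv[OF L g1]
  have ae1: "AE x in ?M. g1 x = wderiv L w x" using d1(2) by eventually_elim simp
  have p1: "periodic_fun_simple (wderiv L w) L" using d1(1) by (simp add: weak_deriv_def)
  have "weak_deriv L (wderiv L w) g2" by (rule weak_deriv_cong_AE[OF g2(1) p1 ae1])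
  note d2 = wderiv_weak_deriv[OF L this]
  show ?thesis
  proof (rule that[OF wu u(1,2) g2(2) _ d2(2) d1(1) d2(1)])
    show "AE x in ?M. wderiv L w x = u x" using d1(2) u(3) by eventually_elim simp
  qed
qed

text \<open>
  A curve with three weak derivatives is of class \<open>C\<^sup>2\<close> with absolutely continuous second
  derivative.
\<close>
lemma W3_structure:
  fixes \<gamma> :: "real \<Rightarrow> 'a::euclidean_space"
  assumes L: "L > 0" and w: "\<gamma> \<in> Wc L 3 p"
  obtains u a c where "C2_on L \<gamma> u a" "primitive L \<gamma> u" "primitive L a c" "a L = a 0"
proof -
  let ?M = "lebesgue_on {0..L}"
  obtain g1 g2 g3 where wc: "continuous_on UNIV \<gamma>" and g: "weak_deriv L \<gamma> g1" "weak_deriv L g1 g2" "weak_deriv L g2 g3"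
    using w by (auto simp: Wc_def numeral_3_eq_3)
  obtain a where a: "primitive L a g3" "a L = a 0" "AE x in ?M. g2 x = a x"
    using weak_deriv_primitive[OF L g(3)] by blast
  obtain u where u: "primitive L u g2" "u L = u 0" "AE x in ?M. g1 x = u x"
    using weak_deriv_primitive[OF L g(2)] by blast
  have ua: "primitive L u a" by (rule primitive_cong_AE[OF u(1) a(3)])
  have "primitive L \<gamma> g1"
    by (rule weak_deriv_continuous_primitive[OF L g(1)]) (use wc continuous_on_subset in blast)
  then have gu: "primitive L \<gamma> u" by (rule primitive_cong_AE[OF _ u(3)])
  have "C2_on L \<gamma> u a"
    unfolding C2_on_def
    using g(1) primitive_has_vector_derivative_interior[OF gu primitive_continuous[OF ua]]
      primitive_has_vector_derivative[OF ua primitive_continuous[OF a(1)]]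
      primitive_continuous[OF a(1)] u(2)
    by (auto simp: weak_deriv_def)
  then show ?thesis using that gu a by blast
qed

text \<open>
  The function differs from its mean by at most its oscillation, which is bounded by the
  integral of the norm of its derivative. This is the embedding of \<open>W\<^bsup>1,1\<^esup>\<close> into the bounded
  functions.
\<close>
lemma primitive_sup_bound:
  fixes u a :: "real \<Rightarrow> 'a::euclidean_space"
  assumes u: "primitive L u a" and L: "L > 0" and x: "x \<in> {0..L}"
  shows "L * norm (u x) \<le> (\<integral>y. norm (u y) \<partial>lebesgue_on {0..L}) + 2 * L * (\<integral>y. norm (a y) \<partial>lebesgue_on {0..L})"
proof -
  let ?M = "lebesgue_on {0..L}" and ?A = "\<integral>y. norm (a y) \<partial>lebesgue_on {0..L}"
  have a: "integrable ?M a" by (rule primitive_integrable[OF u])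
  have osc: "norm (u y - u 0) \<le> ?A" if y: "y \<in> {0..L}" for y
  proof -
    have na: "integrable ?M (\<lambda>y. norm (a y))" using a by auto
    have "norm (u y - u 0) = norm (integral {0..y} a)" using u y by (simp add: primitive_def)
    also have "\<dots> \<le> integral {0..y} (\<lambda>s. norm (a s))"
      by (intro integral_norm_bound_integral integrable_on_subinterval_0[OF _ y] a na) auto
    also have "\<dots> \<le> integral {0..L} (\<lambda>s. norm (a s))"
      using y L by (intro integral_subset_le integrable_on_subinterval_0[OF na]) auto
    also have "\<dots> = ?A" by (rule integral_lebesgue_on_eq_HK[OF na, symmetric])
    finally show ?thesis .
  qed
  have "(\<integral>y. norm (u x) \<partial>?M) \<le> (\<integral>y. norm (u y) + 2 * ?A \<partial>?M)"
  proof (rule integral_mono)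
    show "integrable ?M (\<lambda>y. norm (u x))" by (rule integrable_const_Icc)
    show "integrable ?M (\<lambda>y. norm (u y) + 2 * ?A)"
      by (intro integrable_lebesgue_on_continuous continuous_intros primitive_continuous[OF u])
    fix y assume "y \<in> space ?M"
    then have y: "y \<in> {0..L}" by simp
    have "u x = u y + ((u x - u 0) - (u y - u 0))" by simp
    then have "norm (u x) \<le> norm (u y) + norm ((u x - u 0) - (u y - u 0))"
      by (metis norm_triangle_ineq)
    also have "\<dots> \<le> norm (u y) + (?A + ?A)"
      using norm_triangle_ineq4[of "u x - u 0" "u y - u 0"] osc[OF x] osc[OF y] by simp
    finally show "norm (u x) \<le> norm (u y) + 2 * ?A" by simp
  qed
  moreover have "(\<integral>y. norm (u y) + 2 * ?A \<partial>?M) = (\<integral>y. norm (u y) \<partial>?M) + L *\<^sub>R (2 * ?A)"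
    unfolding integral_const_Icc[OF less_imp_le[OF L], symmetric]
    by (rule Bochner_Integration.integral_add[OF integrable_lebesgue_on_continuous[OF
          continuous_on_norm[OF primitive_continuous[OF u]]] integrable_const_Icc])
  moreover have "(\<integral>y. norm (u x) \<partial>?M) = L *\<^sub>R norm (u x)"
    by (rule integral_const_Icc[OF less_imp_le[OF L]])
  ultimately have "L * norm (u x) \<le> (\<integral>y. norm (u y) \<partial>?M) + L * (2 * ?A)"
    by (simp only: real_scaleR_def)
  then show ?thesis by (simp only: mult.assoc mult.left_commute[of 2 L])
qed

section \<open>Estimates in \<open>L\<^sup>p\<close> and \<open>W\<^bsup>2,p\<^esup>\<close>\<close>

lemma LpD:
  assumes "f \<in> Lp L p"
  shows "periodic_fun_simple f L" "f \<in> borel_measurable (lebesgue_on {0..L})"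
    "integrable (lebesgue_on {0..L}) (\<lambda>x. norm (f x) powr p)"
  using assms by (auto simp: Lp_def)

lemma Lp_norm_nonneg: "0 \<le> Lp_norm L p f"
  by (simp add: Lp_norm_def)

lemma Lp_norm_powr:
  assumes "p > 0"
  shows "Lp_norm L p f powr p = (\<integral>x. norm (f x) powr p \<partial>lebesgue_on {0..L})"
  using assms by (simp add: Lp_norm_def powr_powr)

text \<open>
  A substitute for the Hoelder inequality: weighing \<open>t \<le> \<delta>\<close> against \<open>t > \<delta>\<close> bounds an
  \<open>L\<^sup>1\<close>-norm by an \<open>L\<^sup>p\<close>-norm.
\<close>
lemma le_delta_powr:
  fixes t d p :: real
  assumes "t \<ge> 0" "d > 0" "p \<ge> 1"
  shows "t \<le> d + d powr (1 - p) * t powr p"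
proof (cases "t \<le> d")
  case True
  then show ?thesis by (simp add: add_increasing2)
next
  case False
  then have t: "t > 0" "d \<le> t" using assms by auto
  have "t powr (1 - p) \<le> d powr (1 - p)"
    using powr_mono2'[of "1 - p" d t] assms t by simp
  then have "t powr (1 - p) * t powr p \<le> d powr (1 - p) * t powr p" by (intro mult_right_mono) auto
  moreover have "t powr (1 - p) * t powr p = t" using t by (simp add: powr_add[symmetric])
  ultimately show ?thesis using assms by linarith
qed

lemma L1_of_Lp:
  fixes f :: "real \<Rightarrow> 'a::euclidean_space"
  assumes m: "f \<in> borel_measurable (lebesgue_on {0..L})"
    and i: "integrable (lebesgue_on {0..L}) (\<lambda>x. norm (f x) powr p)" and p: "p \<ge> 1"
  shows "integrable (lebesgue_on {0..L}) f"
proof (rule Bochner_Integration.integrable_bound[OF _ m])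
  show "integrable (lebesgue_on {0..L}) (\<lambda>x. 1 + norm (f x) powr p)"
    using i integrable_const_Icc by auto
  show "AE x in lebesgue_on {0..L}. norm (f x) \<le> norm (1 + norm (f x) powr p)"
    using le_delta_powr[of "norm (f _)" 1 p] p by (auto intro!: AE_I2)
qed

text \<open>
  Take \<open>\<delta>\<close> equal to the \<open>L\<^sup>p\<close>-norm in the pointwise bound, or \<open>\<delta> \<rightarrow> 0\<close> if that norm vanishes.
\<close>
lemma L1_le_Lp_norm:
  fixes f :: "real \<Rightarrow> 'a::euclidean_space"
  assumes L: "L > 0" and m: "f \<in> borel_measurable (lebesgue_on {0..L})"
    and i: "integrable (lebesgue_on {0..L}) (\<lambda>x. norm (f x) powr p)" and p: "p \<ge> 1"
  shows "(\<integral>x. norm (f x) \<partial>lebesgue_on {0..L}) \<le> (L + 1) * Lp_norm L p f"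
proof -
  let ?M = "lebesgue_on {0..L}" and ?N = "Lp_norm L p f"
  have fi: "integrable ?M f" by (rule L1_of_Lp[OF m i p])
  have main: "(\<integral>x. norm (f x) \<partial>?M) \<le> d * L + d powr (1 - p) * ?N powr p" if d: "d > 0" for d
  proof -
    have "(\<integral>x. norm (f x) \<partial>?M) \<le> (\<integral>x. d + d powr (1 - p) * norm (f x) powr p \<partial>?M)"
      by (intro integral_mono integrable_norm fi Bochner_Integration.integrable_add integrable_const_Icc
          integrable_mult_right i le_delta_powr d p norm_ge_zero)
    also have "\<dots> = L *\<^sub>R d + d powr (1 - p) * (\<integral>x. norm (f x) powr p \<partial>?M)"
      unfolding integral_const_Icc[OF less_imp_le[OF L], symmetric] integral_mult_right_zero[symmetric]
      by (intro Bochner_Integration.integral_add integrable_const_Icc integrable_mult_right i)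
    finally show ?thesis using p by (simp add: Lp_norm_powr mult.commute)
  qed
  show ?thesis
  proof (cases "?N = 0")
    case True
    have "(\<integral>x. norm (f x) \<partial>?M) \<le> 0"
    proof (rule field_le_epsilon)
      fix e :: real assume e: "e > 0"
      show "(\<integral>x. norm (f x) \<partial>?M) \<le> 0 + e" using main[of "e / L"] e L True by simp
    qed
    then show ?thesis using True by simp
  next
    case False
    then have N: "?N > 0" using Lp_norm_nonneg[of L p f] by simp
    have "?N powr (1 - p) * ?N powr p = ?N" using N by (simp add: powr_add[symmetric])
    then show ?thesis using main[OF N] by (simp add: algebra_simps)
  qed
qed

lemma weak_deriv_diff:
  fixes f g f' g' :: "real \<Rightarrow> 'a::euclidean_space"
  assumes w: "weak_deriv L f g" "weak_deriv L f' g'"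
  shows "weak_deriv L (\<lambda>x. f x - f' x) (\<lambda>x. g x - g' x)"
proof -
  let ?M = "lebesgue_on {0..L}"
  have i: "integrable ?M f" "integrable ?M f'" "integrable ?M g" "integrable ?M g'"
    using w by (auto simp: weak_deriv_def)
  have "(\<integral>x. deriv \<zeta> x *\<^sub>R (f x - f' x) \<partial>?M) = - (\<integral>x. \<zeta> x *\<^sub>R (g x - g' x) \<partial>?M)"
    if \<zeta>: "smooth \<zeta>" "periodic_fun_simple \<zeta> L" for \<zeta> :: "real \<Rightarrow> real"
  proof -
    note c = smooth_continuous[OF \<zeta>(1), of "{0..L}"] smooth_continuous[OF smooth_real_deriv(2)[OF \<zeta>(1)], of "{0..L}"]
    have "(\<integral>x. deriv \<zeta> x *\<^sub>R f x \<partial>?M) = - (\<integral>x. \<zeta> x *\<^sub>R g x \<partial>?M)"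
      "(\<integral>x. deriv \<zeta> x *\<^sub>R f' x \<partial>?M) = - (\<integral>x. \<zeta> x *\<^sub>R g' x \<partial>?M)"
      using w \<zeta> by (auto simp: weak_deriv_def)
    then show ?thesis
      using integrable_scaleR_continuous[OF i(1) c(2)] integrable_scaleR_continuous[OF i(2) c(2)]
        integrable_scaleR_continuous[OF i(3) c(1)] integrable_scaleR_continuous[OF i(4) c(1)]
      by (simp add: scaleR_diff_right)
  qed
  then show ?thesis using w by (auto simp: weak_deriv_def periodic_fun_simple_def)
qed

lemma norm_diff_powr_le:
  fixes a b :: "'a::real_normed_vector"
  assumes "p > 0"
  shows "norm (a - b) powr p \<le> 2 powr p * (norm a powr p + norm b powr p)"
proof -
  have "norm (a - b) \<le> 2 * max (norm a) (norm b)" using norm_triangle_ineq4[of a b] by simp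
  then have "norm (a - b) powr p \<le> (2 * max (norm a) (norm b)) powr p" using assms by (intro powr_mono2) auto
  also have "\<dots> = 2 powr p * max (norm a) (norm b) powr p" by (simp add: powr_mult)
  also have "max (norm a) (norm b) powr p \<le> norm a powr p + norm b powr p" by (simp add: max_def)
  finally show ?thesis by simp
qed

lemma Lp_diff:
  fixes f g :: "real \<Rightarrow> 'a::euclidean_space"
  assumes f: "f \<in> Lp L p" and g: "g \<in> Lp L p" and p: "p > 0"
  shows "(\<lambda>x. f x - g x) \<in> Lp L p"
proof -
  let ?M = "lebesgue_on {0..L}"
  have m: "(\<lambda>x. f x - g x) \<in> borel_measurable ?M" using LpD(2)[OF f] LpD(2)[OF g] by auto
  have "integrable ?M (\<lambda>x. norm (f x - g x) powr p)"
  proof (rule Bochner_Integration.integrable_bound)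
    show "integrable ?M (\<lambda>x. 2 powr p * (norm (f x) powr p + norm (g x) powr p))"
      using LpD(3)[OF f] LpD(3)[OF g] by auto
    show "(\<lambda>x. norm (f x - g x) powr p) \<in> borel_measurable ?M" using m by auto
    show "AE x in ?M. norm (norm (f x - g x) powr p) \<le> norm (2 powr p * (norm (f x) powr p + norm (g x) powr p))"
      using norm_diff_powr_le[OF p] by (intro AE_I2) simp
  qed
  then show ?thesis using f g m by (auto simp: Lp_def periodic_fun_simple_def)
qed

lemma Lp_cong_AE:
  fixes f g :: "real \<Rightarrow> 'a::euclidean_space"
  assumes f: "f \<in> Lp L p" and ae: "AE x in lebesgue_on {0..L}. f x = g x" and g: "periodic_fun_simple g L"
  shows "g \<in> Lp L p"
proof -
  have "g \<in> borel_measurable (lebesgue_on {0..L})"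
    by (rule measurable_lebesgue_on_cong_AE[OF _ ae LpD(2)[OF f]]) simp
  moreover have "integrable (lebesgue_on {0..L}) (\<lambda>x. norm (g x) powr p)"
    by (rule integrable_lebesgue_on_cong_AE[OF _ _ LpD(3)[OF f]]) (use ae in \<open>auto elim: eventually_mono\<close>)
  ultimately show ?thesis using g by (simp add: Lp_def)
qed

lemma W2_wderiv_Lp:
  fixes w :: "real \<Rightarrow> 'a::euclidean_space"
  assumes L: "L > 0" and w: "w \<in> Wc L 2 p"
  shows "wderiv L (wderiv L w) \<in> Lp L p"
proof -
  obtain u a where s: "a \<in> Lp L p" "AE x in lebesgue_on {0..L}. wderiv L (wderiv L w) x = a x"
    "weak_deriv L (wderiv L w) (wderiv L (wderiv L w))"
    using W2_structure[OF L w] by metis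
  have "AE x in lebesgue_on {0..L}. a x = wderiv L (wderiv L w) x" using s(2) by eventually_elim simp
  then show ?thesis using s by (intro Lp_cong_AE[OF s(1)]) (auto simp: weak_deriv_def)
qed

lemma W2_wderiv_Lp1:
  fixes w :: "real \<Rightarrow> 'a::euclidean_space"
  assumes L: "L > 0" and w: "w \<in> Wc L 2 p"
  shows "wderiv L w \<in> Lp L p"
proof -
  obtain g1 g2 where g: "weak_deriv L w g1" "g1 \<in> Lp L p"
    using w by (auto simp: Wc_def numeral_2_eq_2)
  note d = wderiv_weak_deriv[OF L g(1)]
  have "AE x in lebesgue_on {0..L}. g1 x = wderiv L w x" using d(2) by eventually_elim simp
  then show ?thesis using d(1) by (intro Lp_cong_AE[OF g(2)]) (auto simp: weak_deriv_def)
qed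

lemma W2_diff:
  fixes w s :: "real \<Rightarrow> 'a::euclidean_space"
  assumes L: "L > 0" and p: "p > 0" and w: "w \<in> Wc L 2 p" and s: "s \<in> Wc L 2 p"
  defines "d \<equiv> \<lambda>x. w x - s x"
  shows "d \<in> Wc L 2 p"
    and "AE x in lebesgue_on {0..L}. wderiv L d x = wderiv L w x - wderiv L s x"
    and "AE x in lebesgue_on {0..L}. wderiv L (wderiv L d) x = wderiv L (wderiv L w) x - wderiv L (wderiv L s) x"
proof -
  let ?M = "lebesgue_on {0..L}"
  have ww: "weak_deriv L w (wderiv L w)" "weak_deriv L (wderiv L w) (wderiv L (wderiv L w))"
    using W2_structure[OF L w] by metis+
  have ss: "weak_deriv L s (wderiv L s)" "weak_deriv L (wderiv L s) (wderiv L (wderiv L s))"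
    using W2_structure[OF L s] by metis+
  note d1 = weak_deriv_diff[OF ww(1) ss(1), folded d_def]
  note d2 = weak_deriv_diff[OF ww(2) ss(2)]
  show a1: "AE x in ?M. wderiv L d x = wderiv L w x - wderiv L s x"
    by (rule wderiv_weak_deriv(2)[OF L d1])
  have "AE x in ?M. wderiv L w x - wderiv L s x = wderiv L d x" using a1 by eventually_elim simp
  moreover have "periodic_fun_simple (wderiv L d) L"
    using wderiv_weak_deriv(1)[OF L d1] by (simp add: weak_deriv_def)
  ultimately have d3: "weak_deriv L (wderiv L d) (\<lambda>x. wderiv L (wderiv L w) x - wderiv L (wderiv L s) x)"
    by (intro weak_deriv_cong_AE[OF d2])
  show "AE x in ?M. wderiv L (wderiv L d) x = wderiv L (wderiv L w) x - wderiv L (wderiv L s) x"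
    by (rule wderiv_weak_deriv(2)[OF L d3])
  have "w \<in> Lp L p" "s \<in> Lp L p" "continuous_on UNIV w" "continuous_on UNIV s"
    using w s by (auto simp: Wc_def numeral_2_eq_2)
  note mem = this
  have "(\<lambda>x. wderiv L w x - wderiv L s x) \<in> sobolev L (Suc 0) p"
    using Lp_diff[OF W2_wderiv_Lp1[OF L w] W2_wderiv_Lp1[OF L s] p]
      Lp_diff[OF W2_wderiv_Lp[OF L w] W2_wderiv_Lp[OF L s] p] d2 by auto
  moreover have "d \<in> Lp L p" unfolding d_def by (rule Lp_diff[OF mem(1,2) p])
  ultimately have "d \<in> sobolev L (Suc (Suc 0)) p" using d1 by auto
  moreover have "continuous_on UNIV d" unfolding d_def by (intro continuous_on_diff mem)
  ultimately show "d \<in> Wc L 2 p" by (simp add: Wc_def numeral_2_eq_2)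
qed

lemma sobolev_norm_2:
  "sobolev_norm L 2 p f = Lp_norm L p f + Lp_norm L p (wderiv L f) + Lp_norm L p (wderiv L (wderiv L f))"
  by (simp add: sobolev_norm_def numeral_2_eq_2)

text \<open>
  A constant for the embedding of \<open>W\<^bsup>2,p\<^esup>\<close> into \<open>C\<^sup>1\<close>.
\<close>
definition sobolev_const :: "real \<Rightarrow> real" where
  "sobolev_const L = (1 / L + 2) * (L + 1)"

lemma W2_bounds:
  fixes d :: "real \<Rightarrow> 'a::euclidean_space"
  assumes L: "L > 0" and p: "p \<ge> 1" and d: "d \<in> Wc L 2 p"
  shows "AE x in lebesgue_on {0..L}. norm (wderiv L d x) \<le> sobolev_const L * sobolev_norm L 2 p d"
    and "(\<integral>x. norm (wderiv L (wderiv L d) x) powr p \<partial>lebesgue_on {0..L}) \<le> sobolev_norm L 2 p d powr p"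
proof -
  let ?M = "lebesgue_on {0..L}" and ?N = "sobolev_norm L 2 p d"
  let ?w = "wderiv L d" and ?ww = "wderiv L (wderiv L d)"
  have N: "Lp_norm L p ?w \<le> ?N" "Lp_norm L p ?ww \<le> ?N" "?N \<ge> 0"
    using Lp_norm_nonneg[of L p d] Lp_norm_nonneg[of L p ?w] Lp_norm_nonneg[of L p ?ww]
    by (auto simp: sobolev_norm_2)
  have N1: "Lp_norm L p ?w + Lp_norm L p ?ww \<le> ?N"
    using Lp_norm_nonneg[of L p d] by (simp add: sobolev_norm_2)
  have "Lp_norm L p ?ww powr p \<le> ?N powr p"
    using N p Lp_norm_nonneg by (intro powr_mono2) auto
  then show "(\<integral>x. norm (?ww x) powr p \<partial>?M) \<le> ?N powr p" using p by (simp add: Lp_norm_powr)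
  obtain u a where ua: "primitive L u a" "AE x in ?M. ?w x = u x" "AE x in ?M. ?ww x = a x"
    using W2_structure[OF L d] by metis
  have e1: "(\<integral>x. norm (u x) \<partial>?M) = (\<integral>x. norm (?w x) \<partial>?M)"
    by (rule integral_lebesgue_on_cong_AE) (use ua(2) in \<open>auto elim: eventually_mono\<close>)
  have e2: "(\<integral>x. norm (a x) \<partial>?M) = (\<integral>x. norm (?ww x) \<partial>?M)"
    by (rule integral_lebesgue_on_cong_AE) (use ua(3) in \<open>auto elim: eventually_mono\<close>)
  note l1 = L1_le_Lp_norm[OF L LpD(2,3)[OF W2_wderiv_Lp1[OF L d]] p]
  note l2 = L1_le_Lp_norm[OF L LpD(2,3)[OF W2_wderiv_Lp[OF L d]] p]
  have b: "norm (u x) \<le> sobolev_const L * ?N" if x: "x \<in> {0..L}" for x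
  proof -
    have "L * norm (u x) \<le> (L + 1) * Lp_norm L p ?w + 2 * L * ((L + 1) * Lp_norm L p ?ww)"
      using primitive_sup_bound[OF ua(1) L x] l1 l2 L unfolding e1 e2
      by (smt (verit) mult_left_mono)
    also have "\<dots> \<le> (L + 1) * ?N + 2 * L * ((L + 1) * ?N)"
      using N L by (intro add_mono mult_left_mono) auto
    also have "\<dots> = L * (sobolev_const L * ?N)" using L by (simp add: sobolev_const_def field_simps)
    finally show ?thesis using L by simp
  qed
  have "AE x in ?M. x \<in> {0..L}" by (rule AE_I2) simp
  with ua(2) show "AE x in ?M. norm (?w x) \<le> sobolev_const L * ?N"
    by eventually_elim (use b in simp)
qed

section \<open>Growth and continuity of the integrand\<close>

lemma compact_shell: "compact {u::'a::euclidean_space. r \<le> norm u \<and> norm u \<le> R}"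
proof -
  have "{u::'a. r \<le> norm u \<and> norm u \<le> R} = cball 0 R - ball 0 r" by auto
  then show ?thesis by (simp add: compact_diff)
qed

lemma ddensity_compact:
  fixes r R A M :: real
  assumes p: "p > 2" and r: "r > 0"
  defines "K \<equiv> {u::'a::euclidean_space. r \<le> norm u \<and> norm u \<le> R} \<times> cball (0::'a) A \<times> cball (0::'a) M \<times> cball (0::'a) M"
  shows "compact K" "continuous_on K (\<lambda>z. ddensity p lam (fst z) (fst (snd z)) (fst (snd (snd z))) (snd (snd (snd z))))"
proof -
  show "compact K" unfolding K_def by (intro compact_Times compact_shell compact_cball)
  show "continuous_on K (\<lambda>z. ddensity p lam (fst z) (fst (snd z)) (fst (snd (snd z))) (snd (snd (snd z))))"
    by (rule continuous_ddensity[OF p]) (use r in \<open>auto simp: K_def intro!: continuous_intros\<close>)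
qed

lemma ddensity_bounded:
  fixes r R A M :: real
  assumes p: "p > 2" and r: "r > 0"
  obtains C where "C \<ge> 0" "\<And>u a v b::'a::euclidean_space. r \<le> norm u \<Longrightarrow> norm u \<le> R \<Longrightarrow> norm a \<le> A \<Longrightarrow>
    norm v \<le> M \<Longrightarrow> norm b \<le> M \<Longrightarrow> \<bar>ddensity p lam u a v b\<bar> \<le> C"
proof -
  let ?K = "{u::'a. r \<le> norm u \<and> norm u \<le> R} \<times> cball (0::'a) A \<times> cball (0::'a) M \<times> cball (0::'a) M"
  obtain C where C: "\<And>z. z \<in> ?K \<Longrightarrow> \<bar>ddensity p lam (fst z) (fst (snd z)) (fst (snd (snd z))) (snd (snd (snd z)))\<bar> \<le> C"
    using compact_imp_bounded[OF compact_continuous_image[OF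
        ddensity_compact(2)[OF p r, where R = R and A = A and M = M and lam = lam]
        ddensity_compact(1)[OF p r, where R = R and A = A and M = M]]]
    unfolding bounded_iff real_norm_def by blast
  show ?thesis
  proof (rule that[of "max 0 C"])
    fix u a v b :: 'a assume "r \<le> norm u" "norm u \<le> R" "norm a \<le> A" "norm v \<le> M" "norm b \<le> M"
    then show "\<bar>ddensity p lam u a v b\<bar> \<le> max 0 C" using C[of "(u, a, v, b)"] by simp
  qed simp
qed

lemma ddensity_homogeneous:
  fixes u a v b :: "'a::euclidean_space"
  assumes s: "s > 0"
  shows "ddensity p 0 u (s *\<^sub>R a) v (s *\<^sub>R b) = s powr p * ddensity p 0 u a v b"
proof -
  have g: "gram u (s *\<^sub>R a) = s powr 2 * gram u a"
    using s by (simp add: gram_def power2_eq_square algebra_simps)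
  have d: "dgram u (s *\<^sub>R a) v (s *\<^sub>R b) = s powr 2 * dgram u a v b"
    using s by (simp add: dgram_def power2_eq_square algebra_simps)
  have 1: "(s powr 2 * gram u a) powr (p / 2 - 1) = s powr (p - 2) * gram u a powr (p / 2 - 1)"
  proof -
    have "(s powr 2) powr (p / 2 - 1) = s powr (p - 2)"
      unfolding powr_powr by (rule arg_cong[where f = "\<lambda>q. s powr q"]) (simp add: algebra_simps)
    then show ?thesis using gram_nonneg[of u a] by (simp only: powr_mult powr_ge_zero)
  qed
  have 2: "(s powr 2 * gram u a) powr (p / 2) = s powr p * gram u a powr (p / 2)"
  proof -
    have "(s powr 2) powr (p / 2) = s powr p" unfolding powr_powr by simp
    then show ?thesis using gram_nonneg[of u a] by (simp only: powr_mult powr_ge_zero)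
  qed
  have 3: "s powr p = s powr (p - 2) * s powr 2" unfolding powr_add[symmetric] by simp
  have alg: "1 / 2 * (s2 * G') * (t2 * D) * N + 1 / p * (s2 * t2 * G) * Z + 0 * y
      = s2 * t2 * (1 / 2 * G' * D * N + 1 / p * G * Z + 0 * y)" for s2 t2 G' D N G Z y :: real
    by (simp add: algebra_simps)
  show ?thesis unfolding ddensity_def g d 1 2 unfolding 3 by (rule alg)
qed

text \<open>
  For \<open>|a| \<le> 1\<close> this is boundedness on a compact set; for larger \<open>a\<close> homogeneity reduces to
  \<open>|a| = 1\<close>. The length term does not involve \<open>a\<close> and is split off.
\<close>
lemma ddensity_growth:
  fixes r R M :: real
  assumes p: "p > 2" and r: "r > 0" and M: "M \<ge> 0"
  obtains C where "C \<ge> 0" "\<And>u a v b::'a::euclidean_space. r \<le> norm u \<Longrightarrow> norm u \<le> R \<Longrightarrow>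
    norm v \<le> M \<Longrightarrow> norm b \<le> M \<Longrightarrow> \<bar>ddensity p lam u a v b\<bar> \<le> C * (1 + norm a powr p)"
proof -
  obtain C0 where C0: "C0 \<ge> 0" "\<And>u a v b::'a. r \<le> norm u \<Longrightarrow> norm u \<le> R \<Longrightarrow> norm a \<le> 1 \<Longrightarrow>
    norm v \<le> M \<Longrightarrow> norm b \<le> M \<Longrightarrow> \<bar>ddensity p 0 u a v b\<bar> \<le> C0"
    using ddensity_bounded[OF p r] by metis
  obtain C1 where C1: "C1 \<ge> 0" "\<And>u a v b::'a. r \<le> norm u \<Longrightarrow> norm u \<le> R \<Longrightarrow> norm a \<le> 0 \<Longrightarrow>
    norm v \<le> M \<Longrightarrow> norm b \<le> M \<Longrightarrow> \<bar>ddensity p lam u a v b\<bar> \<le> C1"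
    using ddensity_bounded[OF p r] by metis
  show ?thesis
  proof (rule that[of "C0 + (C1 + C0)"])
    fix u a v b :: 'a assume h: "r \<le> norm u" "norm u \<le> R" "norm v \<le> M" "norm b \<le> M"
    have e: "ddensity p lam u x v b = ddensity p 0 u x v b + (ddensity p lam u 0 v b - ddensity p 0 u 0 v b)" for x
      by (simp add: ddensity_def)
    have l: "\<bar>ddensity p lam u 0 v b - ddensity p 0 u 0 v b\<bar> \<le> C1 + C0"
      using C1(2)[OF h(1,2) _ h(3,4), of 0] C0(2)[OF h(1,2) _ h(3,4), of 0] by simp
    have m: "\<bar>ddensity p 0 u a v b\<bar> \<le> C0 * (1 + norm a powr p)"
    proof (cases "norm a \<le> 1")
      case True
      have "\<bar>ddensity p 0 u a v b\<bar> \<le> C0" by (rule C0(2)[OF h(1,2) True h(3,4)])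
      also have "\<dots> \<le> C0 * (1 + norm a powr p)" using C0(1) by (simp add: algebra_simps)
      finally show ?thesis .
    next
      case False
      define s where "s = norm a"
      have s: "s > 1" using False by (simp add: s_def)
      have "norm b / s \<le> norm b / 1" using s by (intro divide_left_mono) auto
      then have "norm (b /\<^sub>R s) \<le> norm b" using s by (simp add: divide_inverse mult.commute)
      then have b: "norm (b /\<^sub>R s) \<le> M" using h by simp
      have "norm a \<noteq> 0" using s unfolding s_def by linarith
      then have "norm (a /\<^sub>R s) \<le> 1" by (simp add: s_def)
      then have k: "\<bar>ddensity p 0 u (a /\<^sub>R s) v (b /\<^sub>R s)\<bar> \<le> C0" by (rule C0(2)[OF h(1,2) _ h(3) b])
      have "ddensity p 0 u a v b = s powr p * ddensity p 0 u (a /\<^sub>R s) v (b /\<^sub>R s)"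
        using ddensity_homogeneous[of s p u "a /\<^sub>R s" v "b /\<^sub>R s"] s by simp
      then have "\<bar>ddensity p 0 u a v b\<bar> = s powr p * \<bar>ddensity p 0 u (a /\<^sub>R s) v (b /\<^sub>R s)\<bar>"
        by (simp add: abs_mult)
      also have "\<dots> \<le> s powr p * C0" using k by (intro mult_left_mono) auto
      also have "\<dots> \<le> C0 * (1 + norm a powr p)" using C0(1) by (simp add: s_def algebra_simps)
      finally show ?thesis .
    qed
    have "C1 + C0 \<le> (C1 + C0) * (1 + norm a powr p)" using C0(1) C1(1) by (simp add: algebra_simps)
    then show "\<bar>ddensity p lam u a v b\<bar> \<le> (C0 + (C1 + C0)) * (1 + norm a powr p)"
      using e[of a] l m by (simp add: algebra_simps)
  qed (use C0 C1 in auto)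
qed

text \<open>
  If \<open>a'\<close> is close to \<open>a\<close>, uniform continuity on a compact set gives the small term \<open>d\<close>. If it
  is not, \<open>|a' - a|\<close> is bounded below, and the growth bound is absorbed by a large multiple of
  \<open>|a' - a|\<^sup>p\<close>. Thus convergence in \<open>L\<^sup>p\<close> of second derivatives suffices to pass to the limit,
  without selecting subsequences.
\<close>
lemma ddensity_perturbation:
  fixes r R M d :: real
  assumes p: "p > 2" and r: "r > 0" and M: "M \<ge> 0" and R: "R \<ge> 0" and d: "d > 0"
  obtains C h where "C \<ge> 0" "h > 0" "\<And>u u' a a' v b::'a::euclidean_space. 2 * r \<le> norm u \<Longrightarrow> norm u \<le> R \<Longrightarrow>
    norm a \<le> R \<Longrightarrow> norm v \<le> M \<Longrightarrow> norm b \<le> M \<Longrightarrow> norm (u' - u) \<le> h \<Longrightarrow>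
    \<bar>ddensity p lam u' a' v b - ddensity p lam u a v b\<bar> \<le> d + C * norm (a' - a) powr p"
proof -
  let ?D = "\<lambda>z::'a \<times> 'a \<times> 'a \<times> 'a. ddensity p lam (fst z) (fst (snd z)) (fst (snd (snd z))) (snd (snd (snd z)))"
  let ?K = "{u::'a. r \<le> norm u \<and> norm u \<le> R + 1} \<times> cball (0::'a) (R + 1) \<times> cball (0::'a) M \<times> cball (0::'a) M"
  have uc: "uniformly_continuous_on ?K ?D"
    by (rule compact_uniformly_continuous[OF ddensity_compact(2)[OF p r] ddensity_compact(1)[OF p r]])
  obtain e where e: "e > 0" "\<And>z z'. z \<in> ?K \<Longrightarrow> z' \<in> ?K \<Longrightarrow> dist z' z < e \<Longrightarrow> dist (?D z') (?D z) < d"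
    using uc[unfolded uniformly_continuous_on_def, rule_format, OF d] by blast
  obtain C1 where C1: "C1 \<ge> 0" "\<And>u a v b::'a. r \<le> norm u \<Longrightarrow> norm u \<le> R + 1 \<Longrightarrow>
    norm v \<le> M \<Longrightarrow> norm b \<le> M \<Longrightarrow> \<bar>ddensity p lam u a v b\<bar> \<le> C1 * (1 + norm a powr p)"
    using ddensity_growth[OF p r M] by metis
  \<comment> \<open>With this radius \<open>u'\<close> stays in the shell \<open>r \<le> |u'| \<le> R + 1\<close>, and closeness of \<open>u\<close> and of \<open>a\<close>
      by \<open>h\<close> gives closeness by \<open>e\<close> in the product.\<close>
  define h where "h = min (min 1 r) (e / 3)"
  have h: "h > 0" "h \<le> 1" "h \<le> r" "h \<le> e / 3" using r e by (auto simp: h_def)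
  define C where "C = C1 * (2 * h powr (- p) + (1 + R / h) powr p + R powr p * h powr (- p))"
  show ?thesis
  proof (rule that[of C h])
    show "C \<ge> 0" using C1 by (simp add: C_def)
    show "h > 0" by (rule h)
    fix u u' a a' v b :: 'a
    assume u: "2 * r \<le> norm u" "norm u \<le> R" and a: "norm a \<le> R" and v: "norm v \<le> M" "norm b \<le> M"
      and u': "norm (u' - u) \<le> h"
    have nu': "r \<le> norm u'" "norm u' \<le> R + 1"
      using u u' h norm_triangle_ineq2[of u u'] norm_triangle_ineq2[of u' u] by (auto simp: norm_minus_commute)
    show "\<bar>ddensity p lam u' a' v b - ddensity p lam u a v b\<bar> \<le> d + C * norm (a' - a) powr p"
    proof (cases "norm (a' - a) \<le> h")
      case True
      have "norm a' \<le> R + 1" using True a h norm_triangle_ineq2[of a' a] by auto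
      then have z: "(u, a, v, b) \<in> ?K" "(u', a', v, b) \<in> ?K" using u a v nu' r R by auto
      have "dist (u', a', v, b) (u, a, v, b) \<le> dist u' u + dist a' a"
        unfolding dist_Pair_Pair using real_sqrt_sum_squares_triangle_ineq[of "dist u' u" 0 0 "dist a' a"]
        by simp
      also have "\<dots> < e" using u' True h e by (auto simp: dist_norm)
      finally have "dist (?D (u', a', v, b)) (?D (u, a, v, b)) < d" by (rule e(2)[OF z])
      then have "\<bar>ddensity p lam u' a' v b - ddensity p lam u a v b\<bar> \<le> d" by (simp add: dist_real_def)
      moreover have "0 \<le> C * norm (a' - a) powr p" using C1 by (simp add: C_def)
      ultimately show ?thesis by linarith
    next
      case False
      define t where "t = norm (a' - a)"
      have t: "t > h" using False by (simp add: t_def)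
      have "1 = h powr (- p) * h powr p" using h by (simp add: powr_add[symmetric])
      also have "\<dots> \<le> h powr (- p) * t powr p" using t h p by (intro mult_left_mono powr_mono2) auto
      finally have one: "1 \<le> h powr (- p) * t powr p" .
      have "R \<le> t * (R / h)" using t h R mult_right_mono[of h t "R / h"] by simp
      then have "norm a' \<le> t * (1 + R / h)"
        using norm_triangle_ineq2[of a' a] a by (simp add: t_def algebra_simps)
      then have "norm a' powr p \<le> (t * (1 + R / h)) powr p" using p by (intro powr_mono2) auto
      also have "\<dots> = (1 + R / h) powr p * t powr p" using t h R by (simp add: powr_mult)
      finally have a': "norm a' powr p \<le> (1 + R / h) powr p * t powr p" .
      have "norm a powr p \<le> R powr p * 1" using a p by (simp add: powr_mono2)
      also have "\<dots> \<le> R powr p * (h powr (- p) * t powr p)" by (intro mult_left_mono one) auto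
      finally have aa: "norm a powr p \<le> R powr p * h powr (- p) * t powr p" by simp
      have "\<bar>ddensity p lam u' a' v b - ddensity p lam u a v b\<bar>
          \<le> C1 * (1 + norm a' powr p) + C1 * (1 + norm a powr p)"
        using C1(2)[OF nu' v, of a'] C1(2)[of u v b a] u v r by linarith
      also have "\<dots> = C1 * (1 + 1 + norm a' powr p + norm a powr p)" by (simp add: algebra_simps)
      also have "\<dots> \<le> C1 * (h powr (- p) * t powr p + h powr (- p) * t powr p
          + (1 + R / h) powr p * t powr p + R powr p * h powr (- p) * t powr p)"
        by (intro mult_left_mono add_mono one a' aa C1)
      also have "\<dots> = C * t powr p" by (simp add: C_def algebra_simps)
      finally show ?thesis using d by (simp add: t_def)
    qed
  qed
qed

section \<open>Convergence of the energy integral\<close>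

lemma measurable_AE_limit:
  fixes f :: "nat \<Rightarrow> real \<Rightarrow> real"
  assumes S: "S \<in> sets lebesgue" and m: "\<And>k. f k \<in> borel_measurable (lebesgue_on S)"
    and lim: "AE t in lebesgue_on S. (\<lambda>k. f k t) \<longlonglongrightarrow> g t"
  shows "g \<in> borel_measurable (lebesgue_on S)"
proof (rule measurable_lebesgue_on_cong_AE[OF S])
  show "(\<lambda>t. lim (\<lambda>k. f k t)) \<in> borel_measurable (lebesgue_on S)"
    by (rule borel_measurable_lim_metric[OF m])
  show "AE t in lebesgue_on S. lim (\<lambda>k. f k t) = g t"
    using lim by eventually_elim (rule limI)
qed

lemma ddensity_measurable:
  fixes u a v b :: "'c \<Rightarrow> 'a::euclidean_space"
  assumes [measurable]: "u \<in> borel_measurable M" "a \<in> borel_measurable M"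
    "v \<in> borel_measurable M" "b \<in> borel_measurable M"
  shows "(\<lambda>x. ddensity p lam (u x) (a x) (v x) (b x)) \<in> borel_measurable M"
  unfolding ddensity_def dgram_def gram_def by measurable

lemma continuous_bound_Icc:
  fixes f :: "real \<Rightarrow> 'a::real_normed_vector"
  assumes "continuous_on {a..b} f"
  obtains B where "B \<ge> 0" "\<And>x. x \<in> {a..b} \<Longrightarrow> norm (f x) \<le> B"
proof -
  obtain B where B: "\<And>x. x \<in> {a..b} \<Longrightarrow> norm (f x) \<le> B"
    using compact_imp_bounded[OF compact_continuous_image[OF assms compact_Icc]]
    unfolding bounded_iff by blast
  show ?thesis by (rule that[of "max 0 B"]) (use B in \<open>auto simp: le_max_iff_disj\<close>)
qed

text \<open>
  Continuity of the first variation with respect to the \<open>W\<^bsup>2,p\<^esup>\<close>-norm at a curve of class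
  \<open>C\<^sup>2\<close>.
\<close>
lemma ddensity_integral_tendsto:
  fixes u a v b :: "real \<Rightarrow> 'a::euclidean_space"
  assumes p: "p > 2" and L: "L > 0" and r: "r > 0"
    and c: "continuous_on {0..L} u" "continuous_on {0..L} a" "continuous_on {0..L} v" "continuous_on {0..L} b"
    and reg: "\<And>x. x \<in> {0..L} \<Longrightarrow> 2 * r \<le> norm (u x)"
    and m: "\<And>k. uk k \<in> borel_measurable (lebesgue_on {0..L})" "\<And>k. ak k \<in> borel_measurable (lebesgue_on {0..L})"
    and e: "\<And>k. AE x in lebesgue_on {0..L}. norm (uk k x - u x) \<le> e k" "e \<longlonglongrightarrow> 0"
    and i: "\<And>k. integrable (lebesgue_on {0..L}) (\<lambda>x. norm (ak k x - a x) powr p)"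
    and lim: "(\<lambda>k. \<integral>x. norm (ak k x - a x) powr p \<partial>lebesgue_on {0..L}) \<longlonglongrightarrow> 0"
  shows "(\<lambda>k. \<integral>x. ddensity p lam (uk k x) (ak k x) (v x) (b x) \<partial>lebesgue_on {0..L})
    \<longlonglongrightarrow> (\<integral>x. ddensity p lam (u x) (a x) (v x) (b x) \<partial>lebesgue_on {0..L})"
proof (rule tendstoI)
  let ?M = "lebesgue_on {0..L}"
  let ?f = "\<lambda>x. ddensity p lam (u x) (a x) (v x) (b x)"
  let ?fk = "\<lambda>k x. ddensity p lam (uk k x) (ak k x) (v x) (b x)"
  fix \<epsilon> :: real assume \<epsilon>: "\<epsilon> > 0"
  obtain R1 where R1: "R1 \<ge> 0" "\<And>x. x \<in> {0..L} \<Longrightarrow> norm (u x) \<le> R1" using continuous_bound_Icc[OF c(1)] by blast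
  obtain R2 where R2: "R2 \<ge> 0" "\<And>x. x \<in> {0..L} \<Longrightarrow> norm (a x) \<le> R2" using continuous_bound_Icc[OF c(2)] by blast
  obtain M1 where M1: "M1 \<ge> 0" "\<And>x. x \<in> {0..L} \<Longrightarrow> norm (v x) \<le> M1" using continuous_bound_Icc[OF c(3)] by blast
  obtain M2 where M2: "M2 \<ge> 0" "\<And>x. x \<in> {0..L} \<Longrightarrow> norm (b x) \<le> M2" using continuous_bound_Icc[OF c(4)] by blast
  define R where "R = max R1 R2"
  define M where "M = max M1 M2"
  have R: "R \<ge> 0" and M: "M \<ge> 0" using R1 M1 by (auto simp: R_def M_def)
  define d where "d = \<epsilon> / (2 * L)"
  have d: "d > 0" using \<epsilon> L by (simp add: d_def)
  obtain C h where C: "C \<ge> 0" and h: "h > 0" and pert: "\<And>u u' a a' v b::'a. 2 * r \<le> norm u \<Longrightarrow> norm u \<le> R \<Longrightarrow>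
    norm a \<le> R \<Longrightarrow> norm v \<le> M \<Longrightarrow> norm b \<le> M \<Longrightarrow> norm (u' - u) \<le> h \<Longrightarrow>
    \<bar>ddensity p lam u' a' v b - ddensity p lam u a v b\<bar> \<le> d + C * norm (a' - a) powr p"
    using ddensity_perturbation[OF p r M R d] by metis
  let ?I = "\<lambda>k. \<integral>x. norm (ak k x - a x) powr p \<partial>?M"
  have "(\<lambda>k. C * ?I k) \<longlonglongrightarrow> C * 0" by (intro tendsto_intros lim)
  then have "\<forall>\<^sub>F k in sequentially. C * ?I k < \<epsilon> / 2" using \<epsilon> by (intro order_tendstoD(2)) auto
  moreover have "\<forall>\<^sub>F k in sequentially. e k < h" using e(2) h by (rule order_tendstoD(2))
  ultimately show "\<forall>\<^sub>F k in sequentially. dist (\<integral>x. ?fk k x \<partial>?M) (\<integral>x. ?f x \<partial>?M) < \<epsilon>"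
  proof eventually_elim
    case (elim k)
    have fi: "integrable ?M ?f"
    proof (intro integrable_lebesgue_on_continuous continuous_ddensity[OF p] c)
      show "u x \<noteq> 0" if "x \<in> {0..L}" for x using reg[OF that] r by auto
    qed
    have fkm: "?fk k \<in> borel_measurable ?M"
      by (intro ddensity_measurable m measurable_continuous_Icc c)
    have gi: "integrable ?M (\<lambda>x. d + C * norm (ak k x - a x) powr p)"
      by (intro Bochner_Integration.integrable_add integrable_const_Icc integrable_mult_right i)
    have "AE x in ?M. x \<in> {0..L}" by (rule AE_I2) simp
    with e(1)[of k] have ae: "AE x in ?M. \<bar>?fk k x - ?f x\<bar> \<le> d + C * norm (ak k x - a x) powr p"
    proof eventually_elim
      case (elim x)
      show ?case
        by (rule pert)
          (use elim \<open>e k < h\<close> reg[of x] R1(2)[of x] R2(2)[of x] M1(2)[of x] M2(2)[of x] in \<open>auto simp: R_def M_def le_max_iff_disj\<close>)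
    qed
    have di: "integrable ?M (\<lambda>x. ?fk k x - ?f x)"
    proof (rule Bochner_Integration.integrable_bound[OF gi])
      show "(\<lambda>x. ?fk k x - ?f x) \<in> borel_measurable ?M" using fkm fi by auto
      show "AE x in ?M. norm (?fk k x - ?f x) \<le> norm (d + C * norm (ak k x - a x) powr p)"
        using ae by eventually_elim simp
    qed
    have fki: "integrable ?M (?fk k)" using Bochner_Integration.integrable_add[OF di fi] by simp
    have "\<bar>(\<integral>x. ?fk k x \<partial>?M) - (\<integral>x. ?f x \<partial>?M)\<bar> = \<bar>\<integral>x. ?fk k x - ?f x \<partial>?M\<bar>"
      using fki fi by simp
    also have "\<dots> \<le> (\<integral>x. \<bar>?fk k x - ?f x\<bar> \<partial>?M)" using integral_abs_bound by blast
    also have "\<dots> \<le> (\<integral>x. d + C * norm (ak k x - a x) powr p \<partial>?M)"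
      using di gi ae by (intro integral_mono_AE) auto
    also have "\<dots> = L *\<^sub>R d + C * ?I k"
      unfolding integral_const_Icc[OF less_imp_le[OF L], symmetric] integral_mult_right_zero[symmetric]
      by (intro Bochner_Integration.integral_add integrable_const_Icc integrable_mult_right i)
    also have "\<dots> < \<epsilon>" using elim L by (simp add: d_def)
    finally show ?case by (simp add: dist_real_def)
  qed
qed

section \<open>Normal velocity\<close>

text \<open>
  The component of \<open>X\<close> orthogonal to \<open>u\<close>, multiplied by \<open>|u|\<close>. Pairing with it combines the
  normal velocity with the arc-length element, so that \<open>\<partial>\<^sub>t\<^sup>\<bottom>\<gamma> \<bullet> X ds = \<partial>\<^sub>t\<gamma> \<bullet> nproj \<gamma>' X dx\<close>.
\<close>
definition nproj :: "'a::euclidean_space \<Rightarrow> 'a \<Rightarrow> 'a" where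
  "nproj u X = norm u *\<^sub>R X - ((u \<bullet> X) / norm u) *\<^sub>R u"

lemma nproj_velocity:
  fixes u V X :: "'a::euclidean_space"
  assumes "u \<noteq> 0"
  shows "((V - (V \<bullet> (u /\<^sub>R norm u)) *\<^sub>R (u /\<^sub>R norm u)) \<bullet> X) * norm u = V \<bullet> nproj u X"
  using assms by (simp add: nproj_def inner_diff_left inner_diff_right field_simps)

lemma nproj_bound: "norm (nproj u X) \<le> 2 * norm u * norm X"
proof (cases "u = 0")
  case False
  have "norm (((u \<bullet> X) / norm u) *\<^sub>R u) = \<bar>u \<bullet> X\<bar>" using False by simp
  also have "\<dots> \<le> norm u * norm X" by (rule Cauchy_Schwarz_ineq2)
  finally show ?thesis
    using norm_triangle_ineq4[of "norm u *\<^sub>R X" "((u \<bullet> X) / norm u) *\<^sub>R u"] by (simp add: nproj_def)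
qed (simp add: nproj_def)

lemma nproj_tangent: "nproj u (c *\<^sub>R u) = 0"
  by (cases "u = 0") (simp_all add: nproj_def dot_square_norm power2_eq_square)

lemma nproj_diff: "nproj u (X - Y) = nproj u X - nproj u Y"
  by (simp add: nproj_def inner_diff_right diff_divide_distrib scaleR_diff_left scaleR_diff_right)

lemma nproj_linear: "linear (nproj u)"
  by (rule linearI) (simp_all add: nproj_def inner_add_right add_divide_distrib scaleR_add_left scaleR_add_right
      scaleR_diff_right mult.commute)

lemma nproj_measurable:
  fixes u X :: "'c \<Rightarrow> 'a::euclidean_space"
  assumes [measurable]: "u \<in> borel_measurable M" "X \<in> borel_measurable M"
  shows "(\<lambda>x. nproj (u x) (X x)) \<in> borel_measurable M"
  unfolding nproj_def by measurable

lemma nproj_continuous: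
  fixes u X :: "'c::topological_space \<Rightarrow> 'a::euclidean_space"
  assumes "continuous_on S u" "continuous_on S X" "\<And>x. x \<in> S \<Longrightarrow> u x \<noteq> 0"
  shows "continuous_on S (\<lambda>x. nproj (u x) (X x))"
  unfolding nproj_def by (intro continuous_intros assms) (use assms(3) in auto)

lemma nproj_perturbation:
  fixes r R M d :: real
  assumes r: "r > 0" and d: "d > 0"
  obtains h where "h > 0" "h \<le> 1" "\<And>u u' X::'a::euclidean_space. 2 * r \<le> norm u \<Longrightarrow> norm u \<le> R \<Longrightarrow>
    norm X \<le> M \<Longrightarrow> norm (u' - u) \<le> h \<Longrightarrow> norm (nproj u' X - nproj u X) \<le> d"
proof -
  let ?K = "{u::'a. r \<le> norm u \<and> norm u \<le> R + 1} \<times> cball (0::'a) M"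
  let ?D = "\<lambda>z::'a \<times> 'a. nproj (fst z) (snd z)"
  have uc: "uniformly_continuous_on ?K ?D"
    by (intro compact_uniformly_continuous nproj_continuous compact_Times compact_shell compact_cball
        continuous_intros) (use r in auto)
  obtain e where e: "e > 0" "\<And>z z'. z \<in> ?K \<Longrightarrow> z' \<in> ?K \<Longrightarrow> dist z' z < e \<Longrightarrow> dist (?D z') (?D z) < d"
    using uc[unfolded uniformly_continuous_on_def, rule_format, OF d] by blast
  show ?thesis
  proof (rule that[of "min (min 1 r) (e / 2)"])
    fix u u' X :: 'a
    assume u: "2 * r \<le> norm u" "norm u \<le> R" and X: "norm X \<le> M" and u': "norm (u' - u) \<le> min (min 1 r) (e / 2)"
    have "r \<le> norm u'" "norm u' \<le> R + 1"
      using u u' norm_triangle_ineq2[of u u'] norm_triangle_ineq2[of u' u] by (auto simp: norm_minus_commute)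
    then have "(u, X) \<in> ?K" "(u', X) \<in> ?K" using u X r by auto
    moreover have "dist (u', X) (u, X) < e" using u' e(1) by (simp add: dist_Pair_Pair dist_norm)
    ultimately have "dist (?D (u', X)) (?D (u, X)) < d" by (rule e(2))
    then show "norm (nproj u' X - nproj u X) \<le> d" by (simp add: dist_norm)
  qed (use r e in auto)
qed

lemma inner_nproj_bound:
  assumes "norm u \<le> R" "norm X \<le> M"
  shows "\<bar>V \<bullet> nproj u X\<bar> \<le> 2 * R * M * norm V"
proof -
  have "0 \<le> R" using norm_ge_zero assms(1) by (rule order_trans)
  then have "2 * norm u * norm X \<le> 2 * R * M" using assms by (intro mult_mono) auto
  then have "norm (nproj u X) \<le> 2 * R * M" using nproj_bound[of u X] by linarith
  then have "norm V * norm (nproj u X) \<le> norm V * (2 * R * M)" by (intro mult_left_mono) auto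
  then show ?thesis using Cauchy_Schwarz_ineq2[of V "nproj u X"] by (simp add: mult.commute)
qed

lemma friction_integrand_integrable:
  fixes u X V :: "real \<Rightarrow> 'a::euclidean_space"
  assumes V: "integrable (lebesgue_on {0..L}) V" and c: "continuous_on {0..L} u" "continuous_on {0..L} X"
    and nz: "\<And>x. x \<in> {0..L} \<Longrightarrow> u x \<noteq> 0"
  shows "integrable (lebesgue_on {0..L}) (\<lambda>x. V x \<bullet> nproj (u x) (X x))"
  by (rule integrable_linear_family[where A = "\<lambda>x v. v \<bullet> nproj (u x) (X x)"])
     (auto intro!: V continuous_on_inner nproj_continuous c nz continuous_on_const
        bounded_linear.linear[OF bounded_linear_inner_left])

text \<open>
  Strong \<open>L\<^sup>1\<close>-convergence of the velocities is paired with uniform convergence of the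
  tangents.
\<close>
lemma velocity_integral_tendsto:
  fixes u X V :: "real \<Rightarrow> 'a::euclidean_space"
  assumes L: "L > 0" and r: "r > 0"
    and c: "continuous_on {0..L} u" "continuous_on {0..L} X"
    and reg: "\<And>x. x \<in> {0..L} \<Longrightarrow> 2 * r \<le> norm (u x)"
    and m: "\<And>k. uk k \<in> borel_measurable (lebesgue_on {0..L})"
    and e: "\<And>k. AE x in lebesgue_on {0..L}. norm (uk k x - u x) \<le> e k" "e \<longlonglongrightarrow> 0"
    and V: "integrable (lebesgue_on {0..L}) V" "\<And>k. integrable (lebesgue_on {0..L}) (Vk k)"
    and lim: "(\<lambda>k. \<integral>x. norm (V x - Vk k x) \<partial>lebesgue_on {0..L}) \<longlonglongrightarrow> 0"
  shows "(\<lambda>k. \<integral>x. Vk k x \<bullet> nproj (uk k x) (X x) \<partial>lebesgue_on {0..L})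
    \<longlonglongrightarrow> (\<integral>x. V x \<bullet> nproj (u x) (X x) \<partial>lebesgue_on {0..L})"
proof (rule tendstoI)
  let ?M = "lebesgue_on {0..L}"
  fix \<epsilon> :: real assume \<epsilon>: "\<epsilon> > 0"
  obtain R where R: "R \<ge> 0" "\<And>x. x \<in> {0..L} \<Longrightarrow> norm (u x) \<le> R" using continuous_bound_Icc[OF c(1)] by blast
  obtain M where M: "M \<ge> 0" "\<And>x. x \<in> {0..L} \<Longrightarrow> norm (X x) \<le> M" using continuous_bound_Icc[OF c(2)] by blast
  define NV where "NV = (\<integral>x. norm (V x) \<partial>?M)"
  have NV: "NV \<ge> 0" by (simp add: NV_def)
  define d where "d = \<epsilon> / 2 / (NV + 1)"
  have d: "d > 0" using \<epsilon> NV by (simp add: d_def)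
  obtain h where h: "h > 0" "h \<le> 1" and pert: "\<And>u u' X::'a. 2 * r \<le> norm u \<Longrightarrow> norm u \<le> R \<Longrightarrow>
    norm X \<le> M \<Longrightarrow> norm (u' - u) \<le> h \<Longrightarrow> norm (nproj u' X - nproj u X) \<le> d"
    using nproj_perturbation[OF r d] by metis
  define C where "C = 2 * (R + 1) * M"
  let ?I = "\<lambda>k. \<integral>x. norm (V x - Vk k x) \<partial>?M"
  have "(\<lambda>k. C * ?I k) \<longlonglongrightarrow> C * 0" by (intro tendsto_intros lim)
  then have "\<forall>\<^sub>F k in sequentially. C * ?I k < \<epsilon> / 2" using \<epsilon> by (intro order_tendstoD(2)) auto
  moreover have "\<forall>\<^sub>F k in sequentially. e k < h" using e(2) h(1) by (rule order_tendstoD(2))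
  ultimately show "\<forall>\<^sub>F k in sequentially. dist (\<integral>x. Vk k x \<bullet> nproj (uk k x) (X x) \<partial>?M) (\<integral>x. V x \<bullet> nproj (u x) (X x) \<partial>?M) < \<epsilon>"
  proof eventually_elim
    case (elim k)
    let ?f = "\<lambda>x. V x \<bullet> nproj (u x) (X x)" and ?fk = "\<lambda>x. Vk k x \<bullet> nproj (uk k x) (X x)"
    let ?g = "\<lambda>x. C * norm (V x - Vk k x) + d * norm (V x)"
    have Xm: "X \<in> borel_measurable ?M" by (rule measurable_continuous_Icc[OF c(2)])
    have fi: "integrable ?M ?f"
    proof (rule friction_integrand_integrable[OF V(1) c])
      show "u x \<noteq> 0" if "x \<in> {0..L}" for x using reg[OF that] r by auto
    qed
    have fkm: "?fk \<in> borel_measurable ?M" using nproj_measurable[OF m Xm] V by auto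
    have gi: "integrable ?M ?g" using V by auto
    have "AE x in ?M. x \<in> {0..L}" by (rule AE_I2) simp
    with e(1)[of k] have ae: "AE x in ?M. \<bar>?fk x - ?f x\<bar> \<le> ?g x"
    proof eventually_elim
      case (elim x)
      have le: "norm (uk k x - u x) \<le> h" using elim \<open>e k < h\<close> by linarith
      have 1: "norm (nproj (uk k x) (X x) - nproj (u x) (X x)) \<le> d"
        by (rule pert) (use elim le reg[of x] R(2)[of x] M(2)[of x] in auto)
      have "norm (uk k x) \<le> R + 1"
        using le h(2) R(2)[of x] elim(2) norm_triangle_ineq2[of "uk k x" "u x"] by linarith
      then have "2 * norm (uk k x) * norm (X x) \<le> C"
        unfolding C_def using M(2)[of x] elim(2) R(1) by (intro mult_mono) auto
      then have 2: "norm (nproj (uk k x) (X x)) \<le> C" using nproj_bound[of "uk k x" "X x"] by linarith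
      have "?fk x - ?f x = (Vk k x - V x) \<bullet> nproj (uk k x) (X x) + V x \<bullet> (nproj (uk k x) (X x) - nproj (u x) (X x))"
        by (simp add: inner_diff_left inner_diff_right)
      then have "\<bar>?fk x - ?f x\<bar> \<le> norm (Vk k x - V x) * norm (nproj (uk k x) (X x))
          + norm (V x) * norm (nproj (uk k x) (X x) - nproj (u x) (X x))"
        using Cauchy_Schwarz_ineq2[of "Vk k x - V x" "nproj (uk k x) (X x)"]
          Cauchy_Schwarz_ineq2[of "V x" "nproj (uk k x) (X x) - nproj (u x) (X x)"] by linarith
      also have "\<dots> \<le> norm (Vk k x - V x) * C + norm (V x) * d"
        using 1 2 by (intro add_mono mult_left_mono) auto
      finally show ?case by (simp add: norm_minus_commute mult.commute)
    qed
    have di: "integrable ?M (\<lambda>x. ?fk x - ?f x)"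
    proof (rule Bochner_Integration.integrable_bound[OF gi])
      show "(\<lambda>x. ?fk x - ?f x) \<in> borel_measurable ?M" using fkm fi by auto
      show "AE x in ?M. norm (?fk x - ?f x) \<le> norm (?g x)" using ae by eventually_elim simp
    qed
    have fki: "integrable ?M ?fk" using Bochner_Integration.integrable_add[OF di fi] by simp
    have "\<bar>(\<integral>x. ?fk x \<partial>?M) - (\<integral>x. ?f x \<partial>?M)\<bar> = \<bar>\<integral>x. ?fk x - ?f x \<partial>?M\<bar>"
      using fki fi by simp
    also have "\<dots> \<le> (\<integral>x. \<bar>?fk x - ?f x\<bar> \<partial>?M)" using integral_abs_bound by blast
    also have "\<dots> \<le> (\<integral>x. ?g x \<partial>?M)" using di gi ae by (intro integral_mono_AE) auto
    also have "\<dots> = C * ?I k + d * NV" using V by (simp add: NV_def)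
    also have "\<dots> < \<epsilon>"
    proof -
      have "d * NV \<le> d * (NV + 1)" using d by simp
      also have "\<dots> = \<epsilon> / 2" unfolding d_def by (rule nonzero_eq_divide_eq[THEN iffD1, OF _ refl]) (use NV in simp)
      finally show ?thesis using elim by linarith
    qed
    finally show ?case by (simp add: dist_real_def)
  qed
qed

section \<open>Evolving graphs over a smooth curve\<close>

text \<open>
  The part of the hypotheses that concerns the evolving graph \<open>\<gamma>0 + \<phi> t\<close> over the smooth curve
  \<open>\<gamma>0\<close>, with \<open>\<tau>\<close> an arbitrary smooth periodic unit field to which the tangents of the evolving
  curve stay uniformly transversal.
\<close>
locale graph_evolution =
  fixes p lam L T :: real
    and \<gamma>0 \<tau> :: "real \<Rightarrow> 'a::euclidean_space"
    and \<phi> :: "real \<Rightarrow> real \<Rightarrow> 'a"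
  assumes p: "p > 2" and L: "L > 0" and T: "T > 0"
    and \<gamma>0: "smooth \<gamma>0" "periodic_fun_simple \<gamma>0 L"
    and \<tau>: "smooth \<tau>" "periodic_fun_simple \<tau> L" "\<And>x. norm (\<tau> x) = 1"
    and \<phi>_Linfty: "\<phi> \<in> Linfty_into {0..<T} (Wc L 2 p) (sobolev_norm L 2 p)"
    and \<phi>_W12: "\<phi> \<in> W12_into {0..<T} (Lp L 2) (Lp_norm L 2)"
    and steep: "\<And>t x. t \<in> {0..<T} \<Longrightarrow> dx (\<lambda>x. \<gamma>0 x + \<phi> t x) x \<bullet> \<tau> x \<ge> 1 / 2"
    and W3: "AE t in lebesgue_on {0..<T}. (\<lambda>x. \<gamma>0 x + \<phi> t x) \<in> Wc L 3 p"
begin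

abbreviation "circle \<equiv> lebesgue_on {0..L}"
abbreviation "time \<equiv> lebesgue_on {0..<T}"
abbreviation "\<gamma> t \<equiv> \<lambda>x. \<gamma>0 x + \<phi> t x"

definition U :: "(real \<Rightarrow> 'a) \<Rightarrow> real \<Rightarrow> 'a" where "U w x = dx \<gamma>0 x + wderiv L w x"
definition A :: "(real \<Rightarrow> 'a) \<Rightarrow> real \<Rightarrow> 'a" where "A w x = dx (dx \<gamma>0) x + wderiv L (wderiv L w) x"

lemma finite_time: "finite_measure time"
  by (intro finite_measure_lebesgue_on bounded_set_imp_lmeasurable) auto

lemma \<gamma>0_smooth: "smooth (dx \<gamma>0)" "smooth (dx (dx \<gamma>0))"
  using smooth_has_vector_derivative(2) \<gamma>0(1) by blast+

lemma \<phi>_W2: "t \<in> {0..<T} \<Longrightarrow> \<phi> t \<in> Wc L 2 p"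
  using \<phi>_Linfty by (simp add: Linfty_into_def bochner_measurable_def)

text \<open>
  The regular representatives of the derivatives of the curve at a time \<open>t\<close> at which it
  belongs to \<open>W\<^bsup>3,p\<^esup>\<close>: \<open>u = \<gamma>'\<close>, \<open>a = \<gamma>''\<close> and \<open>c\<close> an almost everywhere derivative of \<open>\<gamma>''\<close>.
\<close>
definition frame :: "real \<Rightarrow> (real \<Rightarrow> 'a) \<Rightarrow> (real \<Rightarrow> 'a) \<Rightarrow> (real \<Rightarrow> 'a) \<Rightarrow> bool" where
  "frame t u a c \<longleftrightarrow> C2_on L (\<gamma> t) u a \<and> primitive L a c \<and> a L = a 0 \<and>
     (AE x in circle. U (\<phi> t) x = u x) \<and> (AE x in circle. A (\<phi> t) x = a x) \<and>
     (\<forall>x\<in>{0..L}. u x \<bullet> \<tau> x \<ge> 1 / 2)"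

lemma frame_steep:
  assumes "frame t u a c" "x \<in> {0..L}"
  shows "norm (u x) \<ge> 1 / 2" "u x \<noteq> 0"
proof -
  have "1 / 2 \<le> u x \<bullet> \<tau> x" using assms unfolding frame_def by blast
  then have "1 / 2 \<le> \<bar>u x \<bullet> \<tau> x\<bar>" by linarith
  also have "\<dots> \<le> norm (u x) * norm (\<tau> x)" by (rule Cauchy_Schwarz_ineq2)
  finally show "norm (u x) \<ge> 1 / 2" by (simp add: \<tau>)
  then show "u x \<noteq> 0" by auto
qed

text \<open>
  The weak derivatives of \<open>\<phi> t = \<gamma> t - \<gamma>0\<close> are unique, so they are the differences of those of
  \<open>\<gamma> t\<close> and of \<open>\<gamma>0\<close>. The lower bound on \<open>u \<bullet> \<tau>\<close> is known at interior points, where \<open>u\<close> is the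
  classical derivative, and extends to the end points by continuity.
\<close>
lemma frame_exists_at:
  assumes t: "t \<in> {0..<T}" and w: "\<gamma> t \<in> Wc L 3 p"
  shows "\<exists>u a c. frame t u a c"
proof -
  obtain u a c where c: "C2_on L (\<gamma> t) u a" "primitive L (\<gamma> t) u" "primitive L a c" "a L = a 0"
    using W3_structure[OF L w] by blast
  obtain u' a' where u': "primitive L (\<phi> t) u'" "primitive L u' a'"
    "AE x in circle. wderiv L (\<phi> t) x = u' x" "AE x in circle. wderiv L (wderiv L (\<phi> t)) x = a' x"
    using W2_structure[OF L \<phi>_W2[OF t]] by metis
  have "primitive L (\<phi> t) (\<lambda>x. u x - dx \<gamma>0 x)"
    using primitive_diff[OF c(2) smooth_primitive[OF \<gamma>0(1)]] by simp
  from primitive_unique_AE[OF u'(1) this]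
  have ae1: "AE x in circle. u' x = u x - dx \<gamma>0 x" .
  have eq: "u' x = u x - dx \<gamma>0 x" if "x \<in> {0..L}" for x
    by (rule AE_eq_continuous_Icc[OF L primitive_continuous[OF u'(2)] _ ae1 that])
       (intro continuous_on_diff C2_on_continuous(1)[OF c(1)] smooth_continuous \<gamma>0_smooth)
  have "primitive L (\<lambda>x. u x - dx \<gamma>0 x) (\<lambda>x. a x - dx (dx \<gamma>0) x)"
    by (rule primitive_diff[OF C2_on_continuous(3)[OF c(1)] smooth_primitive[OF \<gamma>0_smooth(1)]])
  then have "primitive L u' (\<lambda>x. a x - dx (dx \<gamma>0) x)"
    using eq L by (simp add: primitive_def)
  from primitive_unique_AE[OF u'(2) this]
  have ae2: "AE x in circle. a' x = a x - dx (dx \<gamma>0) x" .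
  have in1: "AE x in circle. U (\<phi> t) x = u x"
    using ae1 u'(3) by eventually_elim (simp add: U_def)
  have in2: "AE x in circle. A (\<phi> t) x = a x"
    using ae2 u'(4) by eventually_elim (simp add: A_def)
  have st: "u x \<bullet> \<tau> x \<ge> 1 / 2" if x: "x \<in> {0..L}" for x
  proof -
    \<comment> \<open>The inequality is expressed as an equation between continuous functions that holds at all
        interior points.\<close>
    let ?f = "\<lambda>x. max (u x \<bullet> \<tau> x) (1 / 2)"
    have cu: "continuous_on {0..L} (\<lambda>x. u x \<bullet> \<tau> x)"
      by (intro continuous_on_inner C2_on_continuous(1)[OF c(1)] smooth_continuous \<tau>)
    have "?f x = u x \<bullet> \<tau> x"
    proof (rule AE_eq_continuous_Icc[OF L _ cu _ x])
      show "continuous_on {0..L} ?f" by (intro continuous_on_max cu continuous_on_const)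
      show "AE x in circle. ?f x = u x \<bullet> \<tau> x"
      proof (rule AE_interior)
        fix x assume "0 < x" "x < L"
        then show "?f x = u x \<bullet> \<tau> x" using steep[OF t, of x] C2_on_dx[OF c(1)] by simp
      qed
    qed
    then show ?thesis by simp
  qed
  show ?thesis unfolding frame_def using c in1 in2 st by blast
qed

lemma frame_exists: "AE t in time. t \<in> {0..<T} \<and> (\<exists>u a c. frame t u a c)"
proof -
  have "AE t in time. t \<in> {0..<T}" by (rule AE_I2) simp
  with W3 show ?thesis by eventually_elim (use frame_exists_at in blast)
qed

lemma UA_measurable:
  assumes "w \<in> Wc L 2 p"
  shows "U w \<in> borel_measurable circle" "A w \<in> borel_measurable circle"
  unfolding U_def[abs_def] A_def[abs_def]
  using LpD(2)[OF W2_wderiv_Lp1[OF L assms]] LpD(2)[OF W2_wderiv_Lp[OF L assms]]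
    measurable_continuous_Icc[OF smooth_continuous[OF \<gamma>0_smooth(1)]]
    measurable_continuous_Icc[OF smooth_continuous[OF \<gamma>0_smooth(2)]]
  by auto

text \<open>
  Approximation in \<open>W\<^bsup>2,p\<^esup>\<close> means uniform approximation of tangents and \<open>L\<^sup>p\<close>-approximation of
  second derivatives.
\<close>
lemma frame_approx:
  assumes f: "frame t u a c" and t: "t \<in> {0..<T}" and w: "w \<in> Wc L 2 p"
  defines "N \<equiv> sobolev_norm L 2 p (\<lambda>x. \<phi> t x - w x)"
  shows "AE x in circle. norm (U w x - u x) \<le> sobolev_const L * N"
    and "integrable circle (\<lambda>x. norm (A w x - a x) powr p)"
    and "(\<integral>x. norm (A w x - a x) powr p \<partial>circle) \<le> N powr p"
proof -
  let ?d = "\<lambda>x. \<phi> t x - w x"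
  have p0: "p > 0" "p \<ge> 1" using p by auto
  note d = W2_diff[OF L p0(1) \<phi>_W2[OF t] w]
  note b = W2_bounds[OF L p0(2) d(1)]
  have u: "AE x in circle. U (\<phi> t) x = u x" and a: "AE x in circle. A (\<phi> t) x = a x"
    using f by (auto simp: frame_def)
  show "AE x in circle. norm (U w x - u x) \<le> sobolev_const L * N"
    using u d(2) b(1)
  proof eventually_elim
    case (elim x)
    have "U w x - u x = - wderiv L ?d x" using elim(1,2) by (simp add: U_def algebra_simps)
    then show ?case using elim(3) by (simp add: N_def)
  qed
  have ae: "AE x in circle. norm (wderiv L (wderiv L ?d) x) powr p = norm (A w x - a x) powr p"
    using a d(3)
  proof eventually_elim
    case (elim x)
    have "A w x - a x = - wderiv L (wderiv L ?d) x" using elim by (simp add: A_def algebra_simps)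
    then show ?case by simp
  qed
  show "integrable circle (\<lambda>x. norm (A w x - a x) powr p)"
    by (rule integrable_lebesgue_on_cong_AE[OF _ ae LpD(3)[OF W2_wderiv_Lp[OF L d(1)]]]) simp
  show "(\<integral>x. norm (A w x - a x) powr p \<partial>circle) \<le> N powr p"
    using b(2) integral_lebesgue_on_cong_AE[OF _ ae] by (simp add: N_def)
qed

lemma sobolev_norm_nonneg: "0 \<le> sobolev_norm L 2 p f"
  unfolding sobolev_norm_2 by (intro add_nonneg_nonneg Lp_norm_nonneg)

lemma simple_approximation:
  obtains s where "\<And>k. simple_into {0..<T} (Wc L 2 p) (s k)"
    "AE t in time. (\<lambda>k. sobolev_norm L 2 p (\<lambda>x. \<phi> t x - s k t x)) \<longlonglongrightarrow> 0"
  using \<phi>_Linfty unfolding Linfty_into_def bochner_measurable_def by blast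

text \<open>
  Uniform bounds for almost all times come from \<open>\<phi> \<in> L\<^sup>\<infinity>([0, T), W\<^bsup>2,p\<^esup>)\<close>.
\<close>
lemma bounded_frames:
  obtains R K where "R \<ge> 0" "K \<ge> 0"
    "AE t in time. t \<in> {0..<T} \<and> (\<exists>u a c. frame t u a c \<and> (\<forall>x\<in>{0..L}. norm (u x) \<le> R)
       \<and> (\<integral>x. norm (a x) powr p \<partial>circle) \<le> K)"
proof -
  obtain C where C: "AE t in time. sobolev_norm L 2 p (\<phi> t) \<le> C"
    using \<phi>_Linfty unfolding Linfty_into_def by blast
  obtain R0 where R0: "R0 \<ge> 0" "\<And>x. x \<in> {0..L} \<Longrightarrow> norm (dx \<gamma>0 x) \<le> R0"
    using continuous_bound_Icc[OF smooth_continuous[OF \<gamma>0_smooth(1)]] by blast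
  let ?dd = "dx (dx \<gamma>0)"
  have cdd: "continuous_on {0..L} (\<lambda>x. norm (?dd x) powr p)"
    using p by (intro continuous_on_powr' continuous_on_norm smooth_continuous \<gamma>0_smooth continuous_on_const) auto
  have sc: "sobolev_const L \<ge> 0" using L by (simp add: sobolev_const_def)
  define R where "R = R0 + sobolev_const L * \<bar>C\<bar>"
  define K where "K = 2 powr p * ((\<integral>x. norm (?dd x) powr p \<partial>circle) + \<bar>C\<bar> powr p)"
  have "AE t in time. t \<in> {0..<T} \<and> (\<exists>u a c. frame t u a c \<and> (\<forall>x\<in>{0..L}. norm (u x) \<le> R)
       \<and> (\<integral>x. norm (a x) powr p \<partial>circle) \<le> K)"
    using frame_exists C
  proof eventually_elim
    case (elim t)
    then obtain u a c where t: "t \<in> {0..<T}" and f: "frame t u a c" by blast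
    have N: "sobolev_norm L 2 p (\<phi> t) \<le> \<bar>C\<bar>" using elim by simp
    have p0: "p > 0" "p \<ge> 1" using p by auto
    note b = W2_bounds[OF L p0(2) \<phi>_W2[OF t]]
    have ua: "AE x in circle. U (\<phi> t) x = u x" "AE x in circle. A (\<phi> t) x = a x"
      and C2: "C2_on L (\<gamma> t) u a" using f by (auto simp: frame_def)
    have cu: "continuous_on {0..L} (\<lambda>x. norm (u x))"
      by (intro continuous_on_norm C2_on_continuous(1)[OF C2])
    have "norm (u x) \<le> R" if x: "x \<in> {0..L}" for x
    proof -
      have "AE x in circle. x \<in> {0..L}" by (rule AE_I2) simp
      with ua(1) b(1) have "AE x in circle. min (norm (u x)) R = norm (u x)"
      proof eventually_elim
        case (elim x)
        have "norm (u x) \<le> norm (dx \<gamma>0 x) + norm (wderiv L (\<phi> t) x)"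
          using elim(1) norm_triangle_ineq by (metis U_def)
        also have "\<dots> \<le> R0 + sobolev_const L * sobolev_norm L 2 p (\<phi> t)"
          using elim R0 by (intro add_mono) auto
        also have "\<dots> \<le> R" unfolding R_def using N sc by (intro add_mono mult_left_mono) auto
        finally show ?case by simp
      qed
      from AE_eq_continuous_Icc[OF L _ cu this x]
      have "min (norm (u x)) R = norm (u x)"
        using continuous_on_min[OF cu continuous_on_const] by blast
      then show ?thesis by simp
    qed
    moreover have "(\<integral>x. norm (a x) powr p \<partial>circle) \<le> K"
    proof -
      let ?ww = "wderiv L (wderiv L (\<phi> t))"
      have i: "integrable circle (\<lambda>x. norm (?ww x) powr p)" by (rule LpD(3)[OF W2_wderiv_Lp[OF L \<phi>_W2[OF t]]])
      have i2: "integrable circle (\<lambda>x. norm (?dd x) powr p)" by (rule integrable_lebesgue_on_continuous[OF cdd])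
      have ca: "continuous_on {0..L} (\<lambda>x. norm (a x) powr p)"
        using p by (intro continuous_on_powr' continuous_on_norm C2_on_continuous(2)[OF C2] continuous_on_const) auto
      have "(\<integral>x. norm (a x) powr p \<partial>circle) \<le> (\<integral>x. 2 powr p * (norm (?dd x) powr p + norm (?ww x) powr p) \<partial>circle)"
      proof (rule integral_mono_AE)
        show "AE x in circle. norm (a x) powr p \<le> 2 powr p * (norm (?dd x) powr p + norm (?ww x) powr p)"
          using ua(2)
        proof eventually_elim
          case (elim x)
          have "a x = ?dd x - (- ?ww x)" using elim by (simp add: A_def)
          then show ?case using norm_diff_powr_le[OF p0(1), of "?dd x" "- ?ww x"] by simp
        qed
      qed (use i i2 integrable_lebesgue_on_continuous[OF ca] in auto)
      also have "\<dots> = 2 powr p * ((\<integral>x. norm (?dd x) powr p \<partial>circle) + (\<integral>x. norm (?ww x) powr p \<partial>circle))"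
        using i i2 by simp
      also have "\<dots> \<le> K"
      proof -
        have "(\<integral>x. norm (?ww x) powr p \<partial>circle) \<le> \<bar>C\<bar> powr p"
          using b(2) powr_mono2[OF _ sobolev_norm_nonneg N, of p] p by linarith
        then show ?thesis unfolding K_def by (intro mult_left_mono add_left_mono) auto
      qed
      finally show ?thesis .
    qed
    ultimately show ?case using t f by blast
  qed
  moreover have "R \<ge> 0" using R0 sc by (simp add: R_def)
  moreover have "K \<ge> 0" by (simp add: K_def)
  ultimately show ?thesis using that by blast
qed

text \<open>
  The first variation of the energy at \<open>\<gamma>0 + w\<close> in direction \<open>X\<close>, as an integral that makes
  sense for every \<open>W\<^bsup>2,p\<^esup>\<close>-displacement \<open>w\<close>, in particular for the values of approximating
  simple functions.
\<close>
definition elastic :: "(real \<Rightarrow> 'a) \<Rightarrow> (real \<Rightarrow> 'a) \<Rightarrow> real" where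
  "elastic X w = (\<integral>x. ddensity p lam (U w x) (A w x) (dx X x) (dx (dx X) x) \<partial>circle)"

lemma elastic_frame:
  assumes "frame t u a c"
  shows "elastic X (\<phi> t) = (\<integral>x. ddensity p lam (u x) (a x) (dx X x) (dx (dx X) x) \<partial>circle)"
  unfolding elastic_def
proof (rule integral_lebesgue_on_cong_AE)
  have "AE x in circle. U (\<phi> t) x = u x" "AE x in circle. A (\<phi> t) x = a x"
    using assms by (auto simp: frame_def)
  then show "AE x in circle. ddensity p lam (U (\<phi> t) x) (A (\<phi> t) x) (dx X x) (dx (dx X) x)
      = ddensity p lam (u x) (a x) (dx X x) (dx (dx X) x)"
    by eventually_elim simp
qed simp

lemma first_variation_elastic:
  assumes f: "frame t u a c" and X: "smooth X" "periodic_fun_simple X L"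
  shows "first_variation L p lam X (\<gamma> t) = elastic X (\<phi> t)"
  unfolding elastic_frame[OF f]
  by (rule first_variation_C2[OF p L _ frame_steep(2)[OF f] C2_on_smooth[OF X]])
     (use f in \<open>auto simp: frame_def\<close>)

lemma simple_compose_measurable:
  fixes F :: "(real \<Rightarrow> 'a) \<Rightarrow> real"
  assumes "simple_into {0..<T} Y s"
  shows "(\<lambda>t. F (s t)) \<in> borel_measurable time"
proof -
  have "simple_function time s" using assms by (simp add: simple_into_def)
  from simple_function_compose1[OF this, of F] show ?thesis by (rule borel_measurable_simple_function)
qed

text \<open>
  Measurability in time: along simple functions that approximate \<open>\<phi>\<close> in \<open>W\<^bsup>2,p\<^esup>\<close> the
  functional takes finitely many values, and it converges at almost every time because the
  limit curve is regular and of class \<open>C\<^sup>2\<close>. The bound is the growth estimate. Integrability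
  matters: the integral of a non-integrable function is 0 by convention, and then the flow
  equation would carry no information.
\<close>
lemma elastic_integrable:
  assumes X: "smooth X" "periodic_fun_simple X L"
  shows "integrable time (\<lambda>t. elastic X (\<phi> t))"
proof -
  have sX: "smooth (dx X)" "smooth (dx (dx X))" using smooth_has_vector_derivative(2) X(1) by blast+
  obtain s where s: "\<And>k. simple_into {0..<T} (Wc L 2 p) (s k)"
    "AE t in time. (\<lambda>k. sobolev_norm L 2 p (\<lambda>x. \<phi> t x - s k t x)) \<longlonglongrightarrow> 0"
    using simple_approximation by blast
  have sW: "s k t \<in> Wc L 2 p" if "t \<in> {0..<T}" for k t using s(1)[of k] that by (auto simp: simple_into_def)
  have lim: "AE t in time. (\<lambda>k. elastic X (s k t)) \<longlonglongrightarrow> elastic X (\<phi> t)"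
    using frame_exists s(2)
  proof eventually_elim
    case (elim t)
    then obtain u a c where t: "t \<in> {0..<T}" and f: "frame t u a c" by blast
    then have C2: "C2_on L (\<gamma> t) u a" by (simp add: frame_def)
    let ?N = "\<lambda>k. sobolev_norm L 2 p (\<lambda>x. \<phi> t x - s k t x)"
    have N: "?N \<longlonglongrightarrow> 0" using elim by blast
    note ap = frame_approx[OF f t sW[OF t]]
    have Np: "(\<lambda>k. ?N k powr p) \<longlonglongrightarrow> 0"
      using N p by (intro tendsto_zero_powrI[where b = p] tendsto_const always_eventually) (auto simp: sobolev_norm_nonneg)
    show ?case
      unfolding elastic_frame[OF f] unfolding elastic_def
    proof (rule ddensity_integral_tendsto[OF p L, of "1 / 4" _ _ _ _ _ _ "\<lambda>k. sobolev_const L * ?N k"])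
      show "(\<lambda>k. sobolev_const L * ?N k) \<longlonglongrightarrow> 0" using tendsto_mult_right_zero[OF N] .
      show "(\<lambda>k. \<integral>x. norm (A (s k t) x - a x) powr p \<partial>circle) \<longlonglongrightarrow> 0"
        by (rule tendsto_sandwich[OF _ _ tendsto_const Np]) (use ap(3) in auto)
      show "2 * (1 / 4) \<le> norm (u x)" if "x \<in> {0..L}" for x using frame_steep(1)[OF f that] by simp
    qed (use ap UA_measurable[OF sW[OF t]] C2_on_continuous[OF C2] smooth_continuous[OF sX(1)] smooth_continuous[OF sX(2)] in auto)
  qed
  have meas: "(\<lambda>t. elastic X (\<phi> t)) \<in> borel_measurable time"
    by (rule measurable_AE_limit[OF _ simple_compose_measurable[OF s(1)] lim]) simp
  obtain R K where RK: "R \<ge> 0" "K \<ge> 0"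
    "AE t in time. t \<in> {0..<T} \<and> (\<exists>u a c. frame t u a c \<and> (\<forall>x\<in>{0..L}. norm (u x) \<le> R)
       \<and> (\<integral>x. norm (a x) powr p \<partial>circle) \<le> K)"
    using bounded_frames by blast
  obtain M1 where M1: "M1 \<ge> 0" "\<And>x. x \<in> {0..L} \<Longrightarrow> norm (dx X x) \<le> M1"
    using continuous_bound_Icc[OF smooth_continuous[OF sX(1)]] by blast
  obtain M2 where M2: "M2 \<ge> 0" "\<And>x. x \<in> {0..L} \<Longrightarrow> norm (dx (dx X) x) \<le> M2"
    using continuous_bound_Icc[OF smooth_continuous[OF sX(2)]] by blast
  have h: "(1 / 2::real) > 0" "max M1 M2 \<ge> 0" using M1 by auto
  obtain C where C: "C \<ge> 0" "\<And>u a v b::'a. 1 / 2 \<le> norm u \<Longrightarrow> norm u \<le> R \<Longrightarrow>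
    norm v \<le> max M1 M2 \<Longrightarrow> norm b \<le> max M1 M2 \<Longrightarrow> \<bar>ddensity p lam u a v b\<bar> \<le> C * (1 + norm a powr p)"
    using ddensity_growth[OF p h] by metis
  have "AE t in time. norm (elastic X (\<phi> t)) \<le> C * (L + K)"
    using RK(3)
  proof eventually_elim
    case (elim t)
    then obtain u a c where f: "frame t u a c" and R: "\<And>x. x \<in> {0..L} \<Longrightarrow> norm (u x) \<le> R"
      and K: "(\<integral>x. norm (a x) powr p \<partial>circle) \<le> K" by blast
    have C2: "C2_on L (\<gamma> t) u a" using f by (simp add: frame_def)
    have ca: "continuous_on {0..L} (\<lambda>x. norm (a x) powr p)"
      using p by (intro continuous_on_powr' continuous_on_norm C2_on_continuous(2)[OF C2] continuous_on_const) auto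
    have ia: "integrable circle (\<lambda>x. norm (a x) powr p)" by (rule integrable_lebesgue_on_continuous[OF ca])
    let ?f = "\<lambda>x. ddensity p lam (u x) (a x) (dx X x) (dx (dx X) x)"
    have fi: "integrable circle ?f"
      by (intro integrable_lebesgue_on_continuous continuous_ddensity[OF p] C2_on_continuous[OF C2]
          smooth_continuous sX frame_steep(2)[OF f])
    have "\<bar>\<integral>x. ?f x \<partial>circle\<bar> \<le> (\<integral>x. \<bar>?f x\<bar> \<partial>circle)" by (rule integral_abs_bound)
    also have "\<dots> \<le> (\<integral>x. C * (1 + norm (a x) powr p) \<partial>circle)"
    proof (rule integral_mono)
      show "integrable circle (\<lambda>x. C * (1 + norm (a x) powr p))" using ia integrable_const_Icc by auto
      fix x assume "x \<in> space circle"
      then have x: "x \<in> {0..L}" by simp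
      show "\<bar>?f x\<bar> \<le> C * (1 + norm (a x) powr p)"
        by (rule C(2)) (use frame_steep(1)[OF f x] R[OF x] M1(2)[OF x] M2(2)[OF x] in auto)
    qed (use fi in auto)
    also have "\<dots> = C * (L *\<^sub>R 1 + (\<integral>x. norm (a x) powr p \<partial>circle))"
      unfolding integral_const_Icc[OF less_imp_le[OF L], symmetric] integral_mult_right_zero
      by (subst Bochner_Integration.integral_add[OF integrable_const_Icc ia]) simp
    also have "\<dots> \<le> C * (L + K)" using K C(1) by (intro mult_left_mono) auto
    finally show ?case by (simp add: elastic_frame[OF f])
  qed
  then show ?thesis by (rule finite_measure.integrable_const_bound[OF finite_time _ meas])
qed

text \<open>
  The space integral on the left-hand side of the flow equation, for velocity \<open>V\<close> and
  displacement \<open>w\<close>.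
\<close>
definition friction :: "(real \<Rightarrow> 'a) \<Rightarrow> (real \<Rightarrow> 'a) \<Rightarrow> (real \<Rightarrow> 'a) \<Rightarrow> real" where
  "friction X V w = (\<integral>x. V x \<bullet> nproj (U w x) (X x) \<partial>circle)"

lemma friction_frame:
  assumes "frame t u a c"
  shows "friction X V (\<phi> t) = (\<integral>x. V x \<bullet> nproj (u x) (X x) \<partial>circle)"
  unfolding friction_def
proof (rule integral_lebesgue_on_cong_AE)
  have "AE x in circle. U (\<phi> t) x = u x" using assms by (auto simp: frame_def)
  then show "AE x in circle. V x \<bullet> nproj (U (\<phi> t) x) (X x) = V x \<bullet> nproj (u x) (X x)"
    by eventually_elim simp
qed simp

text \<open>
  As for the energy term, now with simple approximations of both the velocity and the
  displacement. The bound is linear in the \<open>L\<^sup>2\<close>-norm of the velocity, which is square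
  integrable in time.
\<close>
lemma friction_integrable:
  assumes V: "V \<in> L2_into {0..<T} (Lp L 2) (Lp_norm L 2)"
    and X: "smooth X" "periodic_fun_simple X L"
  shows "integrable time (\<lambda>t. friction X (V t) (\<phi> t))"
proof -
  have two: "(2::real) \<ge> 1" "(2::real) > 0" by auto
  obtain s where s: "\<And>k. simple_into {0..<T} (Wc L 2 p) (s k)"
    "AE t in time. (\<lambda>k. sobolev_norm L 2 p (\<lambda>x. \<phi> t x - s k t x)) \<longlonglongrightarrow> 0"
    using simple_approximation by blast
  have sW: "s k t \<in> Wc L 2 p" if "t \<in> {0..<T}" for k t using s(1)[of k] that by (auto simp: simple_into_def)
  obtain vs where vs: "\<And>k. simple_into {0..<T} (Lp L 2) (vs k)"
    "AE t in time. (\<lambda>k. Lp_norm L 2 (\<lambda>x. V t x - vs k t x)) \<longlonglongrightarrow> 0"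
    using V unfolding L2_into_def bochner_measurable_def by blast
  have vL: "vs k t \<in> Lp L 2" if "t \<in> {0..<T}" for k t using vs(1)[of k] that by (auto simp: simple_into_def)
  have VL: "V t \<in> Lp L 2" if "t \<in> {0..<T}" for t
    using V that by (auto simp: L2_into_def bochner_measurable_def)
  have cX: "continuous_on {0..L} X" by (rule smooth_continuous[OF X(1)])
  have lim: "AE t in time. (\<lambda>k. friction X (vs k t) (s k t)) \<longlonglongrightarrow> friction X (V t) (\<phi> t)"
    using frame_exists s(2) vs(2)
  proof eventually_elim
    case (elim t)
    then obtain u a c where t: "t \<in> {0..<T}" and f: "frame t u a c" by blast
    then have C2: "C2_on L (\<gamma> t) u a" by (simp add: frame_def)
    let ?N = "\<lambda>k. sobolev_norm L 2 p (\<lambda>x. \<phi> t x - s k t x)"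
    have N: "?N \<longlonglongrightarrow> 0" using elim by blast
    note ap = frame_approx[OF f t sW[OF t]]
    have d: "(\<lambda>x. V t x - vs k t x) \<in> Lp L 2" for k by (rule Lp_diff[OF VL[OF t] vL[OF t] two(2)])
    have l1: "(\<integral>x. norm (V t x - vs k t x) \<partial>circle) \<le> (L + 1) * Lp_norm L 2 (\<lambda>x. V t x - vs k t x)" for k
      by (rule L1_le_Lp_norm[OF L LpD(2,3)[OF d] two(1)])
    have z: "(\<lambda>k. (L + 1) * Lp_norm L 2 (\<lambda>x. V t x - vs k t x)) \<longlonglongrightarrow> 0"
      using elim by (intro tendsto_mult_right_zero) auto
    show ?case
      unfolding friction_frame[OF f] unfolding friction_def
    proof (rule velocity_integral_tendsto[OF L, of "1 / 4" _ _ _ "\<lambda>k. sobolev_const L * ?N k"])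
      show "(\<lambda>k. sobolev_const L * ?N k) \<longlonglongrightarrow> 0" using tendsto_mult_right_zero[OF N] .
      show "(\<lambda>k. \<integral>x. norm (V t x - vs k t x) \<partial>circle) \<longlonglongrightarrow> 0"
        by (rule tendsto_sandwich[OF _ _ tendsto_const z]) (use l1 in auto)
      show "2 * (1 / 4) \<le> norm (u x)" if "x \<in> {0..L}" for x using frame_steep(1)[OF f that] by simp
      show "integrable circle (V t)" by (rule L1_of_Lp[OF LpD(2,3)[OF VL[OF t]] two(1)])
      show "integrable circle (vs k t)" for k by (rule L1_of_Lp[OF LpD(2,3)[OF vL[OF t]] two(1)])
    qed (use ap UA_measurable[OF sW[OF t]] C2_on_continuous[OF C2] cX in auto)
  qed
  have simp_pair: "(\<lambda>t. friction X (vs k t) (s k t)) \<in> borel_measurable time" for k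
  proof -
    have "simple_function time (vs k)" "simple_function time (s k)"
      using s(1)[of k] vs(1)[of k] by (auto simp: simple_into_def)
    from simple_function_compose2[OF this, of "friction X"] show ?thesis
      by (rule borel_measurable_simple_function)
  qed
  have meas: "(\<lambda>t. friction X (V t) (\<phi> t)) \<in> borel_measurable time"
    by (rule measurable_AE_limit[OF _ simp_pair lim]) simp
  obtain R K where RK: "R \<ge> 0" "K \<ge> 0"
    "AE t in time. t \<in> {0..<T} \<and> (\<exists>u a c. frame t u a c \<and> (\<forall>x\<in>{0..L}. norm (u x) \<le> R)
       \<and> (\<integral>x. norm (a x) powr p \<partial>circle) \<le> K)"
    using bounded_frames by blast
  obtain M where M: "M \<ge> 0" "\<And>x. x \<in> {0..L} \<Longrightarrow> norm (X x) \<le> M" using continuous_bound_Icc[OF cX] by blast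
  define C where "C = 2 * R * M * (L + 1)"
  have C: "C \<ge> 0" using RK M L by (simp add: C_def)
  show ?thesis
  proof (rule Bochner_Integration.integrable_bound[OF _ meas])
    show "integrable time (\<lambda>t. C * (1 + (Lp_norm L 2 (V t))\<^sup>2))"
      using V finite_measure.integrable_const[OF finite_time, of "1::real"]
      by (auto simp: L2_into_def)
    show "AE t in time. norm (friction X (V t) (\<phi> t)) \<le> norm (C * (1 + (Lp_norm L 2 (V t))\<^sup>2))"
      using RK(3)
    proof eventually_elim
      case (elim t)
      then obtain u a c where f: "frame t u a c" and R: "\<And>x. x \<in> {0..L} \<Longrightarrow> norm (u x) \<le> R"
        and t: "t \<in> {0..<T}" by blast
      let ?n = "Lp_norm L 2 (V t)"
      have Vi: "integrable circle (V t)" by (rule L1_of_Lp[OF LpD(2,3)[OF VL[OF t]] two(1)])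
      have C2: "C2_on L (\<gamma> t) u a" using f by (simp add: frame_def)
      have "norm (\<integral>x. V t x \<bullet> nproj (u x) (X x) \<partial>circle) \<le> (\<integral>x. 2 * R * M * norm (V t x) \<partial>circle)"
      proof (rule Bochner_Integration.integral_norm_bound_integral)
        show "integrable circle (\<lambda>x. V t x \<bullet> nproj (u x) (X x))"
          by (rule friction_integrand_integrable[OF Vi C2_on_continuous(1)[OF C2] cX frame_steep(2)[OF f]])
        show "integrable circle (\<lambda>x. 2 * R * M * norm (V t x))" using Vi by auto
        show "norm (V t x \<bullet> nproj (u x) (X x)) \<le> 2 * R * M * norm (V t x)" if "x \<in> space circle" for x
          using inner_nproj_bound[OF R[of x] M(2)[of x], of "V t x"] that by simp
      qed
      also have "\<dots> = 2 * R * M * (\<integral>x. norm (V t x) \<partial>circle)" by simp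
      also have "\<dots> \<le> 2 * R * M * ((L + 1) * ?n)"
        using RK(1) M(1) by (intro mult_left_mono L1_le_Lp_norm[OF L LpD(2,3)[OF VL[OF t]] two(1)]) auto
      also have "\<dots> = C * ?n" by (simp add: C_def)
      also have "\<dots> \<le> C * (1 + ?n\<^sup>2)"
      proof (rule mult_left_mono[OF _ C])
        have "0 \<le> (?n - 1 / 2)\<^sup>2" by simp
        then show "?n \<le> 1 + ?n\<^sup>2" by (simp add: power2_eq_square algebra_simps)
      qed
      finally show ?case using C by (simp add: friction_frame[OF f] abs_mult)
    qed
  qed
qed

end

section \<open>Smoothness of the quasi-tangent\<close>

text \<open>
  Since the curve itself is smooth, all derivatives may fall on the curve and none on the
  mollifier.
\<close>
lemma mollify_has_vector_derivative:
  fixes \<beta> :: "real \<Rightarrow> 'a::euclidean_space"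
  assumes \<eta>: "mollifier \<eta>" and e: "e > 0" and \<beta>: "smooth \<beta>"
  shows "(mollify \<eta> e \<beta> has_vector_derivative mollify \<eta> e (dx \<beta>) x) (at x)"
proof -
  let ?k = "\<lambda>y. 1 / e * \<eta> (y / e)"
  have s\<eta>: "continuous_on UNIV \<eta>" and z: "\<And>x. \<bar>x\<bar> \<ge> 1 \<Longrightarrow> \<eta> x = 0"
    using \<eta> by (auto simp: mollifier_def smooth_continuous)
  have ck: "continuous_on S ?k" for S
    by (intro continuous_intros continuous_on_compose2[OF s\<eta>]) (use e in auto)
  have conv: "mollify \<eta> e f x = integral (cbox (- e) e) (\<lambda>y. ?k y *\<^sub>R f (x - y))"
    if f: "smooth f" for f :: "real \<Rightarrow> 'a" and x
  proof -
    have c: "continuous_on {- e..e} (\<lambda>y. ?k y *\<^sub>R f (x - y))"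
      by (intro continuous_on_scaleR ck continuous_on_compose2[OF smooth_continuous[OF f, of UNIV]] continuous_intros) auto
    have "(\<lambda>y. ?k y *\<^sub>R f (x - y)) = (\<lambda>y. if y \<in> {- e..e} then ?k y *\<^sub>R f (x - y) else 0)"
    proof
      fix y
      have "\<eta> (y / e) = 0" if "y \<notin> {- e..e}"
        by (rule z) (use that e in \<open>auto simp: abs_if field_simps not_le\<close>)
      then show "?k y *\<^sub>R f (x - y) = (if y \<in> {- e..e} then ?k y *\<^sub>R f (x - y) else 0)" by simp
    qed
    then have "mollify \<eta> e f x = (\<integral>y. (if y \<in> {- e..e} then ?k y *\<^sub>R f (x - y) else 0) \<partial>lebesgue)"
      unfolding mollify_def by (rule arg_cong[where f = "integral\<^sup>L lebesgue"])
    also have "\<dots> = (\<integral>y. ?k y *\<^sub>R f (x - y) \<partial>lebesgue_on {- e..e})"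
      by (rule Lebesgue_Measure.integral_restrict_UNIV) simp
    also have "\<dots> = integral {- e..e} (\<lambda>y. ?k y *\<^sub>R f (x - y))"
      by (rule integral_lebesgue_on_eq_HK[OF integrable_lebesgue_on_continuous[OF c]])
    finally show ?thesis by simp
  qed
  have "((\<lambda>x. integral (cbox (- e) e) (\<lambda>y. ?k y *\<^sub>R \<beta> (x - y))) has_vector_derivative
      integral (cbox (- e) e) (\<lambda>y. ?k y *\<^sub>R dx \<beta> (x - y))) (at x within UNIV)"
  proof (rule leibniz_rule_vector_derivative)
    fix x y :: real
    have "((\<lambda>x. x - y) has_real_derivative 1) (at x)" by (auto intro!: derivative_eq_intros)
    from vector_diff_chain_at[OF this[unfolded has_real_derivative_iff_has_vector_derivative]
        smooth_has_vector_derivative(1)[OF \<beta>]]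
    have "((\<lambda>x. \<beta> (x - y)) has_vector_derivative dx \<beta> (x - y)) (at x)" by (simp add: o_def)
    then show "((\<lambda>x. ?k y *\<^sub>R \<beta> (x - y)) has_vector_derivative ?k y *\<^sub>R dx \<beta> (x - y)) (at x within UNIV)"
      by (auto intro!: derivative_eq_intros)
  next
    fix x
    show "(\<lambda>y. ?k y *\<^sub>R \<beta> (x - y)) integrable_on cbox (- e) e"
      by (intro integrable_continuous continuous_on_scaleR ck
          continuous_on_compose2[OF smooth_continuous[OF \<beta>, of UNIV]] continuous_intros) auto
  next
    have "continuous_on (UNIV \<times> cbox (- e) e) (\<lambda>z. ?k (snd z) *\<^sub>R dx \<beta> (fst z - snd z))"
      by (intro continuous_on_scaleR continuous_on_compose2[OF ck[of UNIV]]
          continuous_on_compose2[OF smooth_continuous[OF smooth_has_vector_derivative(2)[OF \<beta>], of UNIV]] continuous_intros) auto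
    then show "continuous_on (UNIV \<times> cbox (- e) e) (\<lambda>(x, y). ?k y *\<^sub>R dx \<beta> (x - y))"
      by (simp add: case_prod_beta')
  qed auto
  then show ?thesis
    by (simp only: conv[OF \<beta>, symmetric] conv[OF smooth_has_vector_derivative(2)[OF \<beta>], symmetric])
qed

lemma mollify_smooth:
  fixes \<beta> :: "real \<Rightarrow> 'a::euclidean_space"
  assumes \<eta>: "mollifier \<eta>" and e: "e > 0" and \<beta>: "smooth \<beta>"
  shows "smooth (mollify \<eta> e \<beta>)"
proof -
  have "Ck k (mollify \<eta> e \<beta>)" if "smooth \<beta>" for k and \<beta> :: "real \<Rightarrow> 'a"
    using that
  proof (induction k arbitrary: \<beta>)
    case 0
    have "isCont (mollify \<eta> e \<beta>) x" for x
      using mollify_has_vector_derivative[OF \<eta> e 0] by (rule has_vector_derivative_continuous)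
    then show ?case by (simp add: continuous_at_imp_continuous_on)
  next
    case (Suc k)
    show ?case
      by (rule Ck_Suc_vector_derivative[OF mollify_has_vector_derivative[OF \<eta> e Suc.prems]])
         (rule Suc.IH[OF smooth_has_vector_derivative(2)[OF Suc.prems]])
  qed
  then show ?thesis using \<beta> by (simp add: smooth_def)
qed

text \<open>
  The curve belongs to the class for which the scale of mollification is admissible, so the
  derivative of its mollification never vanishes and can be normalised.
\<close>
lemma quasi_tangent_smooth:
  fixes \<gamma>0 \<tau> :: "real \<Rightarrow> 'a::euclidean_space"
  assumes L: "L > 0" and \<eta>: "mollifier \<eta>" and \<gamma>0: "smooth \<gamma>0" "periodic_fun_simple \<gamma>0 L"
    and q: "unit_quasi_tangent \<eta> p L \<gamma>0 \<tau>"
  shows "smooth \<tau>" "periodic_fun_simple \<tau> L" "norm (\<tau> x) = 1"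
proof -
  define \<beta> where "\<beta> x = \<gamma>0 (L * x) /\<^sub>R L" for x
  obtain M e where e: "e > 0" and \<beta>M: "\<beta> \<in> unit_length_curves p M"
    and nz: "\<forall>\<beta> \<in> (unit_length_curves p M :: (real \<Rightarrow> 'a) set). \<forall>x.
           dx (mollify \<eta> e \<beta>) x \<noteq> 0 \<and> norm (unit_tangent (mollify \<eta> e \<beta>) x - dx \<beta> x) \<le> 1 / 4"
    and t: "(\<lambda>x. \<tau> (L * x)) = unit_tangent (mollify \<eta> e \<beta>)"
    using q unfolding unit_quasi_tangent_def unit_length_quasi_tangent_def \<beta>_def[symmetric, abs_def] by blast
  define m where "m = dx (mollify \<eta> e \<beta>)"
  have m0: "m x \<noteq> 0" for x using nz \<beta>M by (simp add: m_def)
  have bl: "bounded_linear (\<lambda>x::real. L * x)" by (rule bounded_linear_mult_right)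
  have s\<beta>: "smooth \<beta>"
    unfolding smooth_def \<beta>_def[abs_def]
  proof
    fix k
    have "Ck k (\<lambda>x. \<gamma>0 (0 + L * x))"
      by (rule Ck_affine[OF bl]) (use \<gamma>0(1) in \<open>simp add: smooth_def\<close>)
    then have "Ck k (\<lambda>x. \<gamma>0 (L * x))" by simp
    then show "Ck k (\<lambda>x. \<gamma>0 (L * x) /\<^sub>R L)"
      by (rule Ck_bounded_linear[OF bounded_linear_scaleR_right])
  qed
  have sm: "smooth m" unfolding m_def
    by (rule smooth_has_vector_derivative(2)[OF mollify_smooth[OF \<eta> e s\<beta>]])
  have T: "\<tau> (L * x) = (m x \<bullet> m x) powr (- 1 / 2) *\<^sub>R m x" for x
  proof -
    have "inverse (norm (m x)) = (m x \<bullet> m x) powr (- 1 / 2)"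
      using m0[of x] by (simp add: norm_eq_sqrt_inner powr_minus powr_half_sqrt)
    moreover have "\<tau> (L * x) = m x /\<^sub>R norm (m x)"
      using fun_cong[OF t, of x] by (simp add: unit_tangent_def m_def)
    ultimately show ?thesis by simp
  qed
  have \<tau>m: "\<tau> y = (m (y / L) \<bullet> m (y / L)) powr (- 1 / 2) *\<^sub>R m (y / L)" for y
    using T[of "y / L"] L by simp
  show "norm (\<tau> x) = 1"
  proof -
    have "\<tau> (L * (x / L)) = m (x / L) /\<^sub>R norm (m (x / L))"
      using fun_cong[OF t, of "x / L"] by (simp only: unit_tangent_def m_def)
    then show ?thesis using m0[of "x / L"] L by simp
  qed
  have sT: "smooth (\<lambda>x. (m x \<bullet> m x) powr (- 1 / 2) *\<^sub>R m x)"
    by (intro smooth_scaleR smooth_powr smooth_inner sm) (use m0 in simp)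
  show "smooth \<tau>"
    unfolding smooth_def
  proof
    fix k
    have "Ck k (\<lambda>x. (\<lambda>x. (m x \<bullet> m x) powr (- 1 / 2) *\<^sub>R m x) (0 + x / L))"
      by (rule Ck_affine[OF bounded_linear_divide]) (use sT in \<open>simp only: smooth_def\<close>)
    then show "Ck k \<tau>" by (simp add: \<tau>m[abs_def])
  qed
  have p\<beta>: "\<beta> (x + 1) = \<beta> x" for x
    using periodic_fun_simple.plus_period[OF \<gamma>0(2), of "L * x"] by (simp add: \<beta>_def algebra_simps)
  have "mollify \<eta> e \<beta> (x + 1) = mollify \<eta> e \<beta> x" for x
  proof -
    have "\<beta> (x + 1 - y) = \<beta> (x - y)" for y using p\<beta>[of "x - y"] by (simp add: algebra_simps)
    then show ?thesis by (simp add: mollify_def)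
  qed
  then have "periodic_fun_simple (mollify \<eta> e \<beta>) 1" by (simp add: periodic_fun_simple_def)
  then have "periodic_fun_simple m 1" unfolding m_def by (rule dx_periodic)
  then have pm: "m (x + 1) = m x" for x by (simp add: periodic_fun_simple_def)
  show "periodic_fun_simple \<tau> L"
  proof
    fix x
    have "(x + L) / L = x / L + 1" using L by (simp add: field_simps)
    then show "\<tau> (x + L) = \<tau> x" unfolding \<tau>m by (simp add: pm)
  qed
qed

section \<open>Test functions in time\<close>

lemma integrable_Ico_extend:
  fixes f :: "real \<Rightarrow> 'a::euclidean_space"
  assumes f: "integrable (lebesgue_on {0..<T}) f"
  shows "integrable (lebesgue_on {0..T}) (\<lambda>t. if t \<in> {0..<T} then f t else 0)"
    and "(\<integral>t. (if t \<in> {0..<T} then f t else 0) \<partial>lebesgue_on {0..T}) = (\<integral>t. f t \<partial>lebesgue_on {0..<T})"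
proof -
  let ?F = "\<lambda>t. if t \<in> {0..<T} then f t else 0"
  have "integrable lebesgue ?F" using f by (subst Lebesgue_Measure.integrable_restrict_UNIV) auto
  moreover have "?F = (\<lambda>t. if t \<in> {0..T} then ?F t else 0)" by auto
  ultimately have "integrable lebesgue (\<lambda>t. if t \<in> {0..T} then ?F t else 0)" by (simp only:)
  then show "integrable (lebesgue_on {0..T}) ?F" by (subst (asm) Lebesgue_Measure.integrable_restrict_UNIV) auto
  show "(\<integral>t. ?F t \<partial>lebesgue_on {0..T}) = (\<integral>t. f t \<partial>lebesgue_on {0..<T})"
    by (rule integral_restrict) auto
qed

lemma integrable_Ico_restrict:
  fixes f :: "real \<Rightarrow> 'a::euclidean_space"
  assumes f: "integrable (lebesgue_on {0..T}) f"
  shows "integrable (lebesgue_on {0..<T}) f"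
proof -
  have "f absolutely_integrable_on {0..T}"
    using f by (simp add: set_integrable_def integrable_restrict_space)
  then have "f absolutely_integrable_on {0..<T}" by (rule set_integrable_subset) auto
  then show ?thesis by (rule absolutely_integrable_imp_integrable) simp
qed

text \<open>
  Products of two rescaled smooth steps converge to the indicator of \<open>[a, b] \<subseteq> (0, T)\<close>, so the
  integral over every such interval vanishes.
\<close>
lemma AE_zero_by_time_tests:
  fixes f :: "real \<Rightarrow> real"
  assumes \<eta>: "mollifier \<eta>" and T: "T > 0" and f: "integrable (lebesgue_on {0..<T}) f"
    and t: "\<And>\<zeta>::real \<Rightarrow> real. smooth \<zeta> \<Longrightarrow> closure {t. \<zeta> t \<noteq> 0} \<subseteq> {0<..<T} \<Longrightarrow>
      (\<integral>t. \<zeta> t * f t \<partial>lebesgue_on {0..<T}) = 0"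
  shows "AE t in lebesgue_on {0..<T}. f t = 0"
proof -
  let ?M = "lebesgue_on {0..T}"
  define F where "F t = (if t \<in> {0..<T} then f t else 0)" for t
  have Fi: "integrable ?M F" unfolding F_def by (rule integrable_Ico_extend(1)[OF f])
  obtain S :: "real \<Rightarrow> real" where S: "smooth S" "\<And>x. x \<le> -1 \<Longrightarrow> S x = 0" "\<And>x. x \<ge> 1 \<Longrightarrow> S x = 1"
    "\<And>x. \<bar>S x\<bar> \<le> 1"
    using smooth_step_exists[OF \<eta>] by blast
  have sub: "integral {a..b} F = 0" if ab: "0 < a" "a < b" "b < T" for a b
  proof -
    define \<zeta> where "\<zeta> n t = S (real n * (t - a) - 1) * S (real n * (b - t) - 1)" for n :: nat and t
    have supp: "{t. \<zeta> n t \<noteq> 0} \<subseteq> {a..b}" for n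
    proof
      fix t assume "t \<in> {t. \<zeta> n t \<noteq> 0}"
      then have "S (real n * (t - a) - 1) \<noteq> 0" "S (real n * (b - t) - 1) \<noteq> 0" by (auto simp: \<zeta>_def)
      then have "\<not> real n * (t - a) \<le> 0" "\<not> real n * (b - t) \<le> 0"
        using S(2)[of "real n * (t - a) - 1"] S(2)[of "real n * (b - t) - 1"] by auto
      then show "t \<in> {a..b}" by (auto simp: mult_le_0_iff)
    qed
    have clos: "closure {t. \<zeta> n t \<noteq> 0} \<subseteq> {0<..<T}" for n
      using closure_minimal[OF supp[of n]] ab by force
    have sm: "smooth (\<zeta> n)" for n
      unfolding \<zeta>_def
      by (intro smooth_mult smooth_compose_real[OF S(1)] smooth_diff smooth_const smooth_ident)
    have lim: "(\<lambda>n. \<zeta> n t) \<longlonglongrightarrow> (if t \<in> {a..b} then 1 else 0)" if ne: "t \<noteq> a" "t \<noteq> b" for t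
    proof (cases "t \<in> {a..b}")
      case False
      then have "\<zeta> n t = 0" for n using supp[of n] by auto
      then show ?thesis using False by (simp only: if_False tendsto_const)
    next
      case True
      then have pos: "t - a > 0" "b - t > 0" using ne by auto
      have "\<forall>\<^sub>F n in sequentially. real n \<ge> 2 / (t - a)" "\<forall>\<^sub>F n in sequentially. real n \<ge> 2 / (b - t)"
        by (simp_all add: eventually_ge_at_top filterlim_real_sequentially filterlim_at_top[THEN iffD1, rule_format])
      then have "\<forall>\<^sub>F n in sequentially. \<zeta> n t = 1"
      proof eventually_elim
        case (elim n)
        have "real n * (t - a) \<ge> 2" "real n * (b - t) \<ge> 2"
          using elim pos by (auto simp: pos_divide_le_eq)
        then show ?case using S(3) by (simp add: \<zeta>_def)
      qed
      then show ?thesis using True by (simp add: tendsto_eventually)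
    qed
    have m: "(\<lambda>t. if t \<in> {a..b} then F t else 0) \<in> borel_measurable ?M"
    proof (rule measurable_If_set)
      have "{a..b} \<inter> space ?M = {a..b}" using ab by auto
      moreover have "{a..b} \<in> sets ?M" using ab by (simp add: sets_restrict_space_iff)
      ultimately show "{a..b} \<inter> space ?M \<in> sets ?M" by (simp only:)
    qed (use Fi in auto)
    have "(\<lambda>n. \<integral>t. \<zeta> n t * F t \<partial>?M) \<longlonglongrightarrow> (\<integral>t. (if t \<in> {a..b} then F t else 0) \<partial>?M)"
    proof (rule integral_dominated_convergence[where w = "\<lambda>t. norm (F t)"])
      show "(\<lambda>t. \<zeta> n t * F t) \<in> borel_measurable ?M" for n
        using measurable_continuous_Icc[OF smooth_continuous[OF sm[of n]]] Fi by auto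
      have "AE t in lebesgue. t \<notin> {a, b}" by (intro AE_not_in) simp
      then have "AE t in lebesgue. (\<lambda>n. \<zeta> n t * F t) \<longlonglongrightarrow> (if t \<in> {a..b} then F t else 0)"
      proof eventually_elim
        case (elim t)
        then have "(\<lambda>n. \<zeta> n t * F t) \<longlonglongrightarrow> (if t \<in> {a..b} then 1 else 0) * F t"
          by (intro tendsto_mult[OF lim tendsto_const]) auto
        moreover have "(if t \<in> {a..b} then 1 else 0) * F t = (if t \<in> {a..b} then F t else 0)" by auto
        ultimately show ?case by (simp only:)
      qed
      then show "AE t in ?M. (\<lambda>n. \<zeta> n t * F t) \<longlonglongrightarrow> (if t \<in> {a..b} then F t else 0)"
        by (simp add: AE_restrict_space_iff) (auto elim: eventually_mono)
      show "AE t in ?M. norm (\<zeta> n t * F t) \<le> norm (F t)" for n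
      proof (rule AE_I2)
        fix t
        have "\<bar>\<zeta> n t\<bar> \<le> 1" unfolding \<zeta>_def abs_mult using S(4) by (intro mult_le_one) auto
        then show "norm (\<zeta> n t * F t) \<le> norm (F t)" by (simp add: abs_mult mult_left_le_one_le)
      qed
    qed (use Fi m in auto)
    moreover have "(\<integral>t. \<zeta> n t * F t \<partial>?M) = 0" for n
    proof -
      have i: "integrable (lebesgue_on {0..<T}) (\<lambda>t. \<zeta> n t * f t)"
      proof (rule Bochner_Integration.integrable_bound[OF f])
        have "\<zeta> n \<in> borel_measurable (lebesgue_on {0..<T})"
          using integrable_Ico_restrict[OF integrable_lebesgue_on_continuous[OF smooth_continuous[OF sm[of n]]]]
          by (rule borel_measurable_integrable)
        then show "(\<lambda>t. \<zeta> n t * f t) \<in> borel_measurable (lebesgue_on {0..<T})" using f by auto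
        show "AE t in lebesgue_on {0..<T}. norm (\<zeta> n t * f t) \<le> norm (f t)"
        proof (rule AE_I2)
          fix t
          have "\<bar>\<zeta> n t\<bar> \<le> 1" unfolding \<zeta>_def abs_mult using S(4) by (intro mult_le_one) auto
          then show "norm (\<zeta> n t * f t) \<le> norm (f t)" by (simp add: abs_mult mult_left_le_one_le)
        qed
      qed
      have "(\<integral>t. \<zeta> n t * F t \<partial>?M) = (\<integral>t. (if t \<in> {0..<T} then \<zeta> n t * f t else 0) \<partial>?M)"
        by (rule Bochner_Integration.integral_cong) (auto simp: F_def)
      also have "\<dots> = (\<integral>t. \<zeta> n t * f t \<partial>lebesgue_on {0..<T})" by (rule integrable_Ico_extend(2)[OF i])
      also have "\<dots> = 0" by (rule t[OF sm clos])
      finally show ?thesis .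
    qed
    ultimately have "(\<integral>t. (if t \<in> {a..b} then F t else 0) \<partial>?M) = 0"
      using LIMSEQ_unique[OF _ tendsto_const] by (simp only:)
    moreover have "(\<integral>t. (if t \<in> {a..b} then F t else 0) \<partial>?M) = integral\<^sup>L (lebesgue_on {a..b}) F"
      using ab by (intro integral_restrict) auto
    moreover have "integrable (lebesgue_on {a..b}) F"
      by (rule Equivalence_Lebesgue_Henstock_Integration.integrable_subinterval[OF Fi]) (use ab in auto)
    ultimately show ?thesis by (simp add: integral_lebesgue_on_eq_HK)
  qed
  define G where "G y = integral {0..y} F" for y
  have cG: "continuous_on {0..T} G"
    unfolding G_def using Fi by (intro indefinite_integral_continuous_1 integrable_on_lebesgue_on) auto
  have Gab: "G b = G a" if "0 < a" "a < b" "b < T" for a b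
  proof -
    have "integral {0..a} F + integral {a..b} F = integral {0..b} F"
      by (intro Henstock_Kurzweil_Integration.integral_combine integrable_on_subinterval_0[OF Fi]) (use that in auto)
    then show ?thesis using sub[OF that] by (simp add: G_def)
  qed
  have Gmid: "G y = G (T / 2)" if "0 < y" "y < T" for y
    using Gab[of y "T / 2"] Gab[of "T / 2" y] that T by (cases "y = T / 2") (auto simp: neq_iff)
  have Gc: "G y = G (T / 2)" if "y \<in> {0..T}" for y
    by (rule AE_eq_continuous_Icc[OF T cG continuous_on_const AE_interior[OF Gmid] that])
  have "G 0 = 0" by (simp add: G_def)
  then have "G (T / 2) = 0" using Gc[of 0] T by simp
  then have "integral {0..y} F = 0" if "y \<in> {0..T}" for y using Gc[OF that] by (simp add: G_def)
  from AE_zero_of_indefinite_integral_zero[OF Fi this]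
  have "AE t in lebesgue. t \<in> {0..T} \<longrightarrow> F t = 0" by (simp add: AE_restrict_space_iff)
  then have "AE t in lebesgue. t \<in> {0..<T} \<longrightarrow> f t = 0" by eventually_elim (auto simp: F_def)
  then show ?thesis by (simp add: AE_restrict_space_iff)
qed

section \<open>The time derivative of the graph\<close>

text \<open>
  Only \<open>h\<close> is measurable. Subtracting \<open>h\<close> from a simple function below \<open>2 f + h\<close> leaves a
  measurable function below \<open>2 f\<close>, which suffices because the integral of \<open>f\<close> is a supremum
  over such functions. It is applied to the distance of a function to its simple
  approximations, whose measurability in time is not part of the definition of the Bochner
  integral.
\<close>
lemma nn_integral_scale_add_le:
  fixes f h :: "'c \<Rightarrow> ennreal"
  assumes h: "h \<in> borel_measurable M" and h_fin: "\<And>x. h x \<noteq> top"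
  shows "(\<integral>\<^sup>+ x. 2 * f x + h x \<partial>M) \<le> 2 * (\<integral>\<^sup>+ x. f x \<partial>M) + (\<integral>\<^sup>+ x. h x \<partial>M)"
  unfolding nn_integral_def[of M "\<lambda>x. 2 * f x + h x"]
proof (rule SUP_least)
  fix g assume "g \<in> {g. simple_function M g \<and> g \<le> (\<lambda>x. 2 * f x + h x)}"
  then have g: "simple_function M g" "\<And>x. g x \<le> 2 * f x + h x" by (auto simp: le_fun_def)
  have gm: "g \<in> borel_measurable M" by (rule borel_measurable_simple_function[OF g(1)])
  \<comment> \<open>a measurable function below \<open>f\<close>\<close>
  define k where "k x = (g x - h x) / 2" for x
  have km: "k \<in> borel_measurable M" unfolding k_def using gm h by measurable
  have two: "2 * k x = g x - h x" for x
    unfolding k_def ennreal_times_divide by (subst mult.commute, rule ennreal_mult_divide_eq) auto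
  have "k x \<le> f x" for x
  proof -
    have "g x - h x \<le> 2 * f x" using g(2)[of x] h_fin[of x] by (simp add: ennreal_minus_le_iff add.commute)
    then have "k x \<le> (2 * f x) / 2" unfolding k_def by (rule divide_right_mono_ennreal)
    also have "(2 * f x) / 2 = f x"
      by (subst mult.commute, rule ennreal_mult_divide_eq) auto
    finally show ?thesis .
  qed
  then have "(\<integral>\<^sup>+ x. k x \<partial>M) \<le> (\<integral>\<^sup>+ x. f x \<partial>M)" by (intro nn_integral_mono) auto
  moreover have "integral\<^sup>S M g = (\<integral>\<^sup>+ x. g x \<partial>M)" by (rule nn_integral_eq_simple_integral[OF g(1), symmetric])
  moreover have "(\<integral>\<^sup>+ x. g x \<partial>M) \<le> (\<integral>\<^sup>+ x. 2 * k x + h x \<partial>M)"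
  proof (rule nn_integral_mono)
    fix x
    have "g x \<le> h x + (g x - h x)"
      using ennreal_minus_le_iff[of "g x" "h x" "g x - h x"] by blast
    then show "g x \<le> 2 * k x + h x" unfolding two by (simp only: add.commute)
  qed
  moreover have "(\<integral>\<^sup>+ x. 2 * k x + h x \<partial>M) = 2 * (\<integral>\<^sup>+ x. k x \<partial>M) + (\<integral>\<^sup>+ x. h x \<partial>M)"
    using km h by (simp add: nn_integral_add nn_integral_cmult)
  ultimately show "integral\<^sup>S M g \<le> 2 * (\<integral>\<^sup>+ x. f x \<partial>M) + (\<integral>\<^sup>+ x. h x \<partial>M)"
    by (metis (no_types, lifting) add_right_mono mult_left_mono order_trans zero_le)
qed

lemma Lp_scale:
  fixes f :: "real \<Rightarrow> 'a::euclidean_space"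
  assumes f: "f \<in> Lp L p"
  shows "(\<lambda>x. c *\<^sub>R f x) \<in> Lp L p" "p > 0 \<Longrightarrow> Lp_norm L p (\<lambda>x. c *\<^sub>R f x) = \<bar>c\<bar> * Lp_norm L p f"
proof -
  have e: "norm (c *\<^sub>R f x) powr p = \<bar>c\<bar> powr p * norm (f x) powr p" for x by (simp add: powr_mult)
  have "integrable (lebesgue_on {0..L}) (\<lambda>x. norm (c *\<^sub>R f x) powr p)"
    unfolding e using LpD(3)[OF f] by (rule integrable_mult_right)
  then show "(\<lambda>x. c *\<^sub>R f x) \<in> Lp L p"
    using LpD(1)[OF f] borel_measurable_scaleR[OF borel_measurable_const LpD(2)[OF f]]
    unfolding Lp_def periodic_fun_simple_def by simp
  show "Lp_norm L p (\<lambda>x. c *\<^sub>R f x) = \<bar>c\<bar> * Lp_norm L p f" if "p > 0"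
    unfolding Lp_norm_def e using that by (simp add: powr_mult powr_powr)
qed

lemma Lp_add:
  fixes f g :: "real \<Rightarrow> 'a::euclidean_space"
  assumes "f \<in> Lp L p" "g \<in> Lp L p" "p > 0"
  shows "(\<lambda>x. f x + g x) \<in> Lp L p"
  using Lp_diff[OF assms(1) Lp_scale(1)[OF assms(2), of "- 1"] assms(3)] by simp

lemma Lp_sum:
  fixes f :: "'i \<Rightarrow> real \<Rightarrow> 'a::euclidean_space"
  assumes "finite J" "\<And>j. j \<in> J \<Longrightarrow> f j \<in> Lp L p" "p > 0"
  shows "(\<lambda>x. \<Sum>j\<in>J. f j x) \<in> Lp L p"
  using assms
proof (induction J rule: finite_induct)
  case empty
  then show ?case by (auto simp: Lp_def periodic_fun_simple_def)
next
  case (insert j J)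
  then show ?case using Lp_add[of "f j" L p "\<lambda>x. \<Sum>j\<in>J. f j x"] by simp
qed

lemma Lp_continuous:
  fixes f :: "real \<Rightarrow> 'a::euclidean_space"
  assumes "continuous_on UNIV f" "periodic_fun_simple f L" "p > 0"
  shows "f \<in> Lp L p"
proof -
  have c: "continuous_on {0..L} f" using assms(1) continuous_on_subset by blast
  have "continuous_on {0..L} (\<lambda>x. norm (f x) powr p)"
    using assms(3) by (intro continuous_on_powr' continuous_on_norm c continuous_on_const) auto
  then show ?thesis
    using assms(2) measurable_continuous_Icc[OF c] integrable_lebesgue_on_continuous by (auto simp: Lp_def)
qed

text \<open>
  A triangle inequality up to a factor, which is all that convergence arguments need.
\<close>
lemma Lp_norm_2_add_le:
  fixes f g :: "real \<Rightarrow> 'a::euclidean_space"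
  assumes f: "f \<in> Lp L 2" and g: "g \<in> Lp L 2"
  shows "Lp_norm L 2 (\<lambda>x. f x + g x) \<le> 2 * Lp_norm L 2 f + 2 * Lp_norm L 2 g"
proof -
  let ?M = "lebesgue_on {0..L}"
  let ?A = "\<integral>x. norm (f x) powr 2 \<partial>?M" and ?B = "\<integral>x. norm (g x) powr 2 \<partial>?M"
  have two: "(2::real) > 0" by simp
  have b: "norm (f x + g x) powr 2 \<le> 2 powr 2 * (norm (f x) powr 2 + norm (g x) powr 2)" for x
    using norm_diff_powr_le[OF two, of "f x" "- g x"] by simp
  have "(\<integral>x. norm (f x + g x) powr 2 \<partial>?M) \<le> (\<integral>x. 2 powr 2 * (norm (f x) powr 2 + norm (g x) powr 2) \<partial>?M)"
    by (rule integral_mono) (use b LpD(3)[OF f] LpD(3)[OF g] LpD(3)[OF Lp_add[OF f g two]] in auto)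
  also have "\<dots> = 2 powr 2 * (?A + ?B)" using LpD(3)[OF f] LpD(3)[OF g] by simp
  finally have le: "(\<integral>x. norm (f x + g x) powr 2 \<partial>?M) \<le> 2 powr 2 * (?A + ?B)" .
  have AB: "?A \<ge> 0" "?B \<ge> 0" by auto
  have "Lp_norm L 2 (\<lambda>x. f x + g x) \<le> (2 powr 2 * (?A + ?B)) powr (1 / 2)"
    unfolding Lp_norm_def by (rule powr_mono2) (use le in auto)
  also have "\<dots> = 2 * sqrt (?A + ?B)"
  proof -
    have "(2 powr 2 * s) powr (1 / 2) = 2 * sqrt s" if "s \<ge> 0" for s :: real
      using that by (simp add: powr_half_sqrt real_sqrt_mult)
    then show ?thesis using AB by (simp only: add_nonneg_nonneg)
  qed
  also have "\<dots> \<le> 2 * (sqrt ?A + sqrt ?B)"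
    using AB by (intro mult_left_mono sqrt_add_le_add_sqrt) auto
  also have "\<dots> = 2 * Lp_norm L 2 f + 2 * Lp_norm L 2 g"
    using AB by (simp add: Lp_norm_def powr_half_sqrt)
  finally show ?thesis .
qed

lemma simple_integral_into_eq:
  fixes s :: "real \<Rightarrow> 'x \<Rightarrow> 'v::euclidean_space"
  assumes s: "simple_function (lebesgue_on {0..<T}) s"
  shows "integrable (lebesgue_on {0..<T}) (\<lambda>t. s t x)"
    and "simple_integral_into {0..<T} s x = (\<integral>t. s t x \<partial>lebesgue_on {0..<T})"
proof -
  let ?I = "{0..<T}" and ?M = "lebesgue_on {0..<T}"
  let ?E = "\<lambda>y. {t \<in> ?I. s t = y}"
  have fin: "finite (s ` ?I)" using simple_functionD(1)[OF s] by simp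
  have E: "?E y \<in> sets ?M" for y
  proof -
    have "s -` {y} \<inter> space ?M \<in> sets ?M" by (rule simple_functionD(2)[OF s])
    moreover have "s -` {y} \<inter> space ?M = ?E y" by auto
    ultimately show ?thesis by simp
  qed
  have finM: "finite_measure ?M"
    by (intro finite_measure_lebesgue_on bounded_set_imp_lmeasurable) auto
  have rep: "s t x = (\<Sum>y\<in>s ` ?I. indicator (?E y) t *\<^sub>R y x)" if t: "t \<in> ?I" for t
  proof -
    have "(\<Sum>y\<in>s ` ?I. indicator (?E y) t *\<^sub>R y x) = (\<Sum>y\<in>s ` ?I. if y = s t then y x else 0)"
      using t by (intro sum.cong) (auto simp: indicator_def)
    also have "\<dots> = s t x" using fin t by (simp add: sum.delta)
    finally show ?thesis by simp
  qed
  have ind: "integrable ?M (\<lambda>t. indicator (?E y) t *\<^sub>R y x)" for y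
    using E finite_measure.emeasure_finite[OF finM] by (intro integrable_scaleR_left integrable_real_indicator) (auto simp: less_top)
  have "integrable ?M (\<lambda>t. \<Sum>y\<in>s ` ?I. indicator (?E y) t *\<^sub>R y x)" by (intro Bochner_Integration.integrable_sum ind)
  then show "integrable ?M (\<lambda>t. s t x)"
    by (subst Bochner_Integration.integrable_cong[OF refl rep]) auto
  have "(\<integral>t. s t x \<partial>?M) = (\<integral>t. (\<Sum>y\<in>s ` ?I. indicator (?E y) t *\<^sub>R y x) \<partial>?M)"
    by (rule Bochner_Integration.integral_cong[OF refl rep]) simp
  also have "\<dots> = (\<Sum>y\<in>s ` ?I. (\<integral>t. indicator (?E y) t *\<^sub>R y x \<partial>?M))"
    by (intro Bochner_Integration.integral_sum ind)
  also have "\<dots> = (\<Sum>y\<in>s ` ?I. measure lebesgue (?E y) *\<^sub>R y x)"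
  proof (rule sum.cong[OF refl])
    fix y
    have "(\<integral>t. indicator (?E y) t *\<^sub>R y x \<partial>?M) = (\<integral>t. indicator (?E y) t \<partial>?M) *\<^sub>R y x"
      using E finite_measure.emeasure_finite[OF finM] by (intro integral_scaleR_left integrable_real_indicator) (auto simp: less_top)
    also have "(\<integral>t. indicator (?E y) t \<partial>?M) = measure ?M (?E y)"
    proof -
      have "?E y \<inter> space ?M = ?E y" by auto
      then show ?thesis by (simp only: Bochner_Integration.integral_indicator)
    qed
    also have "measure ?M (?E y) = measure lebesgue (?E y)"
      by (rule measure_restrict_space) auto
    finally show "(\<integral>t. indicator (?E y) t *\<^sub>R y x \<partial>?M) = measure lebesgue (?E y) *\<^sub>R y x" .
  qed
  finally show "simple_integral_into ?I s x = (\<integral>t. s t x \<partial>?M)" by (simp add: simple_integral_into_def)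
qed

lemma simple_integral_into_Lp:
  fixes s :: "real \<Rightarrow> real \<Rightarrow> 'a::euclidean_space"
  assumes "simple_into {0..<T} (Lp L p) s" "p > 0"
  shows "simple_integral_into {0..<T} s \<in> Lp L p"
  unfolding simple_integral_into_def
  using assms simple_functionD(1)[of "lebesgue_on {0..<T}" s]
  by (intro Lp_sum Lp_scale) (auto simp: simple_into_def)

text \<open>
  Adding \<open>\<gamma>0\<close> to \<open>\<phi>\<close> adds \<open>\<zeta>' \<gamma>0\<close> to the integrand, whose Bochner integral is \<open>(\<integral> \<zeta>') \<gamma>0 = 0\<close>.
  On the level of the definition, simple approximations \<open>r\<close> of \<open>\<zeta>'\<close> are combined with those of
  the given integrand. This guarantees that the chosen time derivative of the graph is a
  genuine one.
\<close>
lemma weak_time_deriv_add_static: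
  fixes \<phi> v :: "real \<Rightarrow> real \<Rightarrow> 'a::euclidean_space" and \<gamma>0 :: "real \<Rightarrow> 'a"
  assumes T: "T > 0" and \<gamma>0: "\<gamma>0 \<in> Lp L 2"
    and w: "weak_time_deriv {0..<T} (Lp L 2) (Lp_norm L 2) \<phi> v"
  shows "weak_time_deriv {0..<T} (Lp L 2) (Lp_norm L 2) (\<lambda>t x. \<gamma>0 x + \<phi> t x) v"
  unfolding weak_time_deriv_def
proof (intro allI impI)
  let ?X = "Lp L 2 :: (real \<Rightarrow> 'a) set" and ?N = "Lp_norm L 2 :: (real \<Rightarrow> 'a) \<Rightarrow> real"
  let ?I = "{0..<T}" and ?M = "lebesgue_on {0..<T}"
  fix \<zeta> :: "real \<Rightarrow> real"
  assume z: "smooth \<zeta> \<and> compact (closure {t. \<zeta> t \<noteq> 0}) \<and> closure {t. \<zeta> t \<noteq> 0} \<subseteq> interior ?I"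
  then obtain w where hw: "has_bochner_integral_into ?I ?X ?N (\<lambda>t x. deriv \<zeta> t *\<^sub>R \<phi> t x) w"
    and hv: "has_bochner_integral_into ?I ?X ?N (\<lambda>t x. \<zeta> t *\<^sub>R v t x) (\<lambda>x. - w x)"
    using w unfolding weak_time_deriv_def by blast
  let ?d = "deriv \<zeta>"
  have two: "(2::real) > 0" by simp
  obtain s1 where s1: "\<And>k. simple_into ?I ?X (s1 k)"
    "AE t in ?M. (\<lambda>k. ?N (\<lambda>x. ?d t *\<^sub>R \<phi> t x - s1 k t x)) \<longlonglongrightarrow> 0"
    and uX: "\<And>t. t \<in> ?I \<Longrightarrow> (\<lambda>x. ?d t *\<^sub>R \<phi> t x) \<in> ?X"
    using hw unfolding has_bochner_integral_into_def bochner_measurable_def by blast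
  obtain s2 where s2: "\<And>k. simple_into ?I ?X (s2 k)"
    "(\<lambda>k. \<integral>\<^sup>+ t. ennreal (?N (\<lambda>x. ?d t *\<^sub>R \<phi> t x - s2 k t x)) \<partial>?M) \<longlonglongrightarrow> 0"
    "(\<lambda>k. ?N (\<lambda>x. simple_integral_into ?I (s2 k) x - w x)) \<longlonglongrightarrow> 0" and wX: "w \<in> ?X"
    using hw unfolding has_bochner_integral_into_def by blast
  have dc: "continuous_on {0..T} ?d" by (rule smooth_continuous[OF smooth_real_deriv(2)]) (use z in simp)
  have di: "integrable (lebesgue_on {0..T}) ?d" by (rule integrable_lebesgue_on_continuous[OF dc])
  have di': "integrable ?M ?d"
    by (rule integrable_Ico_restrict[OF di])
  have dint: "(\<integral>t. ?d t \<partial>?M) = 0"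
  proof -
    have "\<zeta> t = 0" if "t \<notin> {0<..<T}" for t
    proof (rule ccontr)
      assume "\<zeta> t \<noteq> 0"
      then have "t \<in> interior ?I" using z closure_subset[of "{t. \<zeta> t \<noteq> 0}"] by auto
      then show False using that by simp
    qed
    then have "\<zeta> T = 0" "\<zeta> 0 = 0" by auto
    moreover have "primitive T \<zeta> ?d"
      by (rule primitive_C1[OF _ dc]) (use smooth_real_deriv(1) z in \<open>auto intro: has_vector_derivative_at_within\<close>)
    ultimately have "(\<integral>t. ?d t \<partial>lebesgue_on {0..T}) = 0" using primitive_total T by fastforce
    moreover have "(\<integral>t. (if t \<in> ?I then ?d t else 0) \<partial>lebesgue_on {0..T}) = (\<integral>t. ?d t \<partial>lebesgue_on {0..T})"
      by (rule integral_lebesgue_on_cong_AE[OF _ AE_interior]) auto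
    ultimately show ?thesis using integrable_Ico_extend(2)[OF di'] by simp
  qed
  obtain r where r: "\<And>k. simple_function ?M (r k)" "\<And>t. t \<in> ?I \<Longrightarrow> (\<lambda>k. r k t) \<longlonglongrightarrow> ?d t"
    "\<And>k t. t \<in> ?I \<Longrightarrow> \<bar>r k t\<bar> \<le> 2 * \<bar>?d t\<bar>"
  proof -
    obtain F where F: "\<And>k. simple_function ?M (F k)" "\<And>t. t \<in> ?I \<Longrightarrow> (\<lambda>k. F k t) \<longlonglongrightarrow> ?d t"
      "\<And>k t. t \<in> ?I \<Longrightarrow> dist (F k t) 0 \<le> 2 * dist (?d t) 0"
      using borel_measurable_implies_sequence_metric[OF borel_measurable_integrable[OF di'], of 0]
      unfolding space_lebesgue_on by blast
    show ?thesis by (rule that[OF F(1,2)]) (use F(3) in simp_all)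
  qed
  \<comment> \<open>the combination of the simple functions \<open>r\<close> with simple functions \<open>q\<close> that approximate the
      given integrand\<close>
  define s where "s q k t x = r k t *\<^sub>R \<gamma>0 x + q k t x" for q :: "nat \<Rightarrow> real \<Rightarrow> real \<Rightarrow> 'a" and k t x
  have s_simple: "simple_into ?I ?X (s q k)" if q: "\<forall>j. simple_into ?I ?X (q j)"
    for q :: "nat \<Rightarrow> real \<Rightarrow> real \<Rightarrow> 'a" and k
  proof -
    have qk: "simple_into ?I ?X (q k)" using q by blast
    then have "simple_function ?M (q k)" by (simp add: simple_into_def)
    from simple_function_compose2[OF r(1)[of k] this, of "\<lambda>c y x. c *\<^sub>R \<gamma>0 x + y x"]
    have "simple_function ?M (s q k)" by (simp add: s_def[abs_def])
    moreover have "s q k t \<in> ?X" if "t \<in> ?I" for t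
      unfolding s_def[abs_def]
      by (intro Lp_add[OF Lp_scale(1)[OF \<gamma>0] _ two]) (use qk that in \<open>auto simp: simple_into_def\<close>)
    ultimately show ?thesis by (auto simp: simple_into_def)
  qed
  have N_le: "?N (\<lambda>x. ?d t *\<^sub>R (\<gamma>0 x + \<phi> t x) - s q k t x)
      \<le> 2 * (\<bar>?d t - r k t\<bar> * ?N \<gamma>0) + 2 * ?N (\<lambda>x. ?d t *\<^sub>R \<phi> t x - q k t x)"
    if q: "\<forall>j. simple_into ?I ?X (q j)" and t: "t \<in> ?I" for q :: "nat \<Rightarrow> real \<Rightarrow> real \<Rightarrow> 'a" and k t
  proof -
    have "simple_into ?I ?X (q k)" using q by blast
    then have "q k t \<in> ?X" using t by (auto simp: simple_into_def)
    note a = Lp_diff[OF uX[OF t] this two]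
    have e: "(\<lambda>x. ?d t *\<^sub>R (\<gamma>0 x + \<phi> t x) - s q k t x)
        = (\<lambda>x. (?d t - r k t) *\<^sub>R \<gamma>0 x + (?d t *\<^sub>R \<phi> t x - q k t x))"
      by (simp add: s_def fun_eq_iff algebra_simps)
    show ?thesis
      unfolding e using Lp_norm_2_add_le[OF Lp_scale(1)[OF \<gamma>0, of "?d t - r k t"] a]
      by (simp add: Lp_scale(2)[OF \<gamma>0 two])
  qed
  have bm: "bochner_measurable ?I ?X ?N (\<lambda>t x. ?d t *\<^sub>R (\<gamma>0 x + \<phi> t x))"
    unfolding bochner_measurable_def
  proof (intro conjI ballI exI[of _ "s s1"] allI s_simple s1(1))
    fix t assume t: "t \<in> ?I"
    have "(\<lambda>x. ?d t *\<^sub>R \<gamma>0 x + ?d t *\<^sub>R \<phi> t x) \<in> ?X" by (rule Lp_add[OF Lp_scale(1)[OF \<gamma>0] uX[OF t] two])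
    then show "(\<lambda>x. ?d t *\<^sub>R (\<gamma>0 x + \<phi> t x)) \<in> ?X" by (simp add: scaleR_add_right)
  next
    have "AE t in ?M. t \<in> ?I" by (rule AE_I2) simp
    with s1(2) show "AE t in ?M. (\<lambda>k. ?N (\<lambda>x. ?d t *\<^sub>R (\<gamma>0 x + \<phi> t x) - s s1 k t x)) \<longlonglongrightarrow> 0"
    proof eventually_elim
      case (elim t)
      have "(\<lambda>k. 2 * (\<bar>?d t - r k t\<bar> * ?N \<gamma>0) + 2 * ?N (\<lambda>x. ?d t *\<^sub>R \<phi> t x - s1 k t x))
          \<longlonglongrightarrow> 2 * (\<bar>?d t - ?d t\<bar> * ?N \<gamma>0) + 2 * 0"
        by (intro tendsto_intros r(2) elim)
      then have lim: "(\<lambda>k. 2 * (\<bar>?d t - r k t\<bar> * ?N \<gamma>0) + 2 * ?N (\<lambda>x. ?d t *\<^sub>R \<phi> t x - s1 k t x)) \<longlonglongrightarrow> 0"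
        by simp
      show ?case
        by (rule tendsto_sandwich[OF _ _ tendsto_const lim])
           (use N_le[of s1 t] s1(1) elim(2) in \<open>auto simp: Lp_norm_nonneg\<close>)
    qed
  qed
  have "has_bochner_integral_into ?I ?X ?N (\<lambda>t x. ?d t *\<^sub>R (\<gamma>0 x + \<phi> t x)) w"
    unfolding has_bochner_integral_into_def
  proof (intro conjI bm wX exI[of _ "s s2"] allI s_simple s2(1))
    let ?h = "\<lambda>k t. ennreal (2 * (\<bar>?d t - r k t\<bar> * ?N \<gamma>0))"
    have ri: "integrable ?M (r k)" for k
    proof (rule Bochner_Integration.integrable_bound[of _ "\<lambda>t. 2 * ?d t"])
      show "r k \<in> borel_measurable ?M" by (rule borel_measurable_simple_function[OF r(1)])
      show "AE t in ?M. norm (r k t) \<le> norm (2 * ?d t)" using r(3) by (intro AE_I2) (simp add: abs_mult)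
    qed (use di' in auto)
    have dr: "(\<lambda>k. \<integral>t. \<bar>?d t - r k t\<bar> \<partial>?M) \<longlonglongrightarrow> (\<integral>t. 0 \<partial>?M)"
    proof (rule integral_dominated_convergence[where w = "\<lambda>t. 3 * \<bar>?d t\<bar>"])
      show "AE t in ?M. (\<lambda>k. \<bar>?d t - r k t\<bar>) \<longlonglongrightarrow> 0"
      proof (rule AE_I2)
        fix t assume "t \<in> space ?M"
        then have "(\<lambda>k. \<bar>?d t - r k t\<bar>) \<longlonglongrightarrow> \<bar>?d t - ?d t\<bar>" by (intro tendsto_intros r(2)) auto
        then show "(\<lambda>k. \<bar>?d t - r k t\<bar>) \<longlonglongrightarrow> 0" by simp
      qed
      show "AE t in ?M. norm \<bar>?d t - r k t\<bar> \<le> 3 * \<bar>?d t\<bar>" for k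
      proof (rule AE_I2)
        fix t assume "t \<in> space ?M"
        then have "\<bar>r k t\<bar> \<le> 2 * \<bar>?d t\<bar>" by (intro r(3)) auto
        then show "norm \<bar>?d t - r k t\<bar> \<le> 3 * \<bar>?d t\<bar>" by simp
      qed
    qed (use di' ri in auto)
    have h_int: "(\<integral>\<^sup>+ t. ?h k t \<partial>?M) = ennreal (2 * (?N \<gamma>0 * (\<integral>t. \<bar>?d t - r k t\<bar> \<partial>?M)))" for k
    proof -
      have "(\<integral>\<^sup>+ t. ?h k t \<partial>?M) = ennreal (\<integral>t. 2 * (\<bar>?d t - r k t\<bar> * ?N \<gamma>0) \<partial>?M)"
        by (rule nn_integral_eq_integral) (use di' ri Lp_norm_nonneg[of L 2 \<gamma>0] in auto)
      then show ?thesis using di' ri by (simp add: mult.commute mult.left_commute)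
    qed
    let ?R = "\<lambda>k. 2 * (\<integral>\<^sup>+ t. ennreal (?N (\<lambda>x. ?d t *\<^sub>R \<phi> t x - s2 k t x)) \<partial>?M) + (\<integral>\<^sup>+ t. ?h k t \<partial>?M)"
    have le: "(\<integral>\<^sup>+ t. ennreal (?N (\<lambda>x. ?d t *\<^sub>R (\<gamma>0 x + \<phi> t x) - s s2 k t x)) \<partial>?M) \<le> ?R k" for k
    proof -
      have "(\<integral>\<^sup>+ t. ennreal (?N (\<lambda>x. ?d t *\<^sub>R (\<gamma>0 x + \<phi> t x) - s s2 k t x)) \<partial>?M)
          \<le> (\<integral>\<^sup>+ t. 2 * ennreal (?N (\<lambda>x. ?d t *\<^sub>R \<phi> t x - s2 k t x)) + ?h k t \<partial>?M)"
      proof (rule nn_integral_mono)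
        fix t assume "t \<in> space ?M"
        then have t: "t \<in> ?I" by simp
        have "2 * ennreal (?N (\<lambda>x. ?d t *\<^sub>R \<phi> t x - s2 k t x)) + ?h k t
          = ennreal (2 * ?N (\<lambda>x. ?d t *\<^sub>R \<phi> t x - s2 k t x) + 2 * (\<bar>?d t - r k t\<bar> * ?N \<gamma>0))"
        proof -
          have "ennreal (2 * y + 2 * z) = 2 * ennreal y + ennreal (2 * z)" if "y \<ge> 0" "z \<ge> 0" for y z
          proof -
            have "ennreal (2 * y + 2 * z) = ennreal (2 * y) + ennreal (2 * z)"
              using that by (intro ennreal_plus) auto
            also have "ennreal (2 * y) = 2 * ennreal y" by (simp add: ennreal_mult')
            finally show ?thesis .
          qed
          then show ?thesis by (simp only: Lp_norm_nonneg abs_ge_zero mult_nonneg_nonneg)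
        qed
        then show "ennreal (?N (\<lambda>x. ?d t *\<^sub>R (\<gamma>0 x + \<phi> t x) - s s2 k t x))
            \<le> 2 * ennreal (?N (\<lambda>x. ?d t *\<^sub>R \<phi> t x - s2 k t x)) + ?h k t"
          using N_le[of s2 t k] s2(1) t by (simp add: add.commute ennreal_leI)
      qed
      also have "\<dots> \<le> ?R k"
      proof (rule nn_integral_scale_add_le)
        have "(\<lambda>t. ?d t - r k t) \<in> borel_measurable ?M" using di' ri by auto
        then show "?h k \<in> borel_measurable ?M" by measurable
      qed simp
      finally show ?thesis .
    qed
    have "(\<lambda>k. ?R k) \<longlonglongrightarrow> 2 * 0 + ennreal (2 * (?N \<gamma>0 * (\<integral>t. 0 \<partial>?M)))"
      unfolding h_int by (intro tendsto_add ennreal_tendsto_cmult s2(2) tendsto_ennrealI tendsto_mult_left dr) simp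
    then have R0: "?R \<longlonglongrightarrow> 0" by simp
    show "(\<lambda>k. \<integral>\<^sup>+ t. ennreal (?N (\<lambda>x. ?d t *\<^sub>R (\<gamma>0 x + \<phi> t x) - s s2 k t x)) \<partial>?M) \<longlonglongrightarrow> 0"
      by (rule tendsto_sandwich[OF _ _ tendsto_const R0]) (use le in auto)
    have si: "simple_integral_into ?I (s s2 k) x = (\<integral>t. r k t \<partial>?M) *\<^sub>R \<gamma>0 x + simple_integral_into ?I (s2 k) x" for k x
    proof -
      have f: "simple_function ?M (s s2 k)" "simple_function ?M (s2 k)"
        using s_simple[of s2 k] s2(1) by (auto simp: simple_into_def)
      have "simple_integral_into ?I (s s2 k) x = (\<integral>t. r k t *\<^sub>R \<gamma>0 x + s2 k t x \<partial>?M)"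
        unfolding simple_integral_into_eq(2)[OF f(1)] by (simp add: s_def)
      also have "\<dots> = (\<integral>t. r k t \<partial>?M) *\<^sub>R \<gamma>0 x + (\<integral>t. s2 k t x \<partial>?M)"
        using ri simple_integral_into_eq(1)[OF f(2)] by simp
      finally show ?thesis by (simp add: simple_integral_into_eq(2)[OF f(2)])
    qed
    have r0: "(\<lambda>k. \<integral>t. r k t \<partial>?M) \<longlonglongrightarrow> 0"
    proof -
      have d0: "(\<lambda>k. \<integral>t. \<bar>?d t - r k t\<bar> \<partial>?M) \<longlonglongrightarrow> 0" using dr by simp
      have le3: "norm (\<integral>t. r k t \<partial>?M) \<le> (\<integral>t. \<bar>?d t - r k t\<bar> \<partial>?M)" for k
      proof -
        have "(\<integral>t. r k t \<partial>?M) = - (\<integral>t. ?d t - r k t \<partial>?M)" using di' ri dint by simp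
        then show ?thesis using integral_abs_bound[of ?M "\<lambda>t. ?d t - r k t"] by simp
      qed
      show ?thesis
        by (rule Lim_null_comparison[OF always_eventually d0], rule allI, rule le3)
    qed
    have le2: "?N (\<lambda>x. simple_integral_into ?I (s s2 k) x - w x)
        \<le> 2 * (\<bar>\<integral>t. r k t \<partial>?M\<bar> * ?N \<gamma>0) + 2 * ?N (\<lambda>x. simple_integral_into ?I (s2 k) x - w x)" for k
    proof -
      have e: "(\<lambda>x. simple_integral_into ?I (s s2 k) x - w x)
         = (\<lambda>x. (\<integral>t. r k t \<partial>?M) *\<^sub>R \<gamma>0 x + (simple_integral_into ?I (s2 k) x - w x))"
        by (simp add: si fun_eq_iff)
      show ?thesis unfolding e
        using Lp_norm_2_add_le[OF Lp_scale(1)[OF \<gamma>0, of "\<integral>t. r k t \<partial>?M"] Lp_diff[OF simple_integral_into_Lp[OF s2(1)[of k] two] wX two]]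
        by (simp add: Lp_scale(2)[OF \<gamma>0 two])
    qed
    have "(\<lambda>k. 2 * (\<bar>\<integral>t. r k t \<partial>?M\<bar> * ?N \<gamma>0) + 2 * ?N (\<lambda>x. simple_integral_into ?I (s2 k) x - w x))
        \<longlonglongrightarrow> 2 * (\<bar>0\<bar> * ?N \<gamma>0) + 2 * 0"
      by (intro tendsto_intros r0 s2(3))
    then have z2: "(\<lambda>k. 2 * (\<bar>\<integral>t. r k t \<partial>?M\<bar> * ?N \<gamma>0) + 2 * ?N (\<lambda>x. simple_integral_into ?I (s2 k) x - w x)) \<longlonglongrightarrow> 0"
      by simp
    show "(\<lambda>k. ?N (\<lambda>x. simple_integral_into ?I (s s2 k) x - w x)) \<longlonglongrightarrow> 0"
      by (rule tendsto_sandwich[OF _ _ tendsto_const z2]) (use le2 in \<open>auto simp: Lp_norm_nonneg\<close>)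
  qed
  then show "\<exists>w. has_bochner_integral_into ?I ?X ?N (\<lambda>t x. ?d t *\<^sub>R (\<gamma>0 x + \<phi> t x)) w \<and>
      has_bochner_integral_into ?I ?X ?N (\<lambda>t x. \<zeta> t *\<^sub>R v t x) (\<lambda>x. - w x)"
    using hv by blast
qed

section \<open>Periodic functions with two weak derivatives\<close>

text \<open>
  Two weak derivatives in the absolutely continuous sense, with matching end values. These are
  the functions to which the second-order lemma of du Bois-Reymond applies.
\<close>
definition W2_periodic ::
    "real \<Rightarrow> (real \<Rightarrow> 'a::euclidean_space) \<Rightarrow> (real \<Rightarrow> 'a) \<Rightarrow> (real \<Rightarrow> 'a) \<Rightarrow> bool" where
  "W2_periodic L f f1 f2 \<longleftrightarrow> primitive L f f1 \<and> primitive L f1 f2 \<and> f L = f 0 \<and> f1 L = f1 0"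

lemma W2_periodic_smooth:
  assumes "smooth f" "periodic_fun_simple f L"
  shows "W2_periodic L f (dx f) (dx (dx f))"
  unfolding W2_periodic_def
  using assms smooth_primitive smooth_has_vector_derivative(2)[OF assms(1)]
    periodic_ends dx_periodic[OF assms(2)] by blast

lemma W2_periodic_diff:
  assumes "W2_periodic L f f1 f2" "W2_periodic L g g1 g2"
  shows "W2_periodic L (\<lambda>x. f x - g x) (\<lambda>x. f1 x - g1 x) (\<lambda>x. f2 x - g2 x)"
  using assms primitive_diff unfolding W2_periodic_def by (intro conjI primitive_diff) auto

lemma W2_periodic_bilinear:
  fixes B :: "'a::euclidean_space \<Rightarrow> 'b::euclidean_space \<Rightarrow> 'c::euclidean_space"
  assumes B: "bounded_bilinear B" and f: "W2_periodic L f f1 f2" and g: "W2_periodic L g g1 g2"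
  shows "W2_periodic L (\<lambda>x. B (f x) (g x)) (\<lambda>x. B (f x) (g1 x) + B (f1 x) (g x))
     (\<lambda>x. (B (f x) (g2 x) + B (f1 x) (g1 x)) + (B (f1 x) (g1 x) + B (f2 x) (g x)))"
  using f g unfolding W2_periodic_def by (intro conjI primitive_add primitive_bilinear[OF B]) auto

lemma W2_periodic_inverse:
  fixes d :: "real \<Rightarrow> real"
  assumes d: "W2_periodic L d d1 d2" and pos: "\<And>x. x \<in> {0..L} \<Longrightarrow> d x > 0"
  shows "\<exists>k1 k2. W2_periodic L (\<lambda>x. inverse (d x)) k1 k2"
proof -
  have d': "primitive L d d1" "primitive L d1 d2" "d L = d 0" "d1 L = d1 0"
    using d by (auto simp: W2_periodic_def)
  let ?k = "\<lambda>x. inverse (d x)"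
  have k: "primitive L ?k (\<lambda>x. - (d1 x * (?k x * ?k x)))"
  proof -
    have "primitive L (\<lambda>x. inverse (d x)) (\<lambda>x. (\<lambda>y v. - (v * (inverse y * inverse y))) (d x) (d1 x))"
    proof (rule primitive_chain[OF d'(1), where S = "{0<..}"])
      fix y :: real assume "y \<in> {0<..}"
      then have "(inverse has_real_derivative - (inverse y * inverse y)) (at y)"
        using DERIV_inverse[of y UNIV] by (simp add: power2_eq_square numeral_2_eq_2)
      then show "(inverse has_derivative (\<lambda>v. - (v * (inverse y * inverse y)))) (at y)"
        by (rule has_derivative_eq_rhs[OF has_field_derivative_imp_has_derivative]) (simp add: fun_eq_iff)
    next
      show "continuous_on {0<..} (\<lambda>y::real. - (v * (inverse y * inverse y)))" for v
        by (intro continuous_intros) auto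
    qed (use pos in auto)
    then show ?thesis by simp
  qed
  let ?k1 = "\<lambda>x. - (d1 x * (?k x * ?k x))"
  let ?k2 = "\<lambda>x. - (d1 x * (?k x * ?k1 x + ?k1 x * ?k x) + d2 x * (?k x * ?k x))"
  have k1: "primitive L ?k1 ?k2"
    by (intro primitive_bounded_linear[OF bounded_linear_minus[OF bounded_linear_ident]]
        primitive_bilinear[OF bounded_bilinear_mult] d' k)
  have "W2_periodic L ?k ?k1 ?k2" unfolding W2_periodic_def using k k1 d'(3,4) by simp
  then show ?thesis by blast
qed

lemma primitive_sum:
  fixes f g :: "'i \<Rightarrow> real \<Rightarrow> 'a::euclidean_space"
  assumes "finite J" "\<And>j. j \<in> J \<Longrightarrow> primitive L (f j) (g j)"
  shows "primitive L (\<lambda>x. \<Sum>j\<in>J. f j x) (\<lambda>x. \<Sum>j\<in>J. g j x)"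
  using assms
proof (induction J rule: finite_induct)
  case empty
  show ?case using primitive_C1[of L "\<lambda>x. 0" "\<lambda>x. 0"] by simp
next
  case (insert j J)
  then show ?case using primitive_add[of L "f j" "g j" "\<lambda>x. \<Sum>j\<in>J. f j x" "\<lambda>x. \<Sum>j\<in>J. g j x"] by simp
qed

lemma primitive_eq_on:
  assumes "primitive L f g" "\<And>x. x \<in> {0..L} \<Longrightarrow> f x = f' x" "0 \<le> L"
  shows "primitive L f' g"
  using assms by (auto simp: primitive_def)

text \<open>
  By uniqueness of derivatives, the derivatives of \<open>Y\<close> are those given by the product rule for
  the expansion.
\<close>
lemma W2_periodic_expand:
  fixes Y Y1 Y2 :: "real \<Rightarrow> 'a::euclidean_space" and q :: "'i \<Rightarrow> real \<Rightarrow> 'a"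
  assumes L: "L > 0" and Y: "W2_periodic L Y Y1 Y2" and J: "finite J"
    and q: "\<And>j. j \<in> J \<Longrightarrow> smooth (q j)"
    and w: "\<And>j. j \<in> J \<Longrightarrow> W2_periodic L (w j) (w1 j) (w2 j)"
    and e: "\<forall>x\<in>{0..L}. Y x = (\<Sum>j\<in>J. w j x *\<^sub>R q j x)"
  shows "\<forall>x\<in>{0..L}. Y1 x = (\<Sum>j\<in>J. w j x *\<^sub>R dx (q j) x + w1 j x *\<^sub>R q j x)"
    and "AE x in lebesgue_on {0..L}. Y2 x = (\<Sum>j\<in>J. (w j x *\<^sub>R dx (dx (q j)) x + w1 j x *\<^sub>R dx (q j) x)
          + (w1 j x *\<^sub>R dx (q j) x + w2 j x *\<^sub>R q j x))"
proof -
  have Y': "primitive L Y Y1" "primitive L Y1 Y2" using Y by (auto simp: W2_periodic_def)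
  have w': "primitive L (w j) (w1 j)" "primitive L (w1 j) (w2 j)" if "j \<in> J" for j
    using w[OF that] by (auto simp: W2_periodic_def)
  have q': "primitive L (q j) (dx (q j))" "primitive L (dx (q j)) (dx (dx (q j)))" if "j \<in> J" for j
    using q[OF that] smooth_has_vector_derivative(2) smooth_primitive by blast+
  let ?Z = "\<lambda>x. \<Sum>j\<in>J. w j x *\<^sub>R q j x" and ?Z1 = "\<lambda>x. \<Sum>j\<in>J. w j x *\<^sub>R dx (q j) x + w1 j x *\<^sub>R q j x"
  let ?Z2 = "\<lambda>x. \<Sum>j\<in>J. (w j x *\<^sub>R dx (dx (q j)) x + w1 j x *\<^sub>R dx (q j) x)
          + (w1 j x *\<^sub>R dx (q j) x + w2 j x *\<^sub>R q j x)"
  have Z: "primitive L ?Z ?Z1" by (intro primitive_sum J primitive_bilinear[OF bounded_bilinear_scaleR] w' q')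
  have Z1: "primitive L ?Z1 ?Z2" by (intro primitive_sum J primitive_add primitive_bilinear[OF bounded_bilinear_scaleR] w' q')
  have "primitive L Y ?Z1" by (rule primitive_eq_on[OF Z]) (use e L in auto)
  from primitive_unique_AE[OF Y'(1) this] have ae: "AE x in lebesgue_on {0..L}. Y1 x = ?Z1 x" .
  have e1: "Y1 x = ?Z1 x" if "x \<in> {0..L}" for x
    by (rule AE_eq_continuous_Icc[OF L primitive_continuous[OF Y'(2)] primitive_continuous[OF Z1] ae that])
  then show "\<forall>x\<in>{0..L}. Y1 x = ?Z1 x" by blast
  have "primitive L Y1 ?Z2" by (rule primitive_eq_on[OF Z1]) (use e1 L in auto)
  from primitive_unique_AE[OF Y'(2) this] show "AE x in lebesgue_on {0..L}. Y2 x = ?Z2 x" .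
qed

lemma ddensity_integrable:
  fixes u a v b :: "real \<Rightarrow> 'a::euclidean_space"
  assumes p: "p > 2" and c: "continuous_on {0..L} u" "continuous_on {0..L} a" "continuous_on {0..L} v"
    and b: "integrable (lebesgue_on {0..L}) b" and nz: "\<And>x. x \<in> {0..L} \<Longrightarrow> u x \<noteq> 0"
  shows "integrable (lebesgue_on {0..L}) (\<lambda>x. ddensity p lam (u x) (a x) (v x) (b x))"
proof -
  have "integrable (lebesgue_on {0..L})
      (\<lambda>x. ddensity p lam (u x) (a x) (fst ((v x, 0) + (0, b x))) (snd ((v x, 0) + (0, b x))))"
  proof (rule integrable_linear_family[where g = "\<lambda>x. (v x, 0) + (0, b x)"
        and A = "\<lambda>x h. ddensity p lam (u x) (a x) (fst h) (snd h)"])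
    show "linear (\<lambda>h. ddensity p lam (u x) (a x) (fst h) (snd h))" for x by (rule ddensity_linear)
    show "continuous_on {0..L} (\<lambda>x. ddensity p lam (u x) (a x) (fst h) (snd h))" for h
      by (rule continuous_ddensity[OF p c(1,2) continuous_on_const continuous_on_const nz])
    have "bounded_linear (\<lambda>y::'a. (0::'a, y))" by (intro bounded_linear_Pair bounded_linear_zero bounded_linear_ident)
    from integrable_bounded_linear[OF this b]
    show "integrable (lebesgue_on {0..L}) (\<lambda>x. (v x, 0) + (0, b x))"
      by (rule Bochner_Integration.integrable_add[OF integrable_lebesgue_on_continuous[OF
              continuous_on_Pair[OF c(3) continuous_on_const]]])
  qed
  then show ?thesis by simp
qed

lemma dx_scaleR:
  fixes \<psi> :: "real \<Rightarrow> real" and q :: "real \<Rightarrow> 'a::euclidean_space"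
  assumes "smooth \<psi>" "smooth q"
  shows "dx (\<lambda>x. \<psi> x *\<^sub>R q x) = (\<lambda>x. \<psi> x *\<^sub>R dx q x + dx \<psi> x *\<^sub>R q x)"
proof
  fix x
  have "(\<psi> has_real_derivative dx \<psi> x) (at x)"
    using smooth_has_vector_derivative(1)[OF assms(1)] by (simp add: has_real_derivative_iff_has_vector_derivative)
  from has_vector_derivative_scaleR[OF this smooth_has_vector_derivative(1)[OF assms(2)]]
  show "dx (\<lambda>x. \<psi> x *\<^sub>R q x) x = \<psi> x *\<^sub>R dx q x + dx \<psi> x *\<^sub>R q x"
    unfolding dx_def[of "\<lambda>x. \<psi> x *\<^sub>R q x"] by (rule vector_derivative_at)
qed

lemma dx_add:
  fixes f g :: "real \<Rightarrow> 'a::euclidean_space"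
  assumes "smooth f" "smooth g"
  shows "dx (\<lambda>x. f x + g x) = (\<lambda>x. dx f x + dx g x)"
proof
  fix x
  show "dx (\<lambda>x. f x + g x) x = dx f x + dx g x"
    unfolding dx_def[of "\<lambda>x. f x + g x"]
    by (rule vector_derivative_at[OF has_vector_derivative_add[OF smooth_has_vector_derivative(1)[OF assms(1)]
            smooth_has_vector_derivative(1)[OF assms(2)]]])
qed

lemma dx_const: "dx (\<lambda>x. c) = (\<lambda>x. 0)"
  by (simp add: dx_def fun_eq_iff)

lemma dx_dx_scaleR:
  fixes \<psi> :: "real \<Rightarrow> real" and q :: "real \<Rightarrow> 'a::euclidean_space"
  assumes "smooth \<psi>" "smooth q"
  shows "dx (dx (\<lambda>x. \<psi> x *\<^sub>R q x)) = (\<lambda>x. (\<psi> x *\<^sub>R dx (dx q) x + dx \<psi> x *\<^sub>R dx q x)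
     + (dx \<psi> x *\<^sub>R dx q x + dx (dx \<psi>) x *\<^sub>R q x))"
proof -
  note s = assms smooth_has_vector_derivative(2)[OF assms(1)] smooth_has_vector_derivative(2)[OF assms(2)]
  show ?thesis
    by (simp only: dx_scaleR[OF s(1,2)] dx_add[OF smooth_scaleR[OF s(1,4)] smooth_scaleR[OF s(3,2)]]
        dx_scaleR[OF s(1,4)] dx_scaleR[OF s(3,2)])
qed

lemma integrable_mult_continuous_Ico:
  fixes f \<zeta> :: "real \<Rightarrow> real"
  assumes f: "integrable (lebesgue_on {0..<T}) f" and z: "continuous_on {0..T} \<zeta>"
  shows "integrable (lebesgue_on {0..<T}) (\<lambda>t. \<zeta> t * f t)"
proof -
  obtain B where B: "B \<ge> 0" "\<And>x. x \<in> {0..T} \<Longrightarrow> norm (\<zeta> x) \<le> B" using continuous_bound_Icc[OF z] by blast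
  show ?thesis
  proof (rule Bochner_Integration.integrable_bound)
    show "integrable (lebesgue_on {0..<T}) (\<lambda>t. B * norm (f t))" using f by auto
    have "\<zeta> \<in> borel_measurable (lebesgue_on {0..<T})"
      using integrable_Ico_restrict[OF integrable_lebesgue_on_continuous[OF z]] by (rule borel_measurable_integrable)
    then show "(\<lambda>t. \<zeta> t * f t) \<in> borel_measurable (lebesgue_on {0..<T})" using f by auto
    show "AE t in lebesgue_on {0..<T}. norm (\<zeta> t * f t) \<le> norm (B * norm (f t))"
    proof (rule AE_I2)
      fix t assume "t \<in> space (lebesgue_on {0..<T})"
      then have "norm (\<zeta> t) * norm (f t) \<le> B * norm (f t)" using B(2)[of t] by (intro mult_right_mono) auto
      then show "norm (\<zeta> t * f t) \<le> norm (B * norm (f t))" using B(1) by (simp add: abs_mult)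
    qed
  qed
qed

section \<open>The flow equation at fixed times\<close>

context graph_evolution
begin

abbreviation "velocity \<equiv> time_deriv L {0..<T} (\<lambda>t x. \<gamma>0 x + \<phi> t x)"

lemma velocity_L2: "velocity \<in> L2_into {0..<T} (Lp L 2) (Lp_norm L 2)"
proof -
  obtain v where v: "v \<in> L2_into {0..<T} (Lp L 2) (Lp_norm L 2)"
    "weak_time_deriv {0..<T} (Lp L 2) (Lp_norm L 2) \<phi> v"
    using \<phi>_W12 unfolding W12_into_def by blast
  have "\<gamma>0 \<in> Lp L 2" by (rule Lp_continuous[OF smooth_continuous[OF \<gamma>0(1)] \<gamma>0(2)]) simp
  note w = weak_time_deriv_add_static[OF T this v(2)]
  let ?P = "\<lambda>v. v \<in> L2_into {0..<T} (Lp L 2) (Lp_norm L 2) \<and>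
      weak_time_deriv {0..<T} (Lp L 2) (Lp_norm L 2) (\<lambda>t x. \<gamma>0 x + \<phi> t x) v"
  have "?P v" using v(1) w by (rule conjI)
  from someI[of ?P, OF this] show ?thesis unfolding time_deriv_def by (rule conjunct1)
qed

lemma velocity_integrable:
  assumes "t \<in> {0..<T}"
  shows "integrable circle (velocity t)"
proof -
  have "velocity t \<in> Lp L 2"
    using velocity_L2 assms unfolding L2_into_def bochner_measurable_def by blast
  from L1_of_Lp[OF LpD(2,3)[OF this]] show ?thesis by simp
qed

lemma normal_velocity_friction:
  assumes f: "frame t u a c"
  shows "(\<integral>x. (normal_velocity L {0..<T} (\<lambda>t x. \<gamma>0 x + \<phi> t x) t x \<bullet> X x) * norm (dx (\<gamma> t) x) \<partial>circle)
    = friction X (velocity t) (\<phi> t)"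
  unfolding friction_frame[OF f]
proof (rule integral_lebesgue_on_cong_AE[OF _ AE_interior])
  fix x assume x: "0 < x" "x < L"
  have "dx (\<gamma> t) x = u x" using f C2_on_dx[OF _ x] by (auto simp: frame_def)
  moreover have "u x \<noteq> 0" using frame_steep(2)[OF f] x by auto
  ultimately show "(normal_velocity L {0..<T} (\<lambda>t x. \<gamma>0 x + \<phi> t x) t x \<bullet> X x) * norm (dx (\<gamma> t) x)
      = velocity t x \<bullet> nproj (u x) (X x)"
    using nproj_velocity[of "u x" "velocity t x" "X x"] by (simp add: normal_velocity_def unit_tangent_def)
qed simp

lemma friction_scale: "friction (\<lambda>x. c *\<^sub>R X x) V w = c * friction X V w"
  unfolding friction_def linear_cmul[OF nproj_linear] inner_scaleR_right by (rule integral_mult_right_zero)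

lemma elastic_scale:
  assumes "smooth X"
  shows "elastic (\<lambda>x. c *\<^sub>R X x) w = c * elastic X w"
proof -
  have d: "dx (\<lambda>x. c *\<^sub>R f x) = (\<lambda>x. c *\<^sub>R dx f x)" if "smooth f" for f :: "real \<Rightarrow> 'a"
    using dx_scaleR[OF smooth_const that, of c] by (simp add: dx_const)
  show ?thesis
    unfolding elastic_def d[OF assms] d[OF smooth_has_vector_derivative(2)[OF assms]] ddensity_scale
    by (rule integral_mult_right_zero)
qed

text \<open>
  Testing the flow equation with \<open>\<zeta>(t) X(x)\<close> for all \<open>\<zeta>\<close> localises it in time. The exceptional
  null set of times depends on \<open>X\<close>.
\<close>
lemma flow_equation_at_times:
  assumes \<eta>: "mollifier \<eta>" and X: "smooth X" "periodic_fun_simple X L" "\<And>x. X x \<bullet> \<tau> x = 0"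
    and flow: "\<And>\<psi>. space_time_test L T \<psi> \<Longrightarrow> (\<forall>t x. \<psi> t x \<bullet> \<tau> x = 0) \<Longrightarrow>
      weak_flow_eq L T p lam (\<lambda>t x. \<gamma>0 x + \<phi> t x) \<psi>"
  shows "AE t in time. friction X (velocity t) (\<phi> t) + elastic X (\<phi> t) = 0"
proof (rule AE_zero_by_time_tests[OF \<eta> T])
  let ?f = "\<lambda>t. friction X (velocity t) (\<phi> t)" and ?e = "\<lambda>t. elastic X (\<phi> t)"
  have fi: "integrable time ?f" by (rule friction_integrable[OF velocity_L2 X(1,2)])
  have ei: "integrable time ?e" by (rule elastic_integrable[OF X(1,2)])
  show "integrable time (\<lambda>t. ?f t + ?e t)" using fi ei by auto
  fix \<zeta> :: "real \<Rightarrow> real" assume z: "smooth \<zeta>" "closure {t. \<zeta> t \<noteq> 0} \<subseteq> {0<..<T}"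
  let ?\<psi> = "\<lambda>t x. \<zeta> t *\<^sub>R X x"
  have "space_time_test L T ?\<psi>"
    unfolding space_time_test_def
  proof (intro conjI allI)
    have "smooth (\<lambda>z::real \<times> real. fst z)" "smooth (\<lambda>z::real \<times> real. snd z)"
      by (intro smooth_bounded_linear[OF bounded_linear_fst smooth_ident]
          smooth_bounded_linear[OF bounded_linear_snd smooth_ident])+
    then show "smooth (\<lambda>(t, x). ?\<psi> t x)"
      unfolding case_prod_beta' by (intro smooth_scaleR smooth_compose_real[OF z(1)] smooth_compose_real[OF X(1)])
    show "periodic_fun_simple (?\<psi> t) L" for t using X(2) by (simp add: periodic_fun_simple_def)
    have "{t. \<exists>x. ?\<psi> t x \<noteq> 0} \<subseteq> {t. \<zeta> t \<noteq> 0}" by auto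
    from closure_mono[OF this] z(2) show "closure {t. \<exists>x. ?\<psi> t x \<noteq> 0} \<subseteq> {0<..<T}" by blast
  qed
  moreover have "\<forall>t x. ?\<psi> t x \<bullet> \<tau> x = 0" using X(3) by simp
  ultimately have w: "weak_flow_eq L T p lam (\<lambda>t x. \<gamma>0 x + \<phi> t x) ?\<psi>" by (rule flow)
  have l: "(\<integral>t. (\<integral>x. (normal_velocity L {0..<T} (\<lambda>t x. \<gamma>0 x + \<phi> t x) t x \<bullet> ?\<psi> t x) * norm (dx (\<gamma> t) x) \<partial>circle) \<partial>time)
      = (\<integral>t. \<zeta> t * ?f t \<partial>time)"
  proof (rule integral_lebesgue_on_cong_AE)
    show "AE t in time. (\<integral>x. (normal_velocity L {0..<T} (\<lambda>t x. \<gamma>0 x + \<phi> t x) t x \<bullet> ?\<psi> t x) * norm (dx (\<gamma> t) x) \<partial>circle)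
       = \<zeta> t * ?f t"
      using frame_exists
    proof eventually_elim
      case (elim t)
      then obtain u a c where f: "frame t u a c" by blast
      show ?case unfolding normal_velocity_friction[OF f] friction_scale ..
    qed
  qed simp
  have r: "(\<integral>t. first_variation L p lam (?\<psi> t) (\<gamma> t) \<partial>time) = (\<integral>t. \<zeta> t * ?e t \<partial>time)"
  proof (rule integral_lebesgue_on_cong_AE)
    show "AE t in time. first_variation L p lam (?\<psi> t) (\<gamma> t) = \<zeta> t * ?e t"
      using frame_exists
    proof eventually_elim
      case (elim t)
      then obtain u a c where f: "frame t u a c" by blast
      have "smooth (?\<psi> t)" by (rule smooth_scaleR[OF smooth_const X(1)])
      moreover have "periodic_fun_simple (?\<psi> t) L" using X(2) by (simp add: periodic_fun_simple_def)
      ultimately show ?case using first_variation_elastic[OF f] elastic_scale[OF X(1)] by simp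
    qed
  qed simp
  have "(\<integral>t. \<zeta> t * ?f t \<partial>time) = - (\<integral>t. \<zeta> t * ?e t \<partial>time)"
    using w unfolding weak_flow_eq_def l r .
  moreover have "(\<integral>t. \<zeta> t * (?f t + ?e t) \<partial>time) = (\<integral>t. \<zeta> t * ?f t \<partial>time) + (\<integral>t. \<zeta> t * ?e t \<partial>time)"
    unfolding distrib_left
    by (intro Bochner_Integration.integral_add integrable_mult_continuous_Ico fi ei smooth_continuous z)
  ultimately show "(\<integral>t. \<zeta> t * (?f t + ?e t) \<partial>time) = 0" by simp
qed

text \<open>
  The projection of the vector \<open>i\<close> to the hyperplane orthogonal to \<open>\<tau>\<close>. Over a basis these
  fields span all fields orthogonal to \<open>\<tau>\<close>.
\<close>
definition normal_field :: "'a \<Rightarrow> real \<Rightarrow> 'a" where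
  "normal_field i x = i - (i \<bullet> \<tau> x) *\<^sub>R \<tau> x"

lemma normal_field:
  "smooth (normal_field i)" "periodic_fun_simple (normal_field i) L" "normal_field i x \<bullet> \<tau> x = 0"
proof -
  show "smooth (normal_field i)"
    unfolding normal_field_def by (intro smooth_diff smooth_const smooth_scaleR smooth_inner \<tau>)
  show "periodic_fun_simple (normal_field i) L"
    using \<tau>(2) by (simp add: periodic_fun_simple_def normal_field_def)
  have "\<tau> x \<bullet> \<tau> x = 1" using \<tau>(3)[of x] by (simp add: norm_eq_1)
  then show "normal_field i x \<bullet> \<tau> x = 0" by (simp add: normal_field_def inner_diff_left)
qed

lemma normal_field_sum:
  assumes "y \<bullet> \<tau> x = 0"
  shows "(\<Sum>i\<in>Basis. (y \<bullet> i) *\<^sub>R normal_field i x) = y"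
proof -
  have "(\<Sum>i\<in>Basis. (y \<bullet> i) *\<^sub>R normal_field i x)
      = (\<Sum>i\<in>Basis. (y \<bullet> i) *\<^sub>R i) - (\<Sum>i\<in>Basis. ((y \<bullet> i) * (i \<bullet> \<tau> x)) *\<^sub>R \<tau> x)"
    by (simp add: normal_field_def scaleR_diff_right sum_subtractf)
  also have "(\<Sum>i\<in>Basis. ((y \<bullet> i) * (i \<bullet> \<tau> x)) *\<^sub>R \<tau> x) = (y \<bullet> \<tau> x) *\<^sub>R \<tau> x"
    by (simp add: scaleR_sum_left[symmetric] euclidean_inner[of y "\<tau> x"] inner_commute)
  finally show ?thesis using assms by (simp add: euclidean_representation)
qed

text \<open>
  At a fixed time the equation is a linear functional of second order in \<open>X\<close>. Inserting
  \<open>X = \<psi> q\<^sub>i\<close> with \<open>q\<^sub>i\<close> the projected basis vector turns it into a scalar functional of \<open>\<psi>\<close>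
  for each \<open>i\<close>, with coefficients \<open>c\<^sub>0, c\<^sub>1, c\<^sub>2\<close>, to which the second-order lemma of du
  Bois-Reymond applies. The field \<open>Y\<close> is the sum of \<open>(Y \<bullet> i) q\<^sub>i\<close>.
\<close>
lemma stationary_on_normal_fields:
  fixes V Y Y1 Y2 :: "real \<Rightarrow> 'a"
  assumes f: "frame t u a c" and V: "integrable circle V"
    and tests: "\<And>i \<psi>. i \<in> Basis \<Longrightarrow> \<psi> = (\<lambda>_. 1) \<or> (\<exists>y\<in>\<rat>. \<exists>n. \<psi> = arc_potential L y n) \<Longrightarrow>
      friction (\<lambda>x. \<psi> x *\<^sub>R normal_field i x) V (\<phi> t) + elastic (\<lambda>x. \<psi> x *\<^sub>R normal_field i x) (\<phi> t) = 0"
    and Y: "W2_periodic L Y Y1 Y2" "\<And>x. x \<in> {0..L} \<Longrightarrow> Y x \<bullet> \<tau> x = 0"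
  shows "(\<integral>x. V x \<bullet> nproj (u x) (Y x) + ddensity p lam (u x) (a x) (Y1 x) (Y2 x) \<partial>circle) = 0"
proof -
  let ?q = normal_field
  let ?q1 = "\<lambda>i. dx (?q i)" and ?q2 = "\<lambda>i. dx (dx (?q i))"
  have sq: "smooth (?q i)" "smooth (?q1 i)" "smooth (?q2 i)" for i
    using normal_field(1) smooth_has_vector_derivative(2) by blast+
  have C2: "C2_on L (\<gamma> t) u a" using f by (simp add: frame_def)
  note cu = C2_on_continuous(1)[OF C2] and ca = C2_on_continuous(2)[OF C2]
  note nz = frame_steep(2)[OF f]
  let ?D = "\<lambda>x. ddensity p lam (u x) (a x)"
  define c0 where "c0 i x = V x \<bullet> nproj (u x) (?q i x) + ?D x (?q1 i x) (?q2 i x)" for i x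
  define c1 where "c1 i x = ?D x (?q i x) (2 *\<^sub>R ?q1 i x)" for i x
  define c2 where "c2 i x = ?D x 0 (?q i x)" for i x
  have expand: "V x \<bullet> nproj (u x) (s *\<^sub>R ?q i x)
      + ?D x (s *\<^sub>R ?q1 i x + s1 *\<^sub>R ?q i x) ((s *\<^sub>R ?q2 i x + s1 *\<^sub>R ?q1 i x) + (s1 *\<^sub>R ?q1 i x + s2 *\<^sub>R ?q i x))
     = c0 i x * s + c1 i x * s1 + c2 i x * s2" for i x s s1 s2
  proof -
    have "?D x (s *\<^sub>R ?q1 i x + s1 *\<^sub>R ?q i x) ((s *\<^sub>R ?q2 i x + s1 *\<^sub>R ?q1 i x) + (s1 *\<^sub>R ?q1 i x + s2 *\<^sub>R ?q i x))
        = ?D x (s *\<^sub>R ?q1 i x + (s1 *\<^sub>R ?q i x + s2 *\<^sub>R 0)) (s *\<^sub>R ?q2 i x + (s1 *\<^sub>R (2 *\<^sub>R ?q1 i x) + s2 *\<^sub>R ?q i x))"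
      by (simp add: scaleR_2 scaleR_add_right add.assoc)
    also have "\<dots> = s * ?D x (?q1 i x) (?q2 i x) + (s1 * c1 i x + s2 * c2 i x)"
      unfolding ddensity_add ddensity_scale c1_def c2_def ..
    finally show ?thesis
      using linear_cmul[OF nproj_linear, of "u x" s "?q i x"] by (simp add: c0_def algebra_simps)
  qed
  have ic0: "integrable circle (c0 i)" for i
    unfolding c0_def[abs_def]
    by (intro Bochner_Integration.integrable_add friction_integrand_integrable[OF V cu smooth_continuous[OF sq(1)] nz]
        ddensity_integrable[OF p cu ca smooth_continuous[OF sq(2)] integrable_lebesgue_on_continuous[OF smooth_continuous[OF sq(3)]] nz])
  have cq: "continuous_on {0..L} (\<lambda>x. 2 *\<^sub>R ?q1 i x)" for i
    by (intro continuous_on_scaleR continuous_on_const smooth_continuous sq)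
  have cc1: "continuous_on {0..L} (c1 i)" for i
    unfolding c1_def[abs_def]
    by (rule continuous_ddensity[OF p cu ca smooth_continuous[OF sq(1)] cq nz])
  have cc2: "continuous_on {0..L} (c2 i)" for i
    unfolding c2_def[abs_def]
    by (rule continuous_ddensity[OF p cu ca continuous_on_const smooth_continuous[OF sq(1)] nz])
  have test0: "(\<integral>x. c0 i x * \<psi> x + c1 i x * dx \<psi> x + c2 i x * dx (dx \<psi>) x \<partial>circle) = 0"
    if i: "i \<in> Basis" and \<psi>: "smooth \<psi>" "\<psi> = (\<lambda>_. 1) \<or> (\<exists>y\<in>\<rat>. \<exists>n. \<psi> = arc_potential L y n)" for i and \<psi> :: "real \<Rightarrow> real"
  proof -
    let ?X = "\<lambda>x. \<psi> x *\<^sub>R ?q i x"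
    have s1: "smooth (dx \<psi>)" "smooth (dx (dx \<psi>))" using \<psi>(1) smooth_has_vector_derivative(2) by blast+
    have sX: "smooth ?X" by (intro smooth_scaleR \<psi>(1) sq)
    have sX': "smooth (dx ?X)" "smooth (dx (dx ?X))" using sX smooth_has_vector_derivative(2) by blast+
    have i1: "integrable circle (\<lambda>x. V x \<bullet> nproj (u x) (?X x))"
      by (rule friction_integrand_integrable[OF V cu smooth_continuous[OF sX] nz])
    have i2: "integrable circle (\<lambda>x. ?D x (dx ?X x) (dx (dx ?X) x))"
      by (rule ddensity_integrable[OF p cu ca smooth_continuous[OF sX'(1)] integrable_lebesgue_on_continuous[OF smooth_continuous[OF sX'(2)]] nz])
    have "(\<integral>x. V x \<bullet> nproj (u x) (?X x) + ?D x (dx ?X x) (dx (dx ?X) x) \<partial>circle) = 0"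
      using tests[OF i \<psi>(2)] i1 i2 unfolding friction_frame[OF f] elastic_frame[OF f] by simp
    moreover have "V x \<bullet> nproj (u x) (?X x) + ?D x (dx ?X x) (dx (dx ?X) x)
        = c0 i x * \<psi> x + c1 i x * dx \<psi> x + c2 i x * dx (dx \<psi>) x" for x
      unfolding fun_cong[OF dx_dx_scaleR[OF \<psi>(1) sq(1)[of i]], of x]
      unfolding fun_cong[OF dx_scaleR[OF \<psi>(1) sq(1)[of i]], of x] by (rule expand)
    ultimately show ?thesis by (simp only:)
  qed
  have c00: "(\<integral>x. c0 i x \<partial>circle) = 0" if i: "i \<in> Basis" for i
    using test0[OF i smooth_const, of 1] by (simp add: dx_const)
  have arc0: "(\<integral>x. c0 i x * arc_potential L y n x + c1 i x * dx (arc_potential L y n) x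
           + c2 i x * dx (dx (arc_potential L y n)) x \<partial>circle) = 0" if "i \<in> Basis" "y \<in> \<rat>" for i y n
    by (rule test0[OF that(1) arc_potential(1)[OF L]]) (use that in blast)
  let ?w = "\<lambda>i x. Y x \<bullet> i" and ?w1 = "\<lambda>i x. Y1 x \<bullet> i" and ?w2 = "\<lambda>i x. Y2 x \<bullet> i"
  have w: "W2_periodic L (?w i) (?w1 i) (?w2 i)" for i
    using Y(1) unfolding W2_periodic_def
    by (intro conjI primitive_bounded_linear[OF bounded_linear_inner_left]) simp_all
  have w': "primitive L (?w i) (?w1 i)" "primitive L (?w1 i) (?w2 i)" "?w i L = ?w i 0" "?w1 i L = ?w1 i 0" for i
    using w[of i] by (auto simp: W2_periodic_def)
  have ic1: "integrable circle (c1 i)" and ic2: "integrable circle (c2 i)" for i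
    by (intro integrable_lebesgue_on_continuous cc1 cc2)+
  have zero: "(\<integral>x. c0 i x * ?w i x + c1 i x * ?w1 i x + c2 i x * ?w2 i x \<partial>circle) = 0"
    and int2: "integrable circle (\<lambda>x. c2 i x * ?w2 i x)" if i: "i \<in> Basis" for i
    using second_order_du_Bois_Reymond[OF L ic0 ic1 ic2 c00[OF i] arc0[OF i] w'] by auto
  have int: "integrable circle (\<lambda>x. c0 i x * ?w i x + c1 i x * ?w1 i x + c2 i x * ?w2 i x)" if i: "i \<in> Basis" for i
  proof -
    have "integrable circle (\<lambda>x. ?w i x * c0 i x)"
      by (rule integrable_mult_continuous[OF ic0 primitive_continuous[OF w'(1)]])
    moreover have "integrable circle (\<lambda>x. c1 i x * ?w1 i x)"
      by (rule integrable_lebesgue_on_continuous[OF continuous_on_mult[OF cc1 primitive_continuous[OF w'(2)]]])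
    ultimately show ?thesis using int2[OF i] by (simp add: mult.commute)
  qed
  have e: "\<forall>x\<in>{0..L}. Y x = (\<Sum>i\<in>Basis. ?w i x *\<^sub>R ?q i x)"
    using normal_field_sum[OF Y(2)] by simp
  note ex = W2_periodic_expand[OF L Y(1) finite_Basis sq(1) w e]
  have "AE x in circle. x \<in> {0..L}" by (rule AE_I2) simp
  with ex(2) have ae: "AE x in circle. V x \<bullet> nproj (u x) (Y x) + ?D x (Y1 x) (Y2 x)
      = (\<Sum>i\<in>Basis. c0 i x * ?w i x + c1 i x * ?w1 i x + c2 i x * ?w2 i x)"
  proof eventually_elim
    case (elim x)
    let ?A1 = "\<lambda>i. ?w i x *\<^sub>R ?q1 i x + ?w1 i x *\<^sub>R ?q i x"
    let ?A2 = "\<lambda>i. (?w i x *\<^sub>R ?q2 i x + ?w1 i x *\<^sub>R ?q1 i x) + (?w1 i x *\<^sub>R ?q1 i x + ?w2 i x *\<^sub>R ?q i x)"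
    have "V x \<bullet> nproj (u x) (Y x) = (\<Sum>i\<in>Basis. V x \<bullet> nproj (u x) (?w i x *\<^sub>R ?q i x))"
      unfolding inner_sum_right[symmetric] linear_sum[OF nproj_linear, symmetric] e[rule_format, OF elim(2), symmetric] ..
    moreover have "?D x (Y1 x) (Y2 x) = (\<Sum>i\<in>Basis. ?D x (?A1 i) (?A2 i))"
    proof -
      have "?D x (Y1 x) (Y2 x) = ?D x (\<Sum>i\<in>Basis. ?A1 i) (\<Sum>i\<in>Basis. ?A2 i)"
        using elim(1) ex(1)[rule_format, OF elim(2)] by simp
      also have "\<dots> = (\<lambda>h. ?D x (fst h) (snd h)) (\<Sum>i\<in>Basis. (?A1 i, ?A2 i))"
        by (simp add: fst_sum snd_sum)
      also have "\<dots> = (\<Sum>i\<in>Basis. (\<lambda>h. ?D x (fst h) (snd h)) (?A1 i, ?A2 i))"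
        by (rule linear_sum[OF ddensity_linear])
      finally show ?thesis by simp
    qed
    ultimately have "V x \<bullet> nproj (u x) (Y x) + ?D x (Y1 x) (Y2 x)
      = (\<Sum>i\<in>Basis. V x \<bullet> nproj (u x) (?w i x *\<^sub>R ?q i x) + ?D x (?A1 i) (?A2 i))"
      by (simp only: sum.distrib)
    then show ?case by (simp only: expand)
  qed
  have "(\<integral>x. V x \<bullet> nproj (u x) (Y x) + ?D x (Y1 x) (Y2 x) \<partial>circle)
      = (\<integral>x. (\<Sum>i\<in>Basis. c0 i x * ?w i x + c1 i x * ?w1 i x + c2 i x * ?w2 i x) \<partial>circle)"
    by (rule integral_lebesgue_on_cong_AE[OF _ ae]) simp
  also have "\<dots> = (\<Sum>i\<in>Basis. (\<integral>x. c0 i x * ?w i x + c1 i x * ?w1 i x + c2 i x * ?w2 i x \<partial>circle))"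
    by (intro Bochner_Integration.integral_sum int)
  also have "\<dots> = 0" using zero by simp
  finally show ?thesis .
qed

text \<open>
  The field \<open>X\<close> is split into \<open>g u\<close> with \<open>g = (X \<bullet> \<tau>) / (u \<bullet> \<tau>)\<close> and a rest that is orthogonal
  to \<open>\<tau>\<close>. The tangential part contributes neither to the friction nor to the first variation.
  The rest has only two weak derivatives, since \<open>g\<close> and \<open>u\<close> do.
\<close>
lemma stationary_on_all_fields:
  fixes V X :: "real \<Rightarrow> 'a"
  assumes f: "frame t u a c" and V: "integrable circle V"
    and tests: "\<And>i \<psi>. i \<in> Basis \<Longrightarrow> \<psi> = (\<lambda>_. 1) \<or> (\<exists>y\<in>\<rat>. \<exists>n. \<psi> = arc_potential L y n) \<Longrightarrow>
      friction (\<lambda>x. \<psi> x *\<^sub>R normal_field i x) V (\<phi> t) + elastic (\<lambda>x. \<psi> x *\<^sub>R normal_field i x) (\<phi> t) = 0"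
    and X: "smooth X" "periodic_fun_simple X L"
  shows "friction X V (\<phi> t) + elastic X (\<phi> t) = 0"
proof -
  have C2: "C2_on L (\<gamma> t) u a" and c: "primitive L a c" "a L = a 0"
    and st: "\<And>x. x \<in> {0..L} \<Longrightarrow> u x \<bullet> \<tau> x \<ge> 1 / 2"
    using f by (auto simp: frame_def)
  note cu = C2_on_continuous(1)[OF C2] and ca = C2_on_continuous(2)[OF C2] and ua = C2_on_continuous(3)[OF C2]
  note nz = frame_steep(2)[OF f]
  have uL: "u L = u 0" using C2 by (simp add: C2_on_def)
  have Wu: "W2_periodic L u a c" using ua c uL by (simp add: W2_periodic_def)
  have WX: "W2_periodic L X (dx X) (dx (dx X))" by (rule W2_periodic_smooth[OF X])
  have W\<tau>: "W2_periodic L \<tau> (dx \<tau>) (dx (dx \<tau>))" by (rule W2_periodic_smooth[OF \<tau>(1,2)])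
  have pos: "u x \<bullet> \<tau> x > 0" if "x \<in> {0..L}" for x using st[OF that] by linarith
  obtain k1 k2 where k: "W2_periodic L (\<lambda>x. inverse (u x \<bullet> \<tau> x)) k1 k2"
    using W2_periodic_inverse[OF W2_periodic_bilinear[OF bounded_bilinear_inner Wu W\<tau>] pos] by blast
  define g where "g x = (X x \<bullet> \<tau> x) * inverse (u x \<bullet> \<tau> x)" for x
  obtain g1 g2 where g: "W2_periodic L g g1 g2"
    unfolding g_def[abs_def]
    using W2_periodic_bilinear[OF bounded_bilinear_mult W2_periodic_bilinear[OF bounded_bilinear_inner WX W\<tau>] k] by blast
  then have g': "primitive L g g1" "primitive L g1 g2" "g L = g 0" by (auto simp: W2_periodic_def)
  note Wgu = W2_periodic_bilinear[OF bounded_bilinear_scaleR g Wu]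
  note WY = W2_periodic_diff[OF WX Wgu]
  let ?T1 = "\<lambda>x. g x *\<^sub>R a x + g1 x *\<^sub>R u x"
  let ?T2 = "\<lambda>x. (g x *\<^sub>R c x + g1 x *\<^sub>R a x) + (g1 x *\<^sub>R a x + g2 x *\<^sub>R u x)"
  let ?D = "\<lambda>x. ddensity p lam (u x) (a x)"
  have orth: "(X x - g x *\<^sub>R u x) \<bullet> \<tau> x = 0" if "x \<in> {0..L}" for x
    using pos[OF that] by (simp add: g_def inner_diff_left)
  have main: "(\<integral>x. V x \<bullet> nproj (u x) (X x - g x *\<^sub>R u x) + ?D x (dx X x - ?T1 x) (dx (dx X) x - ?T2 x) \<partial>circle) = 0"
    by (rule stationary_on_normal_fields[OF f V tests WY orth])
  have tang: "(\<integral>x. ?D x (?T1 x) (?T2 x) \<partial>circle) = 0"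
  proof -
    have e: "?D x (?T1 x) (?T2 x) = ?D x (g1 x *\<^sub>R u x + g x *\<^sub>R a x) (g2 x *\<^sub>R u x + (2 * g1 x) *\<^sub>R a x + g x *\<^sub>R c x)" for x
    proof -
      have "?T2 x = g2 x *\<^sub>R u x + (2 * g1 x) *\<^sub>R a x + g x *\<^sub>R c x"
      proof -
        have two: "(2 * g1 x) *\<^sub>R a x = g1 x *\<^sub>R a x + g1 x *\<^sub>R a x" by (simp only: mult_2 scaleR_add_left)
        show ?thesis unfolding two by (simp only: add_ac)
      qed
      then show ?thesis by (simp only: add.commute[of "g x *\<^sub>R a x"])
    qed
    show ?thesis
      unfolding e by (rule tangential_variation_zero[OF p less_imp_le[OF L] ua c(1) uL c(2) nz g'])
  qed
  have sX': "smooth (dx X)" "smooth (dx (dx X))" using X(1) smooth_has_vector_derivative(2) by blast+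
  have i1: "integrable circle (\<lambda>x. V x \<bullet> nproj (u x) (X x))"
    by (rule friction_integrand_integrable[OF V cu smooth_continuous[OF X(1)] nz])
  have i2: "integrable circle (\<lambda>x. ?D x (dx X x) (dx (dx X) x))"
    by (rule ddensity_integrable[OF p cu ca smooth_continuous[OF sX'(1)] integrable_lebesgue_on_continuous[OF smooth_continuous[OF sX'(2)]] nz])
  have i3: "integrable circle (\<lambda>x. ?D x (?T1 x) (?T2 x))"
    by (rule ddensity_integrable[OF p cu ca _ _ nz])
       (use Wgu primitive_continuous primitive_integrable in \<open>auto simp: W2_periodic_def\<close>)
  have pw: "V x \<bullet> nproj (u x) (X x - g x *\<^sub>R u x) + ?D x (dx X x - ?T1 x) (dx (dx X) x - ?T2 x)
      = V x \<bullet> nproj (u x) (X x) + ?D x (dx X x) (dx (dx X) x) - ?D x (?T1 x) (?T2 x)" for x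
    using linear_diff[OF ddensity_linear, of p lam "u x" "a x" "(dx X x, dx (dx X) x)" "(?T1 x, ?T2 x)"]
    by (simp add: nproj_diff nproj_tangent)
  have "(\<integral>x. V x \<bullet> nproj (u x) (X x) \<partial>circle) + (\<integral>x. ?D x (dx X x) (dx (dx X) x) \<partial>circle) = 0"
    using main i1 i2 i3 tang unfolding pw by simp
  then show ?thesis unfolding friction_frame[OF f] elastic_frame[OF f] .
qed

text \<open>
  The countably many tests leave one null set of exceptional times. At all other times the two
  integrands agree for every smooth periodic field, in particular for \<open>\<psi> t\<close>, so the time
  integrals agree whatever their integrability.
\<close>
lemma flow_equation_all_tests:
  assumes \<eta>: "mollifier \<eta>"
    and flow: "\<And>\<psi>. space_time_test L T \<psi> \<Longrightarrow> (\<forall>t x. \<psi> t x \<bullet> \<tau> x = 0) \<Longrightarrow>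
      weak_flow_eq L T p lam (\<lambda>t x. \<gamma>0 x + \<phi> t x) \<psi>"
    and \<psi>: "space_time_test L T \<psi>"
  shows "weak_flow_eq L T p lam (\<lambda>t x. \<gamma>0 x + \<phi> t x) \<psi>"
proof -
  let ?E = "\<lambda>X t. friction X (velocity t) (\<phi> t) + elastic X (\<phi> t) = 0"
  have test: "AE t in time. ?E (\<lambda>x. \<xi> x *\<^sub>R normal_field i x) t"
    if \<xi>: "smooth \<xi>" "periodic_fun_simple \<xi> L" for \<xi> i
  proof (rule flow_equation_at_times[OF \<eta> _ _ _ flow])
    show "smooth (\<lambda>x. \<xi> x *\<^sub>R normal_field i x)" by (intro smooth_scaleR \<xi>(1) normal_field(1))
    show "periodic_fun_simple (\<lambda>x. \<xi> x *\<^sub>R normal_field i x) L"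
      using \<xi>(2) normal_field(2)[of i] by (simp add: periodic_fun_simple_def)
    show "(\<xi> x *\<^sub>R normal_field i x) \<bullet> \<tau> x = 0" for x by (simp add: normal_field(3))
  qed
  have "AE t in time. \<forall>i\<in>Basis. ?E (\<lambda>x. 1 *\<^sub>R normal_field i x) t"
    by (intro AE_finite_allI finite_Basis test smooth_const) (simp add: periodic_fun_simple_def)
  moreover have "AE t in time. \<forall>i\<in>Basis. \<forall>y\<in>\<rat>. \<forall>n. ?E (\<lambda>x. arc_potential L y n x *\<^sub>R normal_field i x) t"
    by (intro AE_finite_allI finite_Basis AE_ball_countable[THEN iffD2] countable_rat ballI AE_all_countable[THEN iffD2] allI
        test arc_potential[OF L])
  ultimately have point: "AE t in time. \<forall>X. smooth X \<longrightarrow> periodic_fun_simple X L \<longrightarrow> ?E X t"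
    using frame_exists
  proof eventually_elim
    case (elim t)
    then obtain u a c where t: "t \<in> {0..<T}" and f: "frame t u a c" by blast
    show ?case
    proof (intro allI impI)
      fix X :: "real \<Rightarrow> 'a" assume X: "smooth X" "periodic_fun_simple X L"
      show "?E X t"
      proof (rule stationary_on_all_fields[OF f velocity_integrable[OF t] _ X])
        fix i :: 'a and \<xi> :: "real \<Rightarrow> real"
        assume "i \<in> Basis" "\<xi> = (\<lambda>_. 1) \<or> (\<exists>y\<in>\<rat>. \<exists>n. \<xi> = arc_potential L y n)"
        then show "?E (\<lambda>x. \<xi> x *\<^sub>R normal_field i x) t" using elim(1,2) by auto
      qed
    qed
  qed
  have s: "smooth (\<psi> t)" "periodic_fun_simple (\<psi> t) L" for t
    using \<psi> smooth_slice unfolding space_time_test_def by blast+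
  have "(\<integral>t. (\<integral>x. (normal_velocity L {0..<T} (\<lambda>t x. \<gamma>0 x + \<phi> t x) t x \<bullet> \<psi> t x) * norm (dx (\<gamma> t) x) \<partial>circle) \<partial>time)
     = (\<integral>t. - first_variation L p lam (\<psi> t) (\<gamma> t) \<partial>time)"
  proof (rule integral_lebesgue_on_cong_AE)
    show "AE t in time. (\<integral>x. (normal_velocity L {0..<T} (\<lambda>t x. \<gamma>0 x + \<phi> t x) t x \<bullet> \<psi> t x) * norm (dx (\<gamma> t) x) \<partial>circle)
        = - first_variation L p lam (\<psi> t) (\<gamma> t)"
      using point frame_exists
    proof eventually_elim
      case (elim t)
      then obtain u a c where f: "frame t u a c" by blast
      have "?E (\<psi> t) t" using elim(1) s by blast
      then show ?case unfolding normal_velocity_friction[OF f] first_variation_elastic[OF f s] by linarith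
    qed
  qed simp
  then show ?thesis unfolding weak_flow_eq_def by simp
qed

end

theorem corollary1p2:
  fixes p lam L T :: real
    and \<eta> :: "real \<Rightarrow> real"
    and \<Gamma> \<gamma>0 \<tau> :: "real \<Rightarrow> real ^ 'n"
    and \<phi> \<gamma> :: "real \<Rightarrow> real \<Rightarrow> real ^ 'n"
  assumes "p > 2" and "lam > 0" and "L > 0" and "0 < T"
    and "mollifier \<eta>"
    and "\<Gamma> \<in> Wc L 2 p" and "arclength_param \<Gamma>"
    and "smooth \<gamma>0" and "periodic_fun_simple \<gamma>0 L" and "arclength_param \<gamma>0"
    and "unit_quasi_tangent \<eta> p L \<gamma>0 \<tau>"
    and "\<phi> \<in> Linfty_into {0..<T} (Wc L 2 p) (sobolev_norm L 2 p)"
    and "\<phi> \<in> W12_into {0..<T} (Lp L 2) (Lp_norm L 2)"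
    and "\<phi> \<in> Holder_into (1/2) {0..<T} (Lp L 2) (Lp_norm L 2)"
    and "\<forall>t\<in>{0..<T}. \<forall>x. \<phi> t x \<bullet> \<tau> x = 0"
    and "\<gamma> = (\<lambda>t x. \<gamma>0 x + \<phi> t x)"
    and "\<forall>t\<in>{0..<T}. \<forall>x. dx (\<gamma> t) x \<bullet> \<tau> x \<ge> 1/2"
    and "\<exists>\<sigma>. reparametrisation L \<sigma> \<and> \<gamma> 0 = \<Gamma> \<circ> \<sigma>"
    and "\<forall>\<psi>. space_time_test L T \<psi> \<and> (\<forall>t x. \<psi> t x \<bullet> \<tau> x = 0)
           \<longrightarrow> weak_flow_eq L T p lam \<gamma> \<psi>"
    and "AE t in lebesgue_on {0..<T}. \<gamma> t \<in> Wc L 3 p"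
  shows "\<forall>\<psi>. space_time_test L T \<psi> \<longrightarrow> weak_flow_eq L T p lam \<gamma> \<psi>"
proof -
  note g = assms(16)
  have \<tau>: "smooth \<tau>" "periodic_fun_simple \<tau> L" "norm (\<tau> x) = 1" for x
    using quasi_tangent_smooth[OF assms(3,5,8,9,11)] by blast+
  have steep: "1 / 2 \<le> dx (\<lambda>x. \<gamma>0 x + \<phi> t x) x \<bullet> \<tau> x" if "t \<in> {0..<T}" for t x
    using assms(17) that unfolding g by blast
  have W3: "AE t in lebesgue_on {0..<T}. (\<lambda>x. \<gamma>0 x + \<phi> t x) \<in> Wc L 3 p"
    using assms(20) unfolding g .
  interpret graph_evolution p lam L T \<gamma>0 \<tau> \<phi>
    by (rule graph_evolution.intro[OF assms(1,3,4,8,9) \<tau> assms(12,13) steep W3])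
  show ?thesis
    using flow_equation_all_tests[OF assms(5)] assms(19) unfolding g by blast
qed

end
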